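(* Fix an integer $n\ge 2$. Let $D$ be an affine arc torsion class. The triangulation associated to the torsion class $\psi(D)$ of $A_{\mathcal Q}$ consists of the following: (i) all tagged arcs $\mathfrak a_{a,b}$ such that $\gamma_{a,b}\in D$ and there do not exist $a<b'\le b<c<a+n$ with $\gamma_{b',c}\in D$; (ii) all notched radial arcs $\mathfrak r_a$ such that there do not exist $a'\le a<b'$ satisfying $\gamma_{a',b'}\in D$.
   Context: Fix an integer $n\ge 2$. A reflection index is a pair $(a,b)$ of integers with $a<b$, up to simultaneous translation by multiples of $n$. Real arcs are symbols $\gamma_{a,b}$ indexed by reflection indices $(a,b)$ with $b-a<n$. An affine arc torsion class is a set $D$ of real arcs such that: if $\gamma_{a,c}\in D$ and $a<b<c$, then $\gamma_{a,b}\in D$; and if $\gamma_{a,b},\gamma_{b,c}\in D$ and $c-a<n$, then $\gamma_{a,c}\in D$. Let $\mathcal Q$ be the oriented cycle quiver with vertices $\mathbb Z/n\mathbb Z$ and arrows $i\to i+1$. The affine Tamari algebra $A_{\mathcal Q}$ is the quotient of the path algebra $\mathbb C[\mathcal Q]$ by the ideal generated by all paths of length $n-1$. Representations are finite-dimensional modules, i.e. finite-dimensional spaces $M^i$ and maps $L^i\colon M^i\to M^{i+1}$ such that compositions of $n-1$ consecutive maps vanish. For $a<b<a+n$, $M_{a,b}=M_{\gamma_{a,b}}$ is the representation with $\mathbb C$ at (residues of) $a\le i\le b-1$, $0$ elsewhere, identity maps $L^i$ for $a\le i\le b-2$, other maps $0$; these are all the indecomposables and all the bricks up to isomorphism. A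 torsion class is a collection of representations closed under isomorphisms, quotients, and extensions; it is determined by, and identified with, the set of bricks it contains. $\psi(D)=\{M_\gamma\mid\gamma\in D\}$, viewed as a torsion class under this identification (i.e., the torsion class whose bricks are exactly the modules $M_\gamma$, $\gamma\in D$). Let $\mathbf P^\bullet$ be a regular $n$-gon with its center $\bullet$ removed. Label its edges $1,\ldots,n$ clockwise (in $\mathbb Z/n\mathbb Z$). Tagged arcs: for $a<b\le a+n-2$, $\mathfrak a_{a,b}$ is the arc that starts at the vertex immediately counterclockwise of edge $a$ and moves clockwise around $\bullet$ to the vertex immediately clockwise of edge $b$; $\mathfrak a_{a,a+n-1}$ is the plain radial arc joining $\bullet$ to the vertex between edges $a-1$ and $a$; $\mathfrak r_a$ is the notched radial arc joining $\bullet$ to the vertex immediately clockwise of edge $a$. The s$\tau$-tilting module of a torsion class $\mathcal T$ is the direct sum, each with multiplicity one, of all indecomposable $M\in\mathcal T$ with $\mathrm{Ext}^1_{A_{\mathcal Q}}(M,N)=0$ for every $N\in\mathcal T$. (Every $N\in\mathcal T$ is then a quotient of a direct sum of copies of it.) The triangulation of $\mathcal T$ is the set of tagged arcs consisting of all $\mathfrak a_{a,b}$ such that $M_{a,b}$ is a summand of the s$\tau$-tilting module of $\mathcal T$ and all $\mathfrak r_a$ such that the simple module $M_{a,a+1}$ is not a subquotient of any element of $\mathcal T$. *)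

theory Defs
  imports "Jordan_Normal_Form.Matrix_Kernel"
begin

text \<open>Throughout, a family indexed by Z/nZ is an n-periodic family indexed by the integers.\<close>

subsection \<open>Real arcs and affine arc torsion classes\<close>

text \<open>The symbol \<gamma>(a,b) is identified with its reflection index: the class of the pair (a,b) under
  simultaneous translation by multiples of n.\<close>

definition arc :: "int \<Rightarrow> int \<Rightarrow> int \<Rightarrow> (int \<times> int) set" where
  "arc n a b = {(a + k * n, b + k * n) | k. True}"

definition real_arcs :: "int \<Rightarrow> (int \<times> int) set set" where
  "real_arcs n = {arc n a b | a b. a < b \<and> b - a < n}"

definition affine_arc_torsion_class :: "int \<Rightarrow> (int \<times> int) set set \<Rightarrow> bool" where
  "affine_arc_torsion_class n D \<longleftrightarrow>
     D \<subseteq> real_arcs n \<and>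
     (\<forall>a b c. arc n a c \<in> D \<and> a < b \<and> b < c \<longrightarrow> arc n a b \<in> D) \<and>
     (\<forall>a b c. arc n a b \<in> D \<and> arc n b c \<in> D \<and> a < b \<and> b < c \<and> c - a < n \<longrightarrow> arc n a c \<in> D)"

subsection \<open>Representations of the affine Tamari algebra\<close>

text \<open>The space at vertex i is the coordinate space of complex column vectors of dimension
  \<open>vdim M i\<close>, and the arrow from i to i + 1 acts by the matrix \<open>vmap M i\<close>.
  Up to isomorphism these are all finite-dimensional representations.\<close>

record qrep =
  vdim :: "int \<Rightarrow> nat"
  vmap :: "int \<Rightarrow> complex mat"

text \<open>Action of the path of length k starting at vertex i.\<close>

fun path_map :: "qrep \<Rightarrow> int \<Rightarrow> nat \<Rightarrow> complex mat" where
  "path_map M i 0 = 1\<^sub>m (vdim M i)"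
| "path_map M i (Suc k) = vmap M (i + int k) * path_map M i k"

definition rep :: "int \<Rightarrow> qrep \<Rightarrow> bool" where
  "rep n M \<longleftrightarrow>
     (\<forall>i. vdim M (i + n) = vdim M i \<and> vmap M (i + n) = vmap M i \<and>
          vmap M i \<in> carrier_mat (vdim M (i + 1)) (vdim M i)) \<and>
     (\<forall>i. path_map M i (nat (n - 1)) = 0\<^sub>m (vdim M (i + (n - 1))) (vdim M i))"

type_synonym qmap = "int \<Rightarrow> complex mat"

definition rep_hom :: "int \<Rightarrow> qrep \<Rightarrow> qrep \<Rightarrow> qmap set" where
  "rep_hom n M N = {f. \<forall>i. f (i + n) = f i \<and> f i \<in> carrier_mat (vdim N i) (vdim M i) \<and>
                           f (i + 1) * vmap M i = vmap N i * f i}"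

definition rep_iso :: "int \<Rightarrow> qrep \<Rightarrow> qrep \<Rightarrow> qmap set" where
  "rep_iso n M N = {f \<in> rep_hom n M N. \<exists>g \<in> rep_hom n N M.
                      \<forall>i. g i * f i = 1\<^sub>m (vdim M i) \<and> f i * g i = 1\<^sub>m (vdim N i)}"

definition rep_inj :: "int \<Rightarrow> qrep \<Rightarrow> qrep \<Rightarrow> qmap set" where
  "rep_inj n M N = {f \<in> rep_hom n M N. \<forall>i. inj_on ((*\<^sub>v) (f i)) (carrier_vec (vdim M i))}"

definition rep_surj :: "int \<Rightarrow> qrep \<Rightarrow> qrep \<Rightarrow> qmap set" where
  "rep_surj n M N = {f \<in> rep_hom n M N.
                       \<forall>i. (*\<^sub>v) (f i) ` carrier_vec (vdim M i) = carrier_vec (vdim N i)}"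

definition isomorphic :: "int \<Rightarrow> qrep \<Rightarrow> qrep \<Rightarrow> bool" where
  "isomorphic n M N \<longleftrightarrow> rep_iso n M N \<noteq> {}"

definition is_quotient :: "int \<Rightarrow> qrep \<Rightarrow> qrep \<Rightarrow> bool" where
  "is_quotient n Q M \<longleftrightarrow> rep n Q \<and> rep_surj n M Q \<noteq> {}"

definition subquotient :: "int \<Rightarrow> qrep \<Rightarrow> qrep \<Rightarrow> bool" where
  "subquotient n Q M \<longleftrightarrow> (\<exists>U. rep n U \<and> rep_inj n U M \<noteq> {} \<and> is_quotient n Q U)"

definition is_zero :: "qrep \<Rightarrow> bool" where
  "is_zero M \<longleftrightarrow> (\<forall>i. vdim M i = 0)"

definition direct_sum :: "qrep list \<Rightarrow> qrep" where
  "direct_sum Ms = \<lparr> vdim = (\<lambda>i. sum_list (map (\<lambda>M. vdim M i) Ms)),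
                     vmap = (\<lambda>i. diag_block_mat (map (\<lambda>M. vmap M i) Ms)) \<rparr>"

definition summand :: "int \<Rightarrow> qrep \<Rightarrow> qrep \<Rightarrow> bool" where
  "summand n M P \<longleftrightarrow> (\<exists>Q. rep n Q \<and> isomorphic n P (direct_sum [M, Q]))"

definition indecomposable :: "int \<Rightarrow> qrep \<Rightarrow> bool" where
  "indecomposable n M \<longleftrightarrow> rep n M \<and> \<not> is_zero M \<and>
     (\<forall>U V. rep n U \<and> rep n V \<and> isomorphic n M (direct_sum [U, V]) \<longrightarrow> is_zero U \<or> is_zero V)"

text \<open>A brick is a representation whose endomorphism ring is a division ring.\<close>

definition brick :: "int \<Rightarrow> qrep \<Rightarrow> bool" where
  "brick n M \<longleftrightarrow> rep n M \<and> \<not> is_zero M \<and>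
     (\<forall>f \<in> rep_hom n M M. (\<exists>i. f i \<noteq> 0\<^sub>m (vdim M i) (vdim M i)) \<longrightarrow> f \<in> rep_iso n M M)"

text \<open>The representation M(a,b), intended for a < b < a + n.\<close>

definition interval_rep :: "int \<Rightarrow> int \<Rightarrow> int \<Rightarrow> qrep" where
  "interval_rep n a b =
     (let d = (\<lambda>i. if \<exists>k. a \<le> i + k * n \<and> i + k * n \<le> b - 1 then 1 else 0) in
      \<lparr> vdim = d,
        vmap = (\<lambda>i. if \<exists>k. a \<le> i + k * n \<and> i + k * n \<le> b - 2 then 1\<^sub>m 1
                    else 0\<^sub>m (d (i + 1)) (d i)) \<rparr>)"

subsection \<open>Extensions\<close>

text \<open>Short exact sequences from N through E to M, with E again a representation of the
  affine Tamari algebra.\<close>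

definition extensions :: "int \<Rightarrow> qrep \<Rightarrow> qrep \<Rightarrow> (qrep \<times> qmap \<times> qmap) set" where
  "extensions n M N = {(E, f, g). rep n E \<and> f \<in> rep_inj n N E \<and> g \<in> rep_surj n E M \<and>
     (\<forall>i. (*\<^sub>v) (f i) ` carrier_vec (vdim N i) = mat_kernel (g i))}"

definition extension_equiv ::
    "int \<Rightarrow> qrep \<Rightarrow> qrep \<Rightarrow> ((qrep \<times> qmap \<times> qmap) \<times> (qrep \<times> qmap \<times> qmap)) set" where
  "extension_equiv n M N =
     {((E, f, g), (E', f', g')). (E, f, g) \<in> extensions n M N \<and> (E', f', g') \<in> extensions n M N \<and>
        (\<exists>h \<in> rep_iso n E E'. \<forall>i. h i * f i = f' i \<and> g' i * h i = g i)}"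

text \<open>Yoneda's Ext group, as a set.  It always contains the class of the split extension, which is
  its zero, so it vanishes iff it is a singleton.\<close>

definition Ext1 :: "int \<Rightarrow> qrep \<Rightarrow> qrep \<Rightarrow> (qrep \<times> qmap \<times> qmap) set set" where
  "Ext1 n M N = extensions n M N // extension_equiv n M N"

definition Ext1_vanishes :: "int \<Rightarrow> qrep \<Rightarrow> qrep \<Rightarrow> bool" where
  "Ext1_vanishes n M N \<longleftrightarrow> is_singleton (Ext1 n M N)"

subsection \<open>Torsion classes\<close>

text \<open>Nonemptiness makes the zero representation a member of every torsion class; without it, the
  empty collection and the collection of zero representations would contain the same bricks.\<close>

definition torsion_class :: "int \<Rightarrow> qrep set \<Rightarrow> bool" where
  "torsion_class n T \<longleftrightarrow>
     T \<subseteq> {M. rep n M} \<and> T \<noteq> {} \<and>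
     (\<forall>M \<in> T. \<forall>N. rep n N \<and> isomorphic n M N \<longrightarrow> N \<in> T) \<and>
     (\<forall>M \<in> T. \<forall>N. is_quotient n N M \<longrightarrow> N \<in> T) \<and>
     (\<forall>M \<in> T. \<forall>N \<in> T. \<forall>(E, f, g) \<in> extensions n M N. E \<in> T)"

definition psi :: "int \<Rightarrow> (int \<times> int) set set \<Rightarrow> qrep set" where
  "psi n D = (THE T. torsion_class n T \<and>
     {M \<in> T. brick n M} =
       {M. rep n M \<and> (\<exists>a b. a < b \<and> b < a + n \<and> arc n a b \<in> D \<and> isomorphic n M (interval_rep n a b))})"

definition ext_projective :: "int \<Rightarrow> qrep set \<Rightarrow> qrep \<Rightarrow> bool" where
  "ext_projective n T M \<longleftrightarrow> M \<in> T \<and> (\<forall>N \<in> T. Ext1_vanishes n M N)"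

text \<open>The module is determined up to isomorphism; the list \<open>Ms\<close> contains exactly one representative
  of each isomorphism class of indecomposable Ext-projectives.\<close>

definition stau_tilting_module :: "int \<Rightarrow> qrep set \<Rightarrow> qrep" where
  "stau_tilting_module n T = (SOME P. rep n P \<and>
     (\<exists>Ms. (\<forall>M \<in> set Ms. indecomposable n M \<and> ext_projective n T M) \<and>
           sorted_wrt (\<lambda>M N. \<not> isomorphic n M N) Ms \<and>
           (\<forall>M. indecomposable n M \<and> ext_projective n T M \<longrightarrow> (\<exists>N \<in> set Ms. isomorphic n M N)) \<and>
           isomorphic n P (direct_sum Ms)))"

subsection \<open>Tagged arcs in the once-punctured polygon\<close>

text \<open>Vertex v of the polygon is the vertex between the edges v - 1 and v, that is, the one
  immediately counterclockwise of edge v; vertices are given by their residues in 0, ..., n - 1.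
  \<open>Peripheral v w\<close> moves clockwise around the puncture from v to w in less than a full
  turn, which determines its isotopy class.  A radial arc is given by its endpoint on the boundary.\<close>

datatype tagged_arc = Peripheral int int | Plain_Radial int | Notched_Radial int

text \<open>The tagged arc a(a,b), intended for a < b < a + n.\<close>

definition tagged_a :: "int \<Rightarrow> int \<Rightarrow> int \<Rightarrow> tagged_arc" where
  "tagged_a n a b = (if b = a + n - 1 then Plain_Radial (a mod n)
                     else Peripheral (a mod n) ((b + 1) mod n))"

definition tagged_r :: "int \<Rightarrow> int \<Rightarrow> tagged_arc" where
  "tagged_r n a = Notched_Radial ((a + 1) mod n)"

definition triangulation :: "int \<Rightarrow> qrep set \<Rightarrow> tagged_arc set" where
  "triangulation n T =
     {tagged_a n a b | a b. a < b \<and> b < a + n \<and>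
        summand n (interval_rep n a b) (stau_tilting_module n T)} \<union>
     {tagged_r n a | a. \<not> (\<exists>M \<in> T. subquotient n (interval_rep n a (a + 1)) M)}"

end

theory Submission
  imports Defs
begin

text \<open>The algebra is a self-injective Nakayama algebra: every representation is a direct sum of the
uniserial interval representations M(a,b), which have a one-dimensional space at each of the
vertices a, ..., b - 1 and are generated at a. Everything reduces to questions about intervals.

The decomposition comes from splitting off one interval at a time (\<open>interval_retract_exists\<close>):
a longest nonzero path, applied to a suitable vector, spans a submodule M(a,b), and a linear form
detecting the end of the path extends to a retraction because no longer path acts nontrivially.
Hence the bricks and the indecomposables are the intervals. The induction principle \<open>rep_induct\<close>
that results from it takes the place of the full decomposition theorem.

The quotients of M(a,b) are the M(a,e) with a < e \<le> b, and a map E \<rightarrow> M(a,b) that restricts to a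
subrepresentation N of E with image M(c,b) induces a map from E/N onto M(a,c). By the two axioms of
an affine arc torsion class, the representations all of whose interval quotients come from D
form a torsion class with the prescribed bricks, and the induction principle shows that it is the
only one (\<open>psi_eq_quotient_class\<close>).

A member M(a,b) of this class is Ext-projective unless some \<gamma>(b',c) in D crosses it, in
the sense that a < b' \<le> b < c < a + n. If there is such an arc, M(b',c) and M(a,b) are the ends of
a nonsplit exact sequence whose middle term is the sum of M(a,c) and M(b',b)
(\<open>crossing_intervals_extension\<close>). If there is none, consider an extension E of M(a,b) by N. A
lift of the generator of M(a,b) is carried by the path from a to b to an element of N at b that the
remaining path of length a + n - 1 - b kills. The interval summands of N that see this element also
start at or before a, because otherwise they would cross; hence the lift can be corrected by an
element of N, and the sequence splits (\<open>noncrossing_interval_projective\<close>).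

Endomorphisms of intervals are scalars. Therefore an interval is a summand of a direct sum of
indecomposables only if it is isomorphic to one of them, and the summands of the support tau-tilting
module are the Ext-projective intervals (\<open>summand_stau_tilting_module_iff\<close>). Finally, the
simple module at a is a subquotient of a member of the class iff some interval from D contains a,
which describes the notched arcs.\<close>


section \<open>Linear algebra with matrices\<close>

text \<open>The ring laws are stated with equations between dimensions rather than with carriers, so that
rewriting can discharge the side conditions without guessing dimensions.\<close>

lemma mult_assoc_dims:
  fixes A B C :: "complex mat"
  assumes "dim_col A = dim_row B" "dim_col B = dim_row C"
  shows "A * B * C = A * (B * C)"
  using assms by (intro assoc_mult_mat) (auto intro!: carrier_matI)

lemma add_mult_dims:
  fixes A B C :: "complex mat"
  assumes "dim_row A = dim_row B" "dim_col A = dim_col B" "dim_col B = dim_row C"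
  shows "(A + B) * C = A * C + B * C"
  using assms by (intro add_mult_distrib_mat) (auto intro!: carrier_matI)

lemma mult_add_dims:
  fixes A B C :: "complex mat"
  assumes "dim_row B = dim_row C" "dim_col B = dim_col C" "dim_col A = dim_row C"
  shows "A * (B + C) = A * B + A * C"
  using assms by (intro mult_add_distrib_mat) (auto intro!: carrier_matI)

lemma mult_minus_dims:
  fixes A B C :: "complex mat"
  assumes "dim_row B = dim_row C" "dim_col B = dim_col C" "dim_col A = dim_row C"
  shows "A * (B - C) = A * B - A * C"
  using assms by (intro mult_minus_distrib_mat) (auto intro!: carrier_matI)

lemma minus_mult_dims:
  fixes A B C :: "complex mat"
  assumes "dim_row A = dim_row B" "dim_col A = dim_col B" "dim_col B = dim_row C"
  shows "(A - B) * C = A * C - B * C"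
  using assms by (intro minus_mult_distrib_mat) (auto intro!: carrier_matI)

lemmas distrib_dims = add_mult_dims mult_add_dims mult_minus_dims minus_mult_dims

lemma col_times:
  fixes A B :: "complex mat"
  assumes "dim_col A = dim_row B" "j < dim_col B"
  shows "col (A * B) j = A *\<^sub>v col B j"
  using assms by (intro col_mult2) (auto intro!: carrier_matI)

lemma mat_eq_if_no_entries:
  assumes "dim_row A = dim_row B" "dim_col A = dim_col B" "dim_row B = 0 \<or> dim_col B = 0"
  shows "A = B"
  using assms by (intro eq_matI) auto

lemma add_zero_dims:
  fixes A :: "complex mat"
  assumes "dim_row A = r" "dim_col A = c"
  shows "A + 0\<^sub>m r c = A" "0\<^sub>m r c + A = A"
  using assms by (auto intro!: eq_matI)

lemma one_mat_eq_zero_iff: "(1\<^sub>m k :: complex mat) = 0\<^sub>m k k \<longleftrightarrow> k = 0"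
  by (metis gr0I index_one_mat(1) index_zero_mat(1) mat_eq_if_no_entries one_neq_zero index_one_mat(2,3) index_zero_mat(2,3))

lemma mult_inner_zero:
  fixes A B :: "complex mat"
  assumes "dim_col A = 0" "dim_row B = 0"
  shows "A * B = 0\<^sub>m (dim_row A) (dim_col B)"
  using assms by (intro eq_matI) (auto simp: scalar_prod_def)

lemma smult_one_mult:
  fixes A :: "complex mat"
  shows "dim_row A = k \<Longrightarrow> (c \<cdot>\<^sub>m 1\<^sub>m k) * A = c \<cdot>\<^sub>m A" "dim_col A = k \<Longrightarrow> A * (c \<cdot>\<^sub>m 1\<^sub>m k) = c \<cdot>\<^sub>m A"
proof -
  assume A: "dim_row A = k"
  have "(c \<cdot>\<^sub>m 1\<^sub>m k) * A = c \<cdot>\<^sub>m (1\<^sub>m k * A)"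
    using A by (intro mult_smult_assoc_mat[of _ k k _ "dim_col A"]) (auto intro: carrier_matI)
  then show "(c \<cdot>\<^sub>m 1\<^sub>m k) * A = c \<cdot>\<^sub>m A" using A by (simp only: left_mult_one_mat')
next
  assume A: "dim_col A = k"
  have "A * (c \<cdot>\<^sub>m 1\<^sub>m k) = c \<cdot>\<^sub>m (A * 1\<^sub>m k)"
    using A by (intro mult_smult_distrib[of _ "dim_row A" k _ k]) (auto intro: carrier_matI)
  then show "A * (c \<cdot>\<^sub>m 1\<^sub>m k) = c \<cdot>\<^sub>m A" using A by (simp only: right_mult_one_mat')
qed

lemma nonzero_row_right_inverse:
  fixes A :: "complex mat"
  assumes A: "A \<in> carrier_mat 1 m" "A \<noteq> 0\<^sub>m 1 m"
  shows "\<exists>G \<in> carrier_mat m 1. A * G = 1\<^sub>m 1"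
proof -
  have "\<exists>y < m. A $$ (0, y) \<noteq> 0"
  proof (rule ccontr)
    assume "\<not> ?thesis"
    then have "A = 0\<^sub>m 1 m" using A(1) by (intro eq_matI) auto
    then show False using A(2) by simp
  qed
  then obtain y where y: "y < m" "A $$ (0, y) \<noteq> 0" by blast
  define G where "G = mat m 1 (\<lambda>(u, _). if u = y then 1 / A $$ (0, y) else 0)"
  have "A * G = 1\<^sub>m 1"
  proof (rule eq_matI)
    fix i j assume ij: "i < dim_row (1\<^sub>m 1 :: complex mat)" "j < dim_col (1\<^sub>m 1 :: complex mat)"
    have "(A * G) $$ (i, j) = (\<Sum>u = 0..<m. A $$ (0, u) * (if u = y then 1 / A $$ (0, y) else 0))"
      using A(1) ij by (simp add: G_def scalar_prod_def)
    also have "\<dots> = 1" using y by (simp add: if_distrib sum.delta cong: if_cong)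
    finally show "(A * G) $$ (i, j) = 1\<^sub>m 1 $$ (i, j)" using ij by simp
  qed (use A in \<open>simp_all add: G_def\<close>)
  then show ?thesis by (intro bexI[of _ G]) (simp_all add: G_def)
qed

text \<open>Injectivity as left cancellation, the form in which equations between matrices use it.\<close>

lemma inj_matrix_cancel:
  fixes A X Y :: "complex mat"
  assumes inj: "inj_on ((*\<^sub>v) A) (carrier_vec (dim_col A))"
    and d: "dim_row X = dim_col A" "dim_row Y = dim_col A" "dim_col X = dim_col Y"
    and eq: "A * X = A * Y"
  shows "X = Y"
proof (rule mat_col_eqI)
  fix j assume j: "j < dim_col Y"
  have "A *\<^sub>v col X j = A *\<^sub>v col Y j"
    using col_times[of A X j] col_times[of A Y j] d eq j by simp
  then show "col X j = col Y j"
    using inj d by (auto dest!: inj_onD intro!: carrier_vecI)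
qed (use d in auto)

text \<open>Solve for one column at a time.\<close>

lemma columns_in_image:
  fixes A X :: "complex mat"
  assumes "\<And>j. j < dim_col X \<Longrightarrow> col X j \<in> (*\<^sub>v) A ` carrier_vec (dim_col A)"
    and "dim_row X = dim_row A"
  obtains Y where "Y \<in> carrier_mat (dim_col A) (dim_col X)" "A * Y = X"
proof -
  have "\<forall>j. \<exists>y. j < dim_col X \<longrightarrow> y \<in> carrier_vec (dim_col A) \<and> col X j = A *\<^sub>v y"
    using assms(1) by (auto simp: image_iff)
  then obtain y where y: "\<And>j. j < dim_col X \<Longrightarrow> y j \<in> carrier_vec (dim_col A) \<and> col X j = A *\<^sub>v y j"
    by metis
  define Y where "Y = mat_of_cols (dim_col A) (map y [0..<dim_col X])"
  have Y: "Y \<in> carrier_mat (dim_col A) (dim_col X)"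
    unfolding Y_def by (metis length_map length_upt mat_of_cols_carrier(1) minus_nat.diff_0)
  have c: "col Y j = y j" if "j < dim_col X" for j
    unfolding Y_def using that y by (subst col_mat_of_cols) auto
  have "A * Y = X"
  proof (rule mat_col_eqI)
    fix j assume j: "j < dim_col X"
    then show "col (A * Y) j = col X j"
      using Y c[OF j] y[OF j] by (subst col_times) auto
  qed (use Y assms in auto)
  with Y show thesis by (rule that)
qed

lemma surj_matrix_right_inverse:
  fixes A :: "complex mat"
  assumes "(*\<^sub>v) A ` carrier_vec (dim_col A) = carrier_vec (dim_row A)"
  shows "\<exists>G \<in> carrier_mat (dim_col A) (dim_row A). A * G = 1\<^sub>m (dim_row A)"
proof -
  obtain Y where "Y \<in> carrier_mat (dim_col A) (dim_col (1\<^sub>m (dim_row A) :: complex mat))"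
      "A * Y = 1\<^sub>m (dim_row A)"
    using columns_in_image[of "1\<^sub>m (dim_row A)" A] assms by auto
  then show ?thesis by auto
qed

lemma surj_if_right_inverse:
  fixes A :: "complex mat"
  assumes "A \<in> carrier_mat k m" "G \<in> carrier_mat m k" "A * G = 1\<^sub>m k"
  shows "(*\<^sub>v) A ` carrier_vec m = carrier_vec k"
proof
  show "(*\<^sub>v) A ` carrier_vec m \<subseteq> carrier_vec k" using assms by auto
  show "carrier_vec k \<subseteq> (*\<^sub>v) A ` carrier_vec m"
  proof
    fix v :: "complex vec" assume v: "v \<in> carrier_vec k"
    then have "A *\<^sub>v (G *\<^sub>v v) = v"
      using assms by (subst assoc_mult_mat_vec[symmetric]) auto
    moreover have "G *\<^sub>v v \<in> carrier_vec m" using assms(2) v by (rule mult_mat_vec_carrier)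
    ultimately show "v \<in> (*\<^sub>v) A ` carrier_vec m" by (metis imageI)
  qed
qed

lemma inj_if_left_inverse:
  fixes A :: "complex mat"
  assumes "A \<in> carrier_mat k m" "G \<in> carrier_mat m k" "G * A = 1\<^sub>m m"
  shows "inj_on ((*\<^sub>v) A) (carrier_vec m)"
proof (rule inj_on_inverseI)
  fix v :: "complex vec" assume v: "v \<in> carrier_vec m"
  then show "G *\<^sub>v (A *\<^sub>v v) = v"
    using assms by (subst assoc_mult_mat_vec[symmetric]) auto
qed

text \<open>When the row r has a nonzero entry in column j, the kernel of r is coordinatised by the entries
other than j: B inserts the missing entry j, and C projects along s and then forgets it. The general
complement of a subspace would need a choice of basis; this one is explicit.\<close>

lemma complement_of_split_line:
  fixes s r :: "complex mat"
  assumes s: "s \<in> carrier_mat m d" and r: "r \<in> carrier_mat d m" and rs: "r * s = 1\<^sub>m d"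
    and d: "d \<le> 1"
  shows "\<exists>B C. B \<in> carrier_mat m (m - d) \<and> C \<in> carrier_mat (m - d) m \<and> C * B = 1\<^sub>m (m - d) \<and>
    r * B = 0\<^sub>m d (m - d) \<and> C * s = 0\<^sub>m (m - d) d \<and> s * r + B * C = 1\<^sub>m m"
proof (cases "d = 0")
  case True
  have "s * r + 1\<^sub>m m = 1\<^sub>m m" using s r True by (intro eq_matI) (auto simp: scalar_prod_def)
  then show ?thesis using s r True
    by (intro exI[of _ "1\<^sub>m m"]) (auto intro!: mat_eq_if_no_entries)
next
  case False
  then have d: "d = 1" using d by simp
  define S where "S x = s $$ (x, 0)" for x
  define R where "R x = r $$ (0, x)" for x
  have RS: "(\<Sum>x = 0..<m. R x * S x) = 1"
    using arg_cong[OF rs, of "\<lambda>A. A $$ (0,0)"] s r d by (auto simp: scalar_prod_def R_def S_def)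
  then obtain j where j: "j < m" "R j \<noteq> 0"
    by (metis (no_types, lifting) atLeastLessThan_iff mult_eq_0_iff sum.neutral zero_neq_one)
  \<comment> \<open>The order-preserving enumeration of the columns other than j.\<close>
  define sk where "sk x = (if x < j then x else Suc x)" for x
  have sk: "sk x < m" "sk x \<noteq> j" if "x < m - 1" for x using that j by (auto simp: sk_def)
  have sk_inj: "sk x = sk y \<longleftrightarrow> x = y" for x y by (auto simp: sk_def)
  have ran: "sk ` {0..<m-1} = {0..<m} - {j}"
  proof
    show "{0..<m} - {j} \<subseteq> sk ` {0..<m-1}"
    proof
      fix x assume x: "x \<in> {0..<m} - {j}"
      show "x \<in> sk ` {0..<m-1}"
      proof (cases "x < j")
        case True then show ?thesis using x j by (intro image_eqI[of _ _ x]) (auto simp: sk_def)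
      next
        case False then show ?thesis using x j
          by (intro image_eqI[of _ _ "x - 1"]) (auto simp: sk_def)
      qed
    qed
    show "sk ` {0..<m-1} \<subseteq> {0..<m} - {j}"
      by (metis Diff_iff atLeastLessThan_iff image_subsetI singletonD sk zero_le)
  qed
  have inj: "inj_on sk {0..<m-1}" by (simp add: inj_on_def sk_inj)
  have sum_sk: "(\<Sum>x = 0..<m. h x) = h j + (\<Sum>y = 0..<m-1. h (sk y))" for h :: "nat \<Rightarrow> complex"
  proof -
    have "(\<Sum>x = 0..<m. h x) = h j + sum h ({0..<m} - {j})"
      using j by (subst sum.remove[of _ j]) auto
    also have "sum h ({0..<m} - {j}) = (\<Sum>y = 0..<m-1. h (sk y))"
      unfolding ran[symmetric] using inj by (simp add: sum.reindex)
    finally show ?thesis .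
  qed
  \<comment> \<open>Entry j is determined by the condition that the row r annihilates the vector.\<close>
  define b where "b x y = (if x = j then - R (sk y) / R j else if x = sk y then 1 else 0)" for x y
  define c where "c y x = (if x = sk y then 1 else 0) - S (sk y) * R x" for y x
  define B where "B = mat m (m - 1) (\<lambda>(x, y). b x y)"
  define C where "C = mat (m - 1) m (\<lambda>(y, x). c y x)"
  have b_sk: "b (sk x) y = (if x = y then 1 else 0)" if "x < m - 1" for x y
    using sk[OF that] by (simp add: b_def sk_inj)
  have Rb: "(\<Sum>x = 0..<m. R x * b x y) = 0" if "y < m - 1" for y
  proof -
    have "(\<Sum>x = 0..<m. R x * b x y) = - R (sk y) + (\<Sum>x = 0..<m-1. R (sk x) * (if x = y then 1 else 0))"
      using j by (simp add: sum_sk b_sk) (simp add: b_def)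
    also have "(\<Sum>x = 0..<m-1. R (sk x) * (if x = y then 1 else 0)) = R (sk y)"
      using that by (simp add: if_distrib sum.delta cong: if_cong)
    finally show ?thesis by simp
  qed
  have CB: "C * B = 1\<^sub>m (m - 1)"
  proof (rule eq_matI)
    fix x y assume xy: "x < dim_row (1\<^sub>m (m - 1) :: complex mat)" "y < dim_col (1\<^sub>m (m - 1) :: complex mat)"
    have "(C * B) $$ (x, y) = (\<Sum>z = 0..<m. c x z * b z y)"
      using xy by (simp add: C_def B_def scalar_prod_def)
    also have "\<dots> = (\<Sum>z = 0..<m. if z = sk x then b z y else 0) - S (sk x) * (\<Sum>z = 0..<m. R z * b z y)"
      by (simp add: c_def left_diff_distrib sum_subtractf sum_distrib_left mult.assoc if_distrib[of "\<lambda>t. t * _"] cong: if_cong)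
    also have "\<dots> = b (sk x) y" using xy sk(1)[of x] by (simp add: Rb)
    finally show "(C * B) $$ (x, y) = 1\<^sub>m (m - 1) $$ (x, y)" using xy by (simp add: b_sk)
  qed (simp_all add: B_def C_def)
  have rB: "r * B = 0\<^sub>m 1 (m - 1)"
    using r d Rb by (intro eq_matI) (auto simp: B_def scalar_prod_def R_def)
  have Cs: "C * s = 0\<^sub>m (m - 1) 1"
  proof (rule eq_matI)
    fix x y assume xy: "x < dim_row (0\<^sub>m (m - 1) 1 :: complex mat)" "y < dim_col (0\<^sub>m (m - 1) 1 :: complex mat)"
    then have "(C * s) $$ (x, y) = (\<Sum>z = 0..<m. c x z * S z)"
      using s d by (simp add: C_def scalar_prod_def S_def)
    also have "\<dots> = (\<Sum>z = 0..<m. if z = sk x then S z else 0) - S (sk x) * (\<Sum>z = 0..<m. R z * S z)"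
      by (simp add: c_def left_diff_distrib sum_subtractf sum_distrib_left mult.assoc if_distrib[of "\<lambda>t. t * _"] cong: if_cong)
    also have "\<dots> = 0" using xy sk(1)[of x] RS by simp
    finally show "(C * s) $$ (x, y) = 0\<^sub>m (m - 1) 1 $$ (x, y)" using xy by simp
  qed (use s d in \<open>simp_all add: C_def\<close>)
  have "s * r + B * C = 1\<^sub>m m"
  proof (rule eq_matI)
    fix x y assume xy: "x < dim_row (1\<^sub>m m :: complex mat)" "y < dim_col (1\<^sub>m m :: complex mat)"
    have "(s * r + B * C) $$ (x, y) = S x * R y + (\<Sum>z = 0..<m-1. b x z * c z y)"
      using xy s r d by (simp add: B_def C_def scalar_prod_def S_def R_def)
    also have "\<dots> = (if x = y then 1 else 0)"
    proof (cases "x = j")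
      case True
      have 1: "(\<Sum>z = 0..<m-1. R (sk z) * S (sk z)) = 1 - R j * S j"
        using RS unfolding sum_sk[of "\<lambda>x. R x * S x"] by (simp add: algebra_simps)
      have "(\<Sum>z = 0..<m-1. b x z * c z y)
          = (\<Sum>z = 0..<m-1. (if y = sk z then - R (sk z) / R j else 0) + R y / R j * (R (sk z) * S (sk z)))"
        using True j by (intro sum.cong) (auto simp: b_def c_def field_simps)
      also have "\<dots> = (\<Sum>z = 0..<m-1. if y = sk z then - R y / R j else 0) + R y / R j * (1 - R j * S j)"
        unfolding sum.distrib sum_distrib_left[symmetric] 1 by (simp cong: if_cong)
      also have "(\<Sum>z = 0..<m-1. if y = sk z then - R y / R j else 0) = (if y = j then 0 else - R y / R j)"
      proof (cases "y = j")
        case True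
        have "y \<noteq> sk z" if "z \<in> {0..<m-1}" for z using True sk(2)[of z] that by auto
        then show ?thesis using True by (simp add: sum.neutral)
      next
        case False
        then have "y \<in> sk ` {0..<m-1}" unfolding ran using xy by simp
        then obtain z where z: "z < m - 1" "y = sk z" by auto
        then show ?thesis using False by (simp add: sk_inj)
      qed
      finally have e: "(\<Sum>z = 0..<m-1. b x z * c z y)
          = (if y = j then 0 else - R y / R j) + R y / R j * (1 - R j * S j)" .
      show ?thesis
      proof (cases "y = j")
        case True
        with \<open>x = j\<close> j show ?thesis unfolding e by (simp add: algebra_simps)
      next
        case False
        with \<open>x = j\<close> j show ?thesis unfolding e by (simp add: field_simps)
      qed
    next
      case False
      then have "x \<in> sk ` {0..<m-1}" unfolding ran using xy by simp
      then obtain w where w: "w < m - 1" "x = sk w" by auto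
      have "(\<Sum>z = 0..<m-1. b x z * c z y) = (\<Sum>z = 0..<m-1. if z = w then c z y else 0)"
        using w by (intro sum.cong) (auto simp: b_sk)
      also have "\<dots> = c w y" using w by simp
      finally show ?thesis using w by (auto simp: c_def)
    qed
    finally show "(s * r + B * C) $$ (x, y) = 1\<^sub>m m $$ (x, y)" using xy by simp
  qed (use s r in \<open>simp_all add: B_def C_def\<close>)
  then show ?thesis using CB rB Cs d by (intro exI[of _ B] exI[of _ C]) (auto simp: B_def C_def)
qed


section \<open>Representations and homomorphisms\<close>

lemma periodic_shift:
  fixes f :: "int \<Rightarrow> 'a" and n k :: int
  assumes "\<And>i. f (i + n) = f i"
  shows "f (i + k * n) = f i"
proof (induction k arbitrary: i rule: int_induct[where k = 0])
  case base then show ?case by simp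
next
  case (step1 k)
  have "f (i + (k + 1) * n) = f (i + k * n + n)" by (simp add: algebra_simps)
  then show ?case using assms step1 by simp
next
  case (step2 k)
  have "f (i + k * n) = f (i + (k - 1) * n + n)" by (simp add: algebra_simps)
  then show ?case using assms step2 by simp
qed

text \<open>The window of n consecutive integers is free to choose. With a window that starts at the left end
of an interval, the support of the interval does not wrap around.\<close>

lemma periodic_window:
  fixes P :: "int \<Rightarrow> bool" and n w :: int
  assumes "0 < n" and per: "\<And>i. P (i + n) = P i" and w: "\<And>i. w \<le> i \<Longrightarrow> i < w + n \<Longrightarrow> P i"
  shows "P i"
proof -
  have "i + (- ((i - w) div n)) * n = w + (i - w) mod n"
    by (simp add: minus_div_mult_eq_mod[symmetric])
  moreover have "P (w + (i - w) mod n)" using assms(1) by (intro w) auto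
  ultimately show ?thesis using periodic_shift[of P n i "- ((i - w) div n)"] per by metis
qed

text \<open>Representations of the cyclic quiver without the relations. The calculus of homomorphisms uses
only the shape of the matrices; the relations are transferred to new representations afterwards.\<close>

definition prerep :: "int \<Rightarrow> qrep \<Rightarrow> bool" where
  "prerep n M \<longleftrightarrow> (\<forall>i. vdim M (i + n) = vdim M i \<and> vmap M (i + n) = vmap M i \<and>
     vmap M i \<in> carrier_mat (vdim M (i + 1)) (vdim M i))"

lemma rep_iff_prerep:
  "rep n M \<longleftrightarrow> prerep n M \<and>
     (\<forall>i. path_map M i (nat (n - 1)) = 0\<^sub>m (vdim M (i + (n - 1))) (vdim M i))"
  by (simp add: rep_def prerep_def)

lemma rep_prerep: "rep n M \<Longrightarrow> prerep n M"
  by (simp add: rep_iff_prerep)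

lemma prerepD:
  assumes "prerep n M"
  shows "vdim M (i + n) = vdim M i" "vdim M (i + n + 1) = vdim M (i + 1)"
    "vmap M (i + n) = vmap M i"
    "dim_row (vmap M i) = vdim M (i + 1)" "dim_col (vmap M i) = vdim M i"
proof -
  show "vdim M (i + n) = vdim M i" "vmap M (i + n) = vmap M i"
    "dim_row (vmap M i) = vdim M (i + 1)" "dim_col (vmap M i) = vdim M i"
    using assms unfolding prerep_def by auto
  have "i + n + 1 = (i + 1) + n" by simp
  then show "vdim M (i + n + 1) = vdim M (i + 1)" using assms unfolding prerep_def by metis
qed

lemma rep_homD:
  assumes "f \<in> rep_hom n M N"
  shows "f (i + n) = f i" "f (i + n + 1) = f (i + 1)" "dim_row (f i) = vdim N i" "dim_col (f i) = vdim M i"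
    "f (i + 1) * vmap M i = vmap N i * f i"
proof -
  show "f (i + n) = f i" "dim_row (f i) = vdim N i" "dim_col (f i) = vdim M i"
    "f (i + 1) * vmap M i = vmap N i * f i"
    using assms unfolding rep_hom_def by auto
  have "i + n + 1 = (i + 1) + n" by simp
  then show "f (i + n + 1) = f (i + 1)" using assms unfolding rep_hom_def by (metis (mono_tags, lifting) mem_Collect_eq)
qed

lemma rep_hom_carrier: "f \<in> rep_hom n M N \<Longrightarrow> f i \<in> carrier_mat (vdim N i) (vdim M i)"
  unfolding rep_hom_def by auto

lemma rep_homI:
  assumes "\<And>i. f (i + n) = f i" "\<And>i. f i \<in> carrier_mat (vdim N i) (vdim M i)"
    "\<And>i. f (i + 1) * vmap M i = vmap N i * f i"
  shows "f \<in> rep_hom n M N"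
  using assms unfolding rep_hom_def by auto

lemma path_map_dims:
  assumes "prerep n M"
  shows "dim_row (path_map M i k) = vdim M (i + int k)" "dim_col (path_map M i k) = vdim M i"
proof (induction k)
  case 0 { case 1 show ?case by simp next case 2 show ?case by simp }
next
  case (Suc k)
  { case 1 show ?case using prerepD[OF assms] by (simp add: add.assoc add.commute[of 1])
  next case 2 show ?case using Suc by simp }
qed

lemma path_map_periodic:
  assumes "prerep n M"
  shows "path_map M (i + n) k = path_map M i k"
proof (induction k)
  case 0 show ?case using prerepD[OF assms] by simp
next
  case (Suc k)
  have "vmap M (i + n + int k) = vmap M (i + int k)"
    using prerepD(3)[OF assms, of "i + int k"] by (simp add: algebra_simps)
  then show ?case using Suc by simp
qed

lemma path_map_add:
  assumes "prerep n M"
  shows "path_map M (i + int k) l * path_map M i k = path_map M i (k + l)"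
proof (induction l)
  case 0 show ?case by (simp add: path_map_dims[OF assms])
next
  case (Suc l)
  have "vmap M (i + int k + int l) * path_map M (i + int k) l * path_map M i k
      = vmap M (i + int k + int l) * (path_map M (i + int k) l * path_map M i k)"
    by (rule mult_assoc_dims) (simp_all add: path_map_dims[OF assms] prerepD[OF assms])
  then show ?case using Suc by (simp add: add.assoc)
qed

lemma path_map_Suc_left:
  assumes "prerep n M"
  shows "path_map M i (Suc k) = path_map M (i + 1) k * vmap M i"
proof -
  have "path_map M i (Suc 0) = vmap M i" by (simp add: prerepD[OF assms])
  then show ?thesis using path_map_add[OF assms, of i "Suc 0" k] by simp
qed

lemma rep_long_path:
  assumes "rep n M" "0 < n" "n \<le> int k + 1"
  shows "path_map M i k = 0\<^sub>m (vdim M (i + int k)) (vdim M i)"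
proof -
  note P = rep_prerep[OF assms(1)]
  define l where "l = nat (n - 1)"
  have l: "int l = n - 1" "l \<le> k" using assms(2,3) by (auto simp: l_def)
  have "path_map M i l = 0\<^sub>m (vdim M (i + int l)) (vdim M i)"
    using assms(1) l(1) by (simp add: rep_iff_prerep flip: l_def)
  then show ?thesis
    using path_map_add[OF P, of i l "k - l"] l(2) by (simp add: path_map_dims[OF P] add.assoc)
qed

lemma rep_hom_path:
  assumes "f \<in> rep_hom n M N" "prerep n M" "prerep n N"
  shows "f (i + int k) * path_map M i k = path_map N i k * f i"
proof (induction k)
  case 0 show ?case using rep_homD[OF assms(1)] by simp
next
  case (Suc k)
  note dims = rep_homD(3-5)[OF assms(1)] prerepD[OF assms(2)] prerepD[OF assms(3)]
    path_map_dims[OF assms(2)] path_map_dims[OF assms(3)]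
  have "f (i + int (Suc k)) * path_map M i (Suc k) = f (i + int k + 1) * vmap M (i + int k) * path_map M i k"
    by (subst mult_assoc_dims) (simp_all add: dims add.assoc add.commute[of 1])
  also have "\<dots> = vmap N (i + int k) * (f (i + int k) * path_map M i k)"
    by (simp add: dims mult_assoc_dims)
  also have "\<dots> = path_map N i (Suc k) * f i"
    unfolding Suc by (simp add: dims mult_assoc_dims)
  finally show ?case .
qed

lemma rep_hom_id: "prerep n M \<Longrightarrow> (\<lambda>i. 1\<^sub>m (vdim M i)) \<in> rep_hom n M M"
  by (intro rep_homI) (auto simp: prerepD)

lemma rep_hom_comp:
  assumes f: "f \<in> rep_hom n M N" and g: "g \<in> rep_hom n N K"
    and P: "prerep n M" "prerep n N" "prerep n K"
  shows "(\<lambda>i. g i * f i) \<in> rep_hom n M K"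
proof (rule rep_homI)
  note dims = rep_homD[OF f] rep_homD[OF g] P[THEN prerepD(4)] P[THEN prerepD(5)]
  show "g (i + n) * f (i + n) = g i * f i" for i by (simp add: dims)
  show "g i * f i \<in> carrier_mat (vdim K i) (vdim M i)" for i by (auto simp: dims)
  fix i
  have "g (i + 1) * f (i + 1) * vmap M i = g (i + 1) * vmap N i * f i"
    by (simp add: mult_assoc_dims rep_homD(3,4)[OF f] rep_homD(3,4)[OF g] rep_homD(5)[OF f] P[THEN prerepD(4)] P[THEN prerepD(5)])
  then show "g (i + 1) * f (i + 1) * vmap M i = vmap K i * (g i * f i)"
    by (simp add: mult_assoc_dims dims)
qed

lemma rep_hom_add:
  assumes f: "f \<in> rep_hom n M N" and g: "g \<in> rep_hom n M N" and P: "prerep n M" "prerep n N"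
  shows "(\<lambda>i. f i + g i) \<in> rep_hom n M N"
  by (rule rep_homI)
    (auto simp: rep_homD[OF f] rep_homD[OF g] P[THEN prerepD(4)] P[THEN prerepD(5)] distrib_dims)

lemma rep_hom_diff:
  assumes f: "f \<in> rep_hom n M N" and g: "g \<in> rep_hom n M N" and P: "prerep n M" "prerep n N"
  shows "(\<lambda>i. f i - g i) \<in> rep_hom n M N"
  by (rule rep_homI)
    (auto simp: rep_homD[OF f] rep_homD[OF g] P[THEN prerepD(4)] P[THEN prerepD(5)] distrib_dims)

text \<open>Relations pass to subrepresentations because a homomorphism commutes with paths.\<close>

lemma rep_of_left_inverse:
  assumes n: "0 < n" and N: "rep n N" and M: "prerep n M" and f: "f \<in> rep_hom n M N"
    and g: "\<And>i. g i * f i = 1\<^sub>m (vdim M i)" "\<And>i. dim_col (g i) = vdim N i"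
  shows "rep n M"
  unfolding rep_iff_prerep
proof (intro conjI allI)
  fix i
  note dims = rep_homD(3,4)[OF f] path_map_dims[OF M] path_map_dims[OF rep_prerep[OF N]] g(2)
  have gr: "dim_row (g i) = vdim M i" for i using arg_cong[OF g(1), of dim_row] by simp
  let ?k = "nat (n - 1)"
  let ?j = "i + int ?k"
  have "path_map M i ?k = g ?j * f ?j * path_map M i ?k"
    by (simp only: g(1) left_mult_one_mat' dims)
  also have "\<dots> = g ?j * (f ?j * path_map M i ?k)"
    by (rule mult_assoc_dims) (simp_all only: dims)
  also have "\<dots> = g ?j * (path_map N i ?k * f i)"
    by (simp only: rep_hom_path[OF f M rep_prerep[OF N]])
  also have "\<dots> = 0\<^sub>m (vdim M ?j) (vdim M i)"
    using n by (subst rep_long_path[OF N n]) (simp_all add: dims gr)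
  finally show "path_map M i (nat (n - 1)) = 0\<^sub>m (vdim M (i + (n - 1))) (vdim M i)"
    using n by simp
qed (use M in simp)

lemma isomorphic_iff:
  "isomorphic n M N \<longleftrightarrow> (\<exists>f g. f \<in> rep_hom n M N \<and> g \<in> rep_hom n N M \<and>
     (\<forall>i. g i * f i = 1\<^sub>m (vdim M i)) \<and> (\<forall>i. f i * g i = 1\<^sub>m (vdim N i)))"
  unfolding isomorphic_def rep_iso_def by auto

lemma isomorphicI:
  assumes "f \<in> rep_hom n M N" "g \<in> rep_hom n N M"
    "\<And>i. g i * f i = 1\<^sub>m (vdim M i)" "\<And>i. f i * g i = 1\<^sub>m (vdim N i)"
  shows "isomorphic n M N"
  using assms unfolding isomorphic_def rep_iso_def by auto

lemma isomorphic_refl: "prerep n M \<Longrightarrow> isomorphic n M M"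
  by (rule isomorphicI[OF rep_hom_id rep_hom_id]) auto

lemma isomorphic_sym: "isomorphic n M N \<Longrightarrow> isomorphic n N M"
  unfolding isomorphic_iff by blast

lemma isomorphic_trans:
  assumes "isomorphic n M N" "isomorphic n N K" and P: "prerep n M" "prerep n N" "prerep n K"
  shows "isomorphic n M K"
proof -
  obtain f g where f: "f \<in> rep_hom n M N" and g: "g \<in> rep_hom n N M"
    and fg: "\<And>i. g i * f i = 1\<^sub>m (vdim M i)" "\<And>i. f i * g i = 1\<^sub>m (vdim N i)"
    using assms(1) unfolding isomorphic_iff by blast
  obtain h k where h: "h \<in> rep_hom n N K" and k: "k \<in> rep_hom n K N"
    and hk: "\<And>i. k i * h i = 1\<^sub>m (vdim N i)" "\<And>i. h i * k i = 1\<^sub>m (vdim K i)"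
    using assms(2) unfolding isomorphic_iff by blast
  note d = rep_homD(3,4)[OF f] rep_homD(3,4)[OF g] rep_homD(3,4)[OF h] rep_homD(3,4)[OF k]
  show ?thesis
  proof (rule isomorphicI[OF rep_hom_comp[OF f h P] rep_hom_comp[OF k g P(3,2,1)]])
    fix i
    have "g i * k i * (h i * f i) = g i * (k i * h i * f i)" by (simp add: mult_assoc_dims d)
    then show "g i * k i * (h i * f i) = 1\<^sub>m (vdim M i)" by (simp add: hk fg d)
    have "h i * f i * (g i * k i) = h i * (f i * g i * k i)" by (simp add: mult_assoc_dims d)
    then show "h i * f i * (g i * k i) = 1\<^sub>m (vdim K i)" by (simp add: hk fg d)
  qed
qed

lemma rep_surjI:
  assumes "f \<in> rep_hom n M N" "\<And>i. G i \<in> carrier_mat (vdim M i) (vdim N i)"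
    "\<And>i. f i * G i = 1\<^sub>m (vdim N i)"
  shows "f \<in> rep_surj n M N"
  using assms surj_if_right_inverse[OF rep_hom_carrier[OF assms(1)]] unfolding rep_surj_def by blast

lemma rep_injI:
  assumes "f \<in> rep_hom n M N" "\<And>i. G i \<in> carrier_mat (vdim M i) (vdim N i)"
    "\<And>i. G i * f i = 1\<^sub>m (vdim M i)"
  shows "f \<in> rep_inj n M N"
  using assms inj_if_left_inverse[OF rep_hom_carrier[OF assms(1)]] unfolding rep_inj_def by blast

text \<open>The right inverses can be chosen periodically because they depend only on the matrix.\<close>

lemma rep_surjE:
  assumes "f \<in> rep_surj n M N"
  obtains G where "f \<in> rep_hom n M N" "\<And>i. G (i + n) = G i"
    "\<And>i. dim_row (G i) = vdim M i" "\<And>i. dim_col (G i) = vdim N i"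
    "\<And>i. f i * G i = 1\<^sub>m (vdim N i)"
proof -
  have f: "f \<in> rep_hom n M N" using assms unfolding rep_surj_def by auto
  define rinv where "rinv A = (SOME G. G \<in> carrier_mat (dim_col A) (dim_row A) \<and> A * G = 1\<^sub>m (dim_row A))"
    for A :: "complex mat"
  have "\<exists>G. G \<in> carrier_mat (dim_col (f i)) (dim_row (f i)) \<and> f i * G = 1\<^sub>m (dim_row (f i))" for i
    using surj_matrix_right_inverse[of "f i"] assms rep_homD(3,4)[OF f] unfolding rep_surj_def by auto
  from someI_ex[OF this]
  have "rinv (f i) \<in> carrier_mat (dim_col (f i)) (dim_row (f i)) \<and> f i * rinv (f i) = 1\<^sub>m (dim_row (f i))" for i
    unfolding rinv_def .
  then show thesis
    using rep_homD[OF f] by (intro that[of "\<lambda>i. rinv (f i)"] f) auto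
qed

lemma rep_surj_comp:
  assumes "f \<in> rep_surj n M N" "g \<in> rep_surj n N K" and P: "prerep n M" "prerep n N" "prerep n K"
  shows "(\<lambda>i. g i * f i) \<in> rep_surj n M K"
proof -
  obtain F where F: "f \<in> rep_hom n M N" "\<And>i. dim_row (F i) = vdim M i" "\<And>i. dim_col (F i) = vdim N i"
    "\<And>i. f i * F i = 1\<^sub>m (vdim N i)"
    using rep_surjE[OF assms(1)] by metis
  obtain G where G: "g \<in> rep_hom n N K" "\<And>i. dim_row (G i) = vdim N i" "\<And>i. dim_col (G i) = vdim K i"
    "\<And>i. g i * G i = 1\<^sub>m (vdim K i)"
    using rep_surjE[OF assms(2)] by metis
  note d = rep_homD(3,4)[OF F(1)] rep_homD(3,4)[OF G(1)] F(2,3) G(2,3)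
  show ?thesis
  proof (rule rep_surjI[OF rep_hom_comp[OF F(1) G(1) P], of "\<lambda>i. F i * G i"])
    fix i
    show "F i * G i \<in> carrier_mat (vdim M i) (vdim K i)" by (auto simp: d)
    have "g i * f i * (F i * G i) = g i * (f i * F i * G i)" by (simp add: mult_assoc_dims d)
    then show "g i * f i * (F i * G i) = 1\<^sub>m (vdim K i)" by (simp add: F(4) G(4) d)
  qed
qed

lemma is_quotient_trans:
  assumes "is_quotient n K N" "is_quotient n N M" "rep n M"
  shows "is_quotient n K M"
  using assms rep_surj_comp unfolding is_quotient_def by (metis all_not_in_conv rep_prerep)

lemma is_quotientI:
  assumes "rep n N" "f \<in> rep_hom n M N" "\<And>i. G i \<in> carrier_mat (vdim M i) (vdim N i)"
    "\<And>i. f i * G i = 1\<^sub>m (vdim N i)"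
  shows "is_quotient n N M"
  using assms rep_surjI[OF assms(2-4)] unfolding is_quotient_def by blast

lemma is_quotient_if_isomorphic:
  assumes "isomorphic n M N" "rep n N"
  shows "is_quotient n N M"
proof -
  obtain f g where "f \<in> rep_hom n M N" "g \<in> rep_hom n N M"
    "\<And>i. g i * f i = 1\<^sub>m (vdim M i)" "\<And>i. f i * g i = 1\<^sub>m (vdim N i)"
    using assms(1) unfolding isomorphic_iff by blast
  then show ?thesis using is_quotientI[OF assms(2)] rep_hom_carrier by blast
qed

section \<open>Direct sum decompositions\<close>

text \<open>A direct sum decomposition is handled through its injections and projections; block matrices occur
only where the existence of such data is proved.\<close>

definition biprod :: "int \<Rightarrow> qrep \<Rightarrow> qrep \<Rightarrow> qrep \<Rightarrow> qmap \<Rightarrow> qmap \<Rightarrow> qmap \<Rightarrow> qmap \<Rightarrow> bool" where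
  "biprod n E U V i1 i2 p1 p2 \<longleftrightarrow>
     i1 \<in> rep_hom n U E \<and> i2 \<in> rep_hom n V E \<and> p1 \<in> rep_hom n E U \<and> p2 \<in> rep_hom n E V \<and>
     (\<forall>i. p1 i * i1 i = 1\<^sub>m (vdim U i) \<and> p2 i * i2 i = 1\<^sub>m (vdim V i) \<and>
          p1 i * i2 i = 0\<^sub>m (vdim U i) (vdim V i) \<and> p2 i * i1 i = 0\<^sub>m (vdim V i) (vdim U i) \<and>
          i1 i * p1 i + i2 i * p2 i = 1\<^sub>m (vdim E i))"

lemma biprodD:
  assumes "biprod n E U V i1 i2 p1 p2"
  shows "i1 \<in> rep_hom n U E" "i2 \<in> rep_hom n V E" "p1 \<in> rep_hom n E U" "p2 \<in> rep_hom n E V"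
    "p1 i * i1 i = 1\<^sub>m (vdim U i)" "p2 i * i2 i = 1\<^sub>m (vdim V i)"
    "p1 i * i2 i = 0\<^sub>m (vdim U i) (vdim V i)" "p2 i * i1 i = 0\<^sub>m (vdim V i) (vdim U i)"
    "i1 i * p1 i + i2 i * p2 i = 1\<^sub>m (vdim E i)"
  using assms unfolding biprod_def by auto

lemma biprod_quotients:
  assumes B: "biprod n E U V i1 i2 p1 p2" and "rep n U" "rep n V"
  shows "is_quotient n U E" "is_quotient n V E"
  using is_quotientI[OF assms(2) biprodD(3)[OF B] rep_hom_carrier[OF biprodD(1)[OF B]] biprodD(5)[OF B]]
    is_quotientI[OF assms(3) biprodD(4)[OF B] rep_hom_carrier[OF biprodD(2)[OF B]] biprodD(6)[OF B]] .

lemma biprod_swap: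
  assumes "biprod n E U V i1 i2 p1 p2"
  shows "biprod n E V U i2 i1 p2 p1"
proof -
  have "i2 i * p2 i + i1 i * p1 i = i1 i * p1 i + i2 i * p2 i" for i
    using biprodD(1-4)[OF assms, THEN rep_hom_carrier, of i]
    by (intro comm_add_mat[of _ "vdim E i" "vdim E i"]) auto
  then show ?thesis using assms unfolding biprod_def by simp
qed

text \<open>A path on E is the sum of its components through U and V.\<close>

lemma biprod_rep:
  assumes n: "0 < n" and B: "biprod n E U V i1 i2 p1 p2"
    and E: "prerep n E" and U: "rep n U" and V: "rep n V"
  shows "rep n E"
proof -
  note h = biprodD(1-4)[OF B]
  note P = E rep_prerep[OF U] rep_prerep[OF V]
  note d = h[THEN rep_homD(3)] h[THEN rep_homD(4)] P[THEN path_map_dims(1)] P[THEN path_map_dims(2)]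
  show ?thesis unfolding rep_iff_prerep
  proof (intro conjI allI)
    fix i
    let ?k = "nat (n - 1)"
    let ?j = "i + int ?k"
    have tr: "X * Y * path_map E i ?k = X * (path_map W i ?k * Z)"
      if "Y * path_map E i ?k = path_map W i ?k * Z" "dim_col X = dim_row Y" "dim_col Y = dim_row (path_map E i ?k)"
      for X Y Z W using that by (simp add: mult_assoc_dims)
    have "path_map E i ?k = (i1 ?j * p1 ?j + i2 ?j * p2 ?j) * path_map E i ?k"
      by (simp only: biprodD(9)[OF B] left_mult_one_mat' d)
    also have "\<dots> = i1 ?j * p1 ?j * path_map E i ?k + i2 ?j * p2 ?j * path_map E i ?k"
      by (rule add_mult_dims) (simp_all only: d index_mult_mat)
    also have "i1 ?j * p1 ?j * path_map E i ?k = i1 ?j * (path_map U i ?k * p1 i)"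
      by (rule tr[OF rep_hom_path[OF h(3) P(1,2)]]) (simp_all only: d)
    also have "i2 ?j * p2 ?j * path_map E i ?k = i2 ?j * (path_map V i ?k * p2 i)"
      by (rule tr[OF rep_hom_path[OF h(4) P(1,3)]]) (simp_all only: d)
    finally show "path_map E i (nat (n - 1)) = 0\<^sub>m (vdim E (i + (n - 1))) (vdim E i)"
      using rep_long_path[OF U n, of ?k i] rep_long_path[OF V n, of ?k i] n by (simp add: d)
  qed (use E in simp)
qed

text \<open>The comparison isomorphism is compatible with one injection and the other projection, so that it is
also an equivalence of the underlying extensions.\<close>

lemma biprod_comparison:
  assumes B: "biprod n E U V i1 i2 p1 p2" and B': "biprod n E' U V j1 j2 q1 q2"
    and P: "prerep n E" "prerep n E'" "prerep n U" "prerep n V"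
  shows "\<exists>h \<in> rep_iso n E E'. \<forall>i. h i * i1 i = j1 i \<and> q2 i * h i = p2 i"
proof -
  note h = biprodD(1-4)[OF B] and h' = biprodD(1-4)[OF B']
  note d = h[THEN rep_homD(3)] h[THEN rep_homD(4)] h'[THEN rep_homD(3)] h'[THEN rep_homD(4)]
  have key: "(j1 i * p1 i + j2 i * p2 i) * (i1 i * q1 i + i2 i * q2 i) = 1\<^sub>m (vdim E' i)"
    if B: "biprod n E U V i1 i2 p1 p2" and B': "biprod n E' U V j1 j2 q1 q2"
    for E E' i1 i2 p1 p2 j1 j2 q1 q2 and i :: int
  proof -
    note h = biprodD(1-4)[OF B] and h' = biprodD(1-4)[OF B']
    note d = h[THEN rep_homD(3)] h[THEN rep_homD(4)] h'[THEN rep_homD(3)] h'[THEN rep_homD(4)]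
    have e: "X * p * (k * q) = X * (p * k * q)"
      if "dim_col X = dim_row p" "dim_col p = dim_row k" "dim_col k = dim_row q"
      for X p k q :: "complex mat"
      using that by (simp add: mult_assoc_dims)
    show ?thesis
      using biprodD(9)[OF B', of i]
      by (simp add: distrib_dims d e biprodD(5-8)[OF B] add_zero_dims)
  qed
  let ?h = "\<lambda>i. j1 i * p1 i + j2 i * p2 i"
  have h1: "?h \<in> rep_hom n E E'"
    using h h' P by (intro rep_hom_add rep_hom_comp[of _ n _ U] rep_hom_comp[of _ n _ V])
  have h2: "(\<lambda>i. i1 i * q1 i + i2 i * q2 i) \<in> rep_hom n E' E"
    using h h' P by (intro rep_hom_add rep_hom_comp[of _ n _ U] rep_hom_comp[of _ n _ V])
  have "?h \<in> rep_iso n E E'"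
    unfolding rep_iso_def mem_Collect_eq using h1
    by (intro conjI bexI[OF _ h2]) (use key[OF B B'] key[OF B' B] in auto)
  moreover have "?h i * i1 i = j1 i" for i
    by (simp add: distrib_dims mult_assoc_dims d biprodD(5,8)[OF B] add_zero_dims)
  moreover have "q2 i * ?h i = p2 i" for i
    by (simp add: distrib_dims mult_assoc_dims[symmetric] d biprodD(6,8)[OF B'] add_zero_dims)
  ultimately show ?thesis by (intro bexI[of _ ?h]) auto
qed

lemma biprod_unique:
  assumes "biprod n E U V i1 i2 p1 p2" "biprod n E' U V j1 j2 q1 q2"
    and "prerep n E" "prerep n E'" "prerep n U" "prerep n V"
  shows "isomorphic n E E'"
  using biprod_comparison[OF assms] unfolding isomorphic_def by blast

lemma biprod_iso:
  assumes B: "biprod n E U V i1 i2 p1 p2" and iso: "isomorphic n E' E"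
    and P: "prerep n E" "prerep n E'" "prerep n U" "prerep n V"
  shows "\<exists>j1 j2 q1 q2. biprod n E' U V j1 j2 q1 q2"
proof -
  obtain f g where f: "f \<in> rep_hom n E' E" and g: "g \<in> rep_hom n E E'"
    and gf: "\<And>i. g i * f i = 1\<^sub>m (vdim E' i)" "\<And>i. f i * g i = 1\<^sub>m (vdim E i)"
    using iso unfolding isomorphic_iff by blast
  note h = biprodD(1-4)[OF B]
  note d = h[THEN rep_homD(3)] h[THEN rep_homD(4)] rep_homD(3,4)[OF f] rep_homD(3,4)[OF g]
  have e: "p * f i * (g i * k) = p * k" if "dim_col p = vdim E i" "dim_row k = vdim E i" for p k i
  proof -
    have "p * f i * (g i * k) = p * (f i * g i * k)" using that by (simp add: mult_assoc_dims d)
    then show ?thesis using that by (simp add: gf)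
  qed
  have sum: "g i * i1 i * (p1 i * f i) + g i * i2 i * (p2 i * f i) = 1\<^sub>m (vdim E' i)" for i
  proof -
    have "g i * i1 i * (p1 i * f i) + g i * i2 i * (p2 i * f i) = g i * ((i1 i * p1 i + i2 i * p2 i) * f i)"
      by (simp add: mult_assoc_dims distrib_dims d)
    then show ?thesis by (simp add: biprodD(9)[OF B] gf d)
  qed
  have "biprod n E' U V (\<lambda>i. g i * i1 i) (\<lambda>i. g i * i2 i) (\<lambda>i. p1 i * f i) (\<lambda>i. p2 i * f i)"
    unfolding biprod_def using rep_hom_comp[OF h(1) g P(3,1,2)] rep_hom_comp[OF h(2) g P(4,1,2)]
      rep_hom_comp[OF f h(3) P(2,1,3)] rep_hom_comp[OF f h(4) P(2,1,4)]
    by (simp add: e d biprodD(5-8)[OF B] sum)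
  then show ?thesis by blast
qed

text \<open>The injections and projections are written as four-block matrices with empty rows or columns of
blocks, so that the multiplication rule for block matrices proves all identities.\<close>

lemma direct_sum_Cons_biprod:
  assumes U: "prerep n U" and V: "prerep n (direct_sum Ms)"
  shows "prerep n (direct_sum (U # Ms)) \<and>
    (\<exists>i1 i2 p1 p2. biprod n (direct_sum (U # Ms)) U (direct_sum Ms) i1 i2 p1 p2)"
proof -
  let ?V = "direct_sum Ms"
  let ?E = "direct_sum (U # Ms)"
  let ?u = "vdim U" and ?v = "vdim ?V"
  note dU = prerepD[OF U] and dV = prerepD[OF V]
  have vd: "vdim ?E i = ?u i + ?v i" for i by (simp add: direct_sum_def)
  have vm: "vmap ?E i = four_block_mat (vmap U i) (0\<^sub>m (?u (i+1)) (?v i)) (0\<^sub>m (?v (i+1)) (?u i)) (vmap ?V i)" for i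
    using dV(4,5)[of i] dU(4,5)[of i] by (simp add: direct_sum_def Let_def)
  have P: "prerep n ?E"
    unfolding prerep_def
    using dU dV by (auto simp: vd vm add.commute intro!: carrier_matI)
  define i1 where "i1 i = four_block_mat (1\<^sub>m (?u i)) (0\<^sub>m (?u i) 0) (0\<^sub>m (?v i) (?u i)) (0\<^sub>m (?v i) 0 :: complex mat)" for i
  define i2 where "i2 i = four_block_mat (0\<^sub>m (?u i) 0) (0\<^sub>m (?u i) (?v i)) (0\<^sub>m (?v i) 0) (1\<^sub>m (?v i) :: complex mat)" for i
  define p1 where "p1 i = four_block_mat (1\<^sub>m (?u i)) (0\<^sub>m (?u i) (?v i)) (0\<^sub>m 0 (?u i)) (0\<^sub>m 0 (?v i) :: complex mat)" for i
  define p2 where "p2 i = four_block_mat (0\<^sub>m 0 (?u i)) (0\<^sub>m 0 (?v i)) (0\<^sub>m (?v i) (?u i)) (1\<^sub>m (?v i) :: complex mat)" for i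
  have u4: "A = four_block_mat A (0\<^sub>m (dim_row A) 0) (0\<^sub>m 0 (dim_col A)) (0\<^sub>m 0 0)" for A :: "complex mat"
    by (rule eq_matI) auto
  have v4: "A = four_block_mat (0\<^sub>m 0 0) (0\<^sub>m 0 (dim_col A)) (0\<^sub>m (dim_row A) 0) A" for A :: "complex mat"
    by (rule eq_matI) auto
  have fb: "four_block_mat A1 B1 C1 D1 * four_block_mat A2 B2 C2 D2
      = four_block_mat (A1 * A2 + B1 * C2) (A1 * B2 + B1 * D2) (C1 * A2 + D1 * C2) (C1 * B2 + D1 * D2)"
    if "dim_row B1 = dim_row A1" "dim_col C1 = dim_col A1" "dim_row D1 = dim_row C1" "dim_col D1 = dim_col B1"
      "dim_row A2 = dim_col A1" "dim_row B2 = dim_col A1" "dim_row C2 = dim_col B1" "dim_row D2 = dim_col B1"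
      "dim_col C2 = dim_col A2" "dim_col D2 = dim_col B2"
    for A1 B1 C1 D1 A2 B2 C2 D2 :: "complex mat"
    by (rule mult_four_block_mat[of _ "dim_row A1" "dim_col A1" _ "dim_col B1" _ "dim_row C1"])
      (use that in \<open>auto intro!: carrier_matI\<close>)
  note z = add_zero_dims
  have "biprod n ?E U ?V i1 i2 p1 p2"
    unfolding biprod_def
  proof (intro conjI allI)
    show "i1 \<in> rep_hom n U ?E"
    proof (rule rep_homI)
      fix i
      show "i1 (i + 1) * vmap U i = vmap ?E i * i1 i"
        by (subst u4[of "vmap U i"]) (simp add: i1_def vm fb dU dV z)
    qed (auto simp: i1_def vd dU dV)
    show "i2 \<in> rep_hom n ?V ?E"
    proof (rule rep_homI)
      fix i
      show "i2 (i + 1) * vmap ?V i = vmap ?E i * i2 i"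
        by (subst v4[of "vmap ?V i"]) (simp add: i2_def vm fb dU dV z)
    qed (auto simp: i2_def vd dU dV)
    show "p1 \<in> rep_hom n ?E U"
    proof (rule rep_homI)
      fix i
      show "p1 (i + 1) * vmap ?E i = vmap U i * p1 i"
        by (subst u4[of "vmap U i"]) (simp add: p1_def vm fb dU dV z)
    qed (auto simp: p1_def vd dU dV)
    show "p2 \<in> rep_hom n ?E ?V"
    proof (rule rep_homI)
      fix i
      show "p2 (i + 1) * vmap ?E i = vmap ?V i * p2 i"
        by (subst v4[of "vmap ?V i"]) (simp add: p2_def vm fb dU dV z)
    qed (auto simp: p2_def vd dU dV)
    fix i
    show "p1 i * i1 i = 1\<^sub>m (?u i)"
      by (subst u4[of "1\<^sub>m (?u i)"]) (simp add: p1_def i1_def fb z)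
    show "p2 i * i2 i = 1\<^sub>m (?v i)"
      by (subst v4[of "1\<^sub>m (?v i)"]) (simp add: p2_def i2_def fb z)
    show "p1 i * i2 i = 0\<^sub>m (?u i) (?v i)"
      by (simp add: p1_def i2_def fb z)
    show "p2 i * i1 i = 0\<^sub>m (?v i) (?u i)"
      by (simp add: p2_def i1_def fb z)
    show "i1 i * p1 i + i2 i * p2 i = 1\<^sub>m (vdim ?E i)"
      by (simp add: i1_def i2_def p1_def p2_def fb z vd add_four_block_mat[of _ "?u i" "?u i" _ "?v i" _ "?v i"])
  qed
  with P show ?thesis by blast
qed


section \<open>Interval representations\<close>

text \<open>Between spaces of dimension at most one, the all-ones matrix of the right shape is the identity or
empty. It describes the structure maps of an interval and the canonical maps between intervals
uniformly.\<close>

definition ones :: "nat \<Rightarrow> nat \<Rightarrow> complex mat" where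
  "ones p q = mat p q (\<lambda>_. 1)"

lemma ones_dims [simp]: "dim_row (ones p q) = p" "dim_col (ones p q) = q"
  by (simp_all add: ones_def)

lemma ones_carrier [simp]: "ones p q \<in> carrier_mat p q"
  by (simp add: carrier_matI)

lemma ones_diag: "p \<le> 1 \<Longrightarrow> ones p p = 1\<^sub>m p"
  by (auto simp: ones_def intro!: eq_matI)

lemma ones_mult:
  "q \<le> 1 \<Longrightarrow> ones p q * ones q r = (if q = 0 then 0\<^sub>m p r else ones p r)"
  by (auto simp: ones_def scalar_prod_def intro!: eq_matI)

definition supp :: "int \<Rightarrow> int \<Rightarrow> int \<Rightarrow> int \<Rightarrow> bool" where
  "supp n a b i \<longleftrightarrow> (\<exists>k. a \<le> i + k * n \<and> i + k * n \<le> b - 1)"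

lemma supp_periodic: "supp n a b (i + n) = supp n a b i"
proof -
  have "supp n a b (i + n)" if h: "supp n a b i" for i
  proof -
    obtain k where "a \<le> i + k * n" "i + k * n \<le> b - 1" using h unfolding supp_def by blast
    then show ?thesis unfolding supp_def by (intro exI[of _ "k - 1"]) (simp add: algebra_simps)
  qed
  moreover have "supp n a b i" if h: "supp n a b (i + n)" for i
  proof -
    obtain k where "a \<le> i + n + k * n" "i + n + k * n \<le> b - 1" using h unfolding supp_def by blast
    then show ?thesis unfolding supp_def by (intro exI[of _ "k + 1"]) (simp add: algebra_simps)
  qed
  ultimately show ?thesis by blast
qed

text \<open>In a window of length n that contains the interval, the only admissible translate is the trivial one.\<close>

lemma supp_window:
  assumes "w \<le> i" "i < w + n" "w \<le> a" "b \<le> w + n"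
  shows "supp n a b i \<longleftrightarrow> a \<le> i \<and> i < b"
proof
  assume "supp n a b i"
  then obtain k where k: "a \<le> i + k * n" "i + k * n \<le> b - 1" unfolding supp_def by blast
  have n: "0 < n" using assms by linarith
  have "k = 0"
  proof (rule ccontr)
    assume "k \<noteq> 0"
    then consider "1 \<le> k" | "k \<le> -1" by linarith
    then show False
    proof cases
      case 1
      then have "n \<le> k * n" using n by (simp add: mult_le_cancel_right1)
      then show False using assms k by linarith
    next
      case 2
      then have "k * n \<le> - n" using n mult_right_mono[of k "-1" n] by simp
      then show False using assms k by linarith
    qed
  qed
  then show "a \<le> i \<and> i < b" using k by auto
qed (auto simp: supp_def intro!: exI[of _ 0])

lemma supp_translate: "supp n (a + k * n) (b + k * n) = supp n a b"
proof -
  have "supp n (a + k * n) (b + k * n) i" if h: "supp n a b i" for i a b k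
  proof -
    obtain l where "a \<le> i + l * n" "i + l * n \<le> b - 1" using h unfolding supp_def by blast
    then show ?thesis unfolding supp_def by (intro exI[of _ "l + k"]) (simp add: algebra_simps)
  qed
  note shift = this
  show ?thesis
  proof (intro ext iffI)
    fix i
    show "supp n (a + k * n) (b + k * n) i" if "supp n a b i" using shift that .
    show "supp n a b i" if "supp n (a + k * n) (b + k * n) i" using shift[OF that, of "- k"] by simp
  qed
qed

lemma supp_self: "a < b \<Longrightarrow> supp n a b a"
  unfolding supp_def by (intro exI[of _ 0]) simp

lemma interval_vdim: "vdim (interval_rep n a b) i = (if supp n a b i then 1 else 0)"
  by (simp add: interval_rep_def supp_def Let_def)

lemma interval_vdim_le: "vdim (interval_rep n a b) i \<le> 1"
  by (simp add: interval_vdim)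

lemma interval_translate: "interval_rep n (a + k * n) (b + k * n) = interval_rep n a b"
proof -
  have e: "(\<exists>l. a + k * n \<le> i + l * n \<and> i + l * n \<le> b + k * n - c) \<longleftrightarrow>
      (\<exists>l. a \<le> i + l * n \<and> i + l * n \<le> b - c)" for i c
    using fun_cong[OF supp_translate[of n a k "b - c + 1"], of i]
    by (simp add: supp_def algebra_simps)
  show ?thesis by (simp only: interval_rep_def e)
qed

text \<open>Two cyclically adjacent vertices lie in the support only if they are adjacent in the interval, because
the interval misses at least one vertex.\<close>

lemma interval_vmap:
  assumes "a \<le> b" "b < a + n"
  shows "vmap (interval_rep n a b) i =
    ones (vdim (interval_rep n a b) (i + 1)) (vdim (interval_rep n a b) i)"
proof -
  let ?P = "\<lambda>i. supp n a b i \<and> supp n a b (i + 1) \<longleftrightarrow> supp n a (b - 1) i"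
  have "?P i"
  proof (rule periodic_window[of n ?P a])
    show "0 < n" using assms by simp
    show "?P (i + n) = ?P i" for i
      using supp_periodic[of n a b "i + 1"] by (simp add: supp_periodic algebra_simps)
    fix i assume i: "a \<le> i" "i < a + n"
    show "?P i"
    proof (cases "i + 1 < a + n")
      case True
      then show ?thesis using i assms
        by (simp add: supp_window[of a i n a] supp_window[of a "i + 1" n a]) linarith
    next
      case False
      then show ?thesis using i assms by (simp add: supp_window[of a i n a])
    qed
  qed
  moreover have "vmap (interval_rep n a b) i = (if supp n a (b - 1) i then 1\<^sub>m 1
      else 0\<^sub>m (vdim (interval_rep n a b) (i + 1)) (vdim (interval_rep n a b) i))"
  proof -
    have e: "b - 1 - 1 = b - 2" by simp
    show ?thesis by (simp only: supp_def e interval_rep_def Let_def qrep.select_convs)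
  qed
  ultimately show ?thesis
    by (cases "supp n a b i"; cases "supp n a b (i + 1)")
      (auto simp: interval_vdim ones_diag intro!: mat_eq_if_no_entries)
qed

lemma interval_prerep:
  assumes "a \<le> b" "b < a + n"
  shows "prerep n (interval_rep n a b)"
proof -
  have "supp n a b (i + n + 1) = supp n a b (i + 1)" for i
    using supp_periodic[of n a b "i + 1"] by (simp add: algebra_simps)
  then show ?thesis using assms
    unfolding prerep_def by (simp add: interval_vmap interval_vdim supp_periodic)
qed

lemma interval_path:
  assumes "a \<le> i" "i + int k < b" "b < a + n"
  shows "path_map (interval_rep n a b) i k = 1\<^sub>m 1"
  using assms(2)
proof (induction k)
  case 0
  then have "supp n a b i" using assms unfolding supp_def by (intro exI[of _ 0]) simp
  then show ?case by (simp add: interval_vdim)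
next
  case (Suc k)
  have "supp n a b (i + int k + 1)" "supp n a b (i + int k)"
    using Suc.prems assms(1) unfolding supp_def by (auto intro!: exI[of _ 0])
  then show ?case using Suc assms
    by (simp add: interval_vmap interval_vdim ones_diag)
qed

lemma not_supp_end: "a \<le> b \<Longrightarrow> b < a + n \<Longrightarrow> \<not> supp n a b b"
  using supp_window[of a b n a b] by auto

text \<open>A path of length n - 1 visits every residue, in particular that of b, where the space is zero.\<close>

lemma interval_rep_is_rep:
  assumes "a \<le> b" "b < a + n"
  shows "rep n (interval_rep n a b)"
  unfolding rep_iff_prerep
proof (intro conjI allI)
  let ?M = "interval_rep n a b"
  note P = interval_prerep[OF assms]
  show "prerep n ?M" by (rule P)
  fix i
  have n: "0 < n" using assms by simp
  let ?k = "nat (n - 1)"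
  define Q where "Q i \<longleftrightarrow> path_map ?M i ?k = 0\<^sub>m (vdim ?M (i + (n - 1))) (vdim ?M i)" for i
  have "Q i"
  \<comment> \<open>These are the starting vertices i with i \<le> b \<le> i + n - 1, so that the path passes through b.\<close>
  proof (rule periodic_window[OF n, of Q "b - n + 1"])
    show "Q (i + n) = Q i" for i
      using prerepD(1)[OF P, of "i + (n - 1)"] prerepD(1)[OF P, of i]
      by (simp add: Q_def path_map_periodic[OF P] algebra_simps)
    fix i assume i: "b - n + 1 \<le> i" "i < b - n + 1 + n"
    define l where "l = nat (b - i)"
    have l: "i + int l = b" "l \<le> ?k" using i by (auto simp: l_def)
    have "path_map ?M i ?k = path_map ?M b (?k - l) * path_map ?M i l"
      using path_map_add[OF P, of i l "?k - l"] l by simp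
    moreover have "vdim ?M b = 0" using not_supp_end[OF assms] by (simp add: interval_vdim)
    ultimately have "path_map ?M i ?k = 0\<^sub>m (vdim ?M (i + int ?k)) (vdim ?M i)"
      using path_map_dims[OF P, of b "?k - l"] path_map_dims[OF P, of i l] l
      by (intro eq_matI) (auto simp: scalar_prod_def algebra_simps)
    then show "Q i" using n by (simp add: Q_def)
  qed
  then show "path_map ?M i ?k = 0\<^sub>m (vdim ?M (i + (n - 1))) (vdim ?M i)" by (simp add: Q_def)
qed

text \<open>The homomorphism from M(a,b) to M that sends the generator to x. The offset of the vertex i from a
is computed modulo n; outside the support the matrix has no columns.\<close>

definition interval_map :: "int \<Rightarrow> int \<Rightarrow> int \<Rightarrow> qrep \<Rightarrow> complex mat \<Rightarrow> qmap" where
  "interval_map n a b M x i = (let t = (i - a) mod n in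
     if t < b - a then path_map M a (nat t) * x else 0\<^sub>m (vdim M i) 0)"

lemma mod_window:
  fixes a i n :: int
  assumes "a \<le> i" "i < a + n"
  shows "(i - a) mod n = i - a"
  using assms by (intro mod_pos_pos_trivial) auto

text \<open>M(a,b) is the quotient of the projective module of the path algebra at a by the submodule that the path of
length b - a generates. A homomorphism out of it is therefore the same as an element at a that this
path kills.\<close>

lemma interval_map_hom:
  assumes ab: "a < b" "b < a + n" and M: "prerep n M" and x: "x \<in> carrier_mat (vdim M a) 1"
    and z: "path_map M a (nat (b - a)) * x = 0\<^sub>m (vdim M b) 1"
  shows "interval_map n a b M x \<in> rep_hom n (interval_rep n a b) M"
    and "interval_map n a b M x a = x"
proof -
  let ?I = "interval_rep n a b" and ?f = "interval_map n a b M x"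
  have n: "0 < n" using ab by simp
  have P: "prerep n ?I" using ab by (intro interval_prerep) auto
  have val: "?f i = (if i < b then path_map M a (nat (i - a)) * x else 0\<^sub>m (vdim M i) 0)"
    if "a \<le> i" "i < a + n" for i
    using that by (simp add: interval_map_def mod_window)
  show "?f a = x" using ab n x by (simp add: val)
  have per: "?f (i + n) = ?f i" for i
  proof -
    have "i + n - a = i - a + n" by simp
    then show ?thesis by (simp only: interval_map_def mod_add_self2 prerepD(1)[OF M])
  qed
  have per1: "?f (i + n + 1) = ?f (i + 1)" for i using per[of "i + 1"] by (simp add: algebra_simps)
  have car: "?f i \<in> carrier_mat (vdim M i) (vdim ?I i)" for i
  proof (rule periodic_window[OF n, of "\<lambda>i. ?f i \<in> carrier_mat (vdim M i) (vdim ?I i)" a])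
    fix i assume i: "a \<le> i" "i < a + n"
    then show "?f i \<in> carrier_mat (vdim M i) (vdim ?I i)"
      using ab x path_map_dims[OF M, of a "nat (i - a)"]
      by (auto simp: val interval_vdim supp_window[of a i n a b] intro!: carrier_matI)
  qed (simp add: per prerepD(1)[OF M] prerepD(1)[OF P])
  have "?f (i + 1) * vmap ?I i = vmap M i * ?f i" for i
  proof (rule periodic_window[OF n, of "\<lambda>i. ?f (i + 1) * vmap ?I i = vmap M i * ?f i" a])
    fix i assume i: "a \<le> i" "i < a + n"
    show "?f (i + 1) * vmap ?I i = vmap M i * ?f i"
    proof (cases "i < b")
      case False
      then have "vdim ?I i = 0" using i ab by (simp add: interval_vdim supp_window[of a i n a b])
      then show ?thesis using car[of "i + 1"] car[of i]
        by (intro mat_eq_if_no_entries) (auto simp: prerepD[OF M] prerepD[OF P])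
    next
      case True
      have d: "vdim ?I i = 1" using True i ab by (simp add: interval_vdim supp_window[of a i n a b])
      have nat: "nat (i + 1 - a) = Suc (nat (i - a))" using i by simp
      have "vmap M i * ?f i = path_map M a (nat (i + 1 - a)) * x"
        using True i x unfolding nat
        by (simp add: val mult_assoc_dims prerepD[OF M] path_map_dims[OF M])
      show ?thesis
      proof (cases "i + 1 < b")
        case True
        then have "vdim ?I (i + 1) = 1" using i ab by (simp add: interval_vdim supp_window[of a "i + 1" n a b])
        moreover have "?f (i + 1) = path_map M a (nat (i + 1 - a)) * x" using True i ab by (simp add: val)
        ultimately show ?thesis using d ab x unfolding \<open>vmap M i * ?f i = _\<close>
          by (simp add: interval_vmap ones_diag)
      next
        case False
        then have b: "b = i + 1" using True by simp
        have "vdim ?I (i + 1) = 0" using not_supp_end[of a b n] ab b by (simp add: interval_vdim)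
        then have "?f (i + 1) \<in> carrier_mat (vdim M (i + 1)) 0" "vmap ?I i \<in> carrier_mat 0 1"
          using car[of "i + 1"] d prerepD(4,5)[OF P, of i] by (auto intro!: carrier_matI)
        then have "?f (i + 1) * vmap ?I i = 0\<^sub>m (vdim M (i + 1)) 1"
          by (intro eq_matI) (auto simp: scalar_prod_def)
        moreover have "vmap M i * ?f i = 0\<^sub>m (vdim M (i + 1)) 1"
          using \<open>vmap M i * ?f i = _\<close> z b by metis
        ultimately show ?thesis by simp
      qed
    qed
  next
    show "(?f (i + n + 1) * vmap ?I (i + n) = vmap M (i + n) * ?f (i + n)) = (?f (i + 1) * vmap ?I i = vmap M i * ?f i)" for i
      by (simp add: per per1 prerepD(3)[OF M] prerepD(3)[OF P])
  qed
  then show "?f \<in> rep_hom n ?I M" using car per by (intro rep_homI)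
qed

text \<open>M(a,b) is generated at a.\<close>

lemma interval_hom_determined:
  assumes ab: "a \<le> b" "b < a + n" and M: "prerep n M"
    and f: "f \<in> rep_hom n (interval_rep n a b) M" and g: "g \<in> rep_hom n (interval_rep n a b) M"
    and eq: "f a = g a"
  shows "f i = g i"
proof (rule periodic_window[of n "\<lambda>i. f i = g i" a])
  let ?I = "interval_rep n a b"
  note P = interval_prerep[OF ab]
  fix i assume i: "a \<le> i" "i < a + n"
  show "f i = g i"
  proof (cases "i < b")
    case False
    then have "vdim ?I i = 0" using i ab by (simp add: interval_vdim supp_window[of a i n a b])
    then show ?thesis using rep_homD[OF f] rep_homD[OF g] by (intro mat_eq_if_no_entries) auto
  next
    case True
    have j: "a + int (nat (i - a)) = i" using i by simp
    have p: "path_map ?I a (nat (i - a)) = 1\<^sub>m 1" using True i ab by (intro interval_path) auto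
    have d: "vdim ?I i = 1" using True i ab by (simp add: interval_vdim supp_window[of a i n a b])
    have "f i = f i * path_map ?I a (nat (i - a))" using d by (simp add: p rep_homD[OF f])
    also have "\<dots> = path_map M a (nat (i - a)) * f a"
      using rep_hom_path[OF f P M, of a "nat (i - a)"] unfolding j .
    also have "\<dots> = g i * path_map ?I a (nat (i - a))"
      using rep_hom_path[OF g P M, of a "nat (i - a)"] unfolding j eq by simp
    also have "\<dots> = g i" using d by (simp add: p rep_homD[OF g])
    finally show ?thesis .
  qed
qed (use ab rep_homD[OF f] rep_homD[OF g] in auto)

text \<open>The map onto the common part of the two intervals, which is a quotient of M(c,d) and a
subrepresentation of M(a,b). The case a = c is the projection of an interval onto an interval with the
same left end, and the case b = d is the inclusion of an interval with the same right end.\<close>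

lemma interval_canonical_map:
  assumes "a \<le> c" "c \<le> d" "a \<le> b" "b \<le> d" "d < a + n"
  shows "(\<lambda>i. ones (vdim (interval_rep n a b) i) (vdim (interval_rep n c d) i))
     \<in> rep_hom n (interval_rep n c d) (interval_rep n a b)"
proof (rule rep_homI)
  let ?I = "interval_rep n c d" and ?J = "interval_rep n a b"
  have I: "prerep n ?I" and J: "prerep n ?J" using assms by (auto intro: interval_prerep)
  fix i
  show "ones (vdim ?J (i + n)) (vdim ?I (i + n)) = ones (vdim ?J i) (vdim ?I i)"
    by (simp add: prerepD(1)[OF I] prerepD(1)[OF J])
  define Q where "Q i \<longleftrightarrow> ones (vdim ?J (i + 1)) (vdim ?I (i + 1)) * vmap ?I i =
    vmap ?J i * ones (vdim ?J i) (vdim ?I i)" for i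
  have "Q i"
  proof (rule periodic_window[of n Q a])
    show "Q (i + n) = Q i" for i
      by (simp add: Q_def prerepD(1-3)[OF I] prerepD(1-3)[OF J])
    fix i assume i: "a \<le> i" "i < a + n"
    show "Q i"
    proof (cases "i < d")
      case True
      then show ?thesis using i assms
        by (auto simp: Q_def interval_vmap interval_vdim supp_window[of a i n] supp_window[of a "i + 1" n]
            ones_mult intro!: mat_eq_if_no_entries)
    next
      case False
      then have "vdim ?I i = 0" using i assms by (simp add: interval_vdim supp_window[of a i n])
      then show ?thesis unfolding Q_def
        by (intro mat_eq_if_no_entries) (simp_all add: prerepD[OF I] prerepD[OF J])
    qed
  qed (use assms in simp)
  then show "ones (vdim ?J (i + 1)) (vdim ?I (i + 1)) * vmap ?I i = vmap ?J i * ones (vdim ?J i) (vdim ?I i)"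
    by (simp add: Q_def)
qed simp

section \<open>Splitting off intervals\<close>

text \<open>The complement is the kernel of r with the coordinates given by the explicit complement at each
vertex, which are chosen as a function of the matrices to keep them periodic.\<close>

lemma retract_biprod:
  assumes n: "0 < n" and M: "rep n M" and A: "prerep n A" and A1: "\<And>i. vdim A i \<le> 1"
    and s: "s \<in> rep_hom n A M" and r: "r \<in> rep_hom n M A" and rs: "\<And>i. r i * s i = 1\<^sub>m (vdim A i)"
  shows "\<exists>Q i2 p2. rep n Q \<and> biprod n M A Q s i2 r p2 \<and> (\<forall>i. vdim M i = vdim A i + vdim Q i)"
proof -
  note P = rep_prerep[OF M]
  define ok where "ok m d (S :: complex mat) R BC \<longleftrightarrow> (case BC of (B, C) \<Rightarrow>
    B \<in> carrier_mat m (m - d) \<and> C \<in> carrier_mat (m - d) m \<and> C * B = 1\<^sub>m (m - d) \<and>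
    R * B = 0\<^sub>m d (m - d) \<and> C * S = 0\<^sub>m (m - d) d \<and> S * R + B * C = 1\<^sub>m m)" for m d S R BC
  define BC where "BC i = (SOME BC. ok (vdim M i) (vdim A i) (s i) (r i) BC)" for i
  define B where "B i = fst (BC i)" for i
  define C where "C i = snd (BC i)" for i
  define q where "q i = vdim M i - vdim A i" for i
  have "ok (vdim M i) (vdim A i) (s i) (r i) (BC i)" for i
  proof -
    have "\<exists>BC. ok (vdim M i) (vdim A i) (s i) (r i) BC"
      using complement_of_split_line[OF rep_hom_carrier[OF s] rep_hom_carrier[OF r] rs A1, of i]
      unfolding ok_def by auto
    then show ?thesis unfolding BC_def by (rule someI_ex)
  qed
  then have B: "dim_row (B i) = vdim M i" "dim_col (B i) = q i"
    and C: "dim_row (C i) = q i" "dim_col (C i) = vdim M i"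
    and CB: "C i * B i = 1\<^sub>m (q i)" and rB: "r i * B i = 0\<^sub>m (vdim A i) (q i)"
    and Cs: "C i * s i = 0\<^sub>m (q i) (vdim A i)" and sum: "s i * r i + B i * C i = 1\<^sub>m (vdim M i)" for i
    unfolding ok_def B_def C_def q_def by (auto simp: case_prod_beta)
  have per: "B (i + n) = B i" "C (i + n) = C i" "q (i + n) = q i" for i
    by (simp_all add: B_def C_def BC_def q_def prerepD[OF P] prerepD[OF A] rep_homD[OF s] rep_homD[OF r])
  have per1: "B (i + n + 1) = B (i + 1)" "C (i + n + 1) = C (i + 1)" "q (i + n + 1) = q (i + 1)" for i
    using per[of "i + 1"] by (simp_all add: algebra_simps)
  define Q where "Q = \<lparr> vdim = q, vmap = (\<lambda>i. C (i + 1) * vmap M i * B i) \<rparr>"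
  note d = rep_homD(3,4)[OF s] rep_homD(3,4)[OF r] B C prerepD(4,5)[OF P] prerepD(4,5)[OF A]
  have Qd: "vdim Q i = q i" "vmap Q i = C (i + 1) * vmap M i * B i" for i by (simp_all add: Q_def)
  have Q: "prerep n Q"
    unfolding prerep_def by (auto simp: Qd per per1 B C prerepD[OF P])
  have Bhom: "B \<in> rep_hom n Q M"
  proof (rule rep_homI)
    fix i
    \<comment> \<open>The component of B along s vanishes because the kernel of r is a subrepresentation.\<close>
    have "vmap M i * B i = (s (i+1) * r (i+1) + B (i+1) * C (i+1)) * (vmap M i * B i)"
      by (simp add: sum d)
    also have "\<dots> = s (i+1) * (r (i+1) * vmap M i * B i) + B (i+1) * (C (i+1) * vmap M i * B i)"
      by (simp add: distrib_dims mult_assoc_dims d)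
    also have "r (i+1) * vmap M i * B i = vmap A i * (r i * B i)"
      unfolding rep_homD(5)[OF r] by (simp add: mult_assoc_dims d)
    also have "\<dots> = 0\<^sub>m (vdim A (i + 1)) (q i)" by (simp add: rB d)
    finally show "B (i + 1) * vmap Q i = vmap M i * B i" by (simp add: Qd d add_zero_dims)
  qed (auto simp: per Qd d)
  have Chom: "C \<in> rep_hom n M Q"
  proof (rule rep_homI)
    fix i
    have "C (i+1) * vmap M i = C (i+1) * vmap M i * (s i * r i + B i * C i)"
      by (simp add: sum d)
    also have "\<dots> = C (i+1) * (vmap M i * s i) * r i + C (i+1) * vmap M i * B i * C i"
      by (simp add: distrib_dims mult_assoc_dims d)
    also have "C (i+1) * (vmap M i * s i) = C (i+1) * s (i+1) * vmap A i"
      unfolding rep_homD(5)[OF s, symmetric] by (simp add: mult_assoc_dims d)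
    also have "\<dots> = 0\<^sub>m (q (i+1)) (vdim A i)" by (simp add: Cs d)
    finally show "C (i + 1) * vmap M i = vmap Q i * C i" by (simp add: Qd d add_zero_dims)
  qed (auto simp: per Qd d)
  have "rep n Q" using rep_of_left_inverse[OF n M Q Bhom, of C] by (simp add: CB Qd C)
  moreover have "biprod n M A Q s B r C"
    unfolding biprod_def using s r Bhom Chom rs CB rB Cs sum by (simp add: Qd)
  moreover have "vdim A i \<le> vdim M i" for i
  proof (rule ccontr)
    assume "\<not> vdim A i \<le> vdim M i"
    then have "vdim M i = 0" "vdim A i \<noteq> 0" using A1[of i] by auto
    moreover from this have "r i * s i = 0\<^sub>m (vdim A i) (vdim A i)"
      by (intro eq_matI) (auto simp: d scalar_prod_def)
    ultimately show False using rs[of i] one_mat_eq_zero_iff by metis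
  qed
  ultimately show ?thesis by (intro exI[of _ Q] exI[of _ B] exI[of _ C]) (simp add: Qd q_def)
qed

text \<open>Let k be the length of a longest nonzero path, and let it act nontrivially on a vector x at the vertex a.
Then x generates a copy of M(a,b) with b = a + k + 1. A linear form at the vertex a + k that
does not vanish on the end of the path, composed with the remaining paths to that vertex, defines a map
back; it respects the arrow that enters a because the paths of length k + 1 are zero.\<close>

lemma interval_retract_exists:
  assumes n: "0 < n" and M: "rep n M" and nz: "\<not> is_zero M"
  shows "\<exists>a b s r. a < b \<and> b < a + n \<and> s \<in> rep_hom n (interval_rep n a b) M \<and>
    r \<in> rep_hom n M (interval_rep n a b) \<and> (\<forall>i. r i * s i = 1\<^sub>m (vdim (interval_rep n a b) i))"
proof -
  note P = rep_prerep[OF M]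
  define K where "K = {k. \<exists>i. path_map M i k \<noteq> 0\<^sub>m (vdim M (i + int k)) (vdim M i)}"
  have K_less: "int k < n - 1" if "k \<in> K" for k
    using that rep_long_path[OF M n, of k] unfolding K_def by force
  have "K \<subseteq> {..<nat (n - 1)}"
  proof
    fix k assume "k \<in> K"
    from K_less[OF this] show "k \<in> {..<nat (n - 1)}" by simp
  qed
  then have fin: "finite K" by (rule finite_subset) simp
  obtain i0 where "vdim M i0 \<noteq> 0" using nz unfolding is_zero_def by auto
  then have "0 \<in> K" unfolding K_def using one_mat_eq_zero_iff by auto
  define k where "k = Max K"
  have "k \<in> K" unfolding k_def using fin \<open>0 \<in> K\<close> by (intro Max_in) auto
  have "Suc k \<notin> K" using Max_ge[OF fin, of "Suc k"] unfolding k_def by auto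
  then have zero: "path_map M i (Suc k) = 0\<^sub>m (vdim M (i + int (Suc k))) (vdim M i)" for i
    unfolding K_def by blast
  obtain a where a: "path_map M a k \<noteq> 0\<^sub>m (vdim M (a + int k)) (vdim M a)"
    using \<open>k \<in> K\<close> unfolding K_def by blast
  let ?p = "path_map M a k"
  have "\<exists>x y. x < vdim M (a + int k) \<and> y < vdim M a \<and> ?p $$ (x, y) \<noteq> 0"
  proof (rule ccontr)
    assume "\<not> ?thesis"
    then have "?p = 0\<^sub>m (vdim M (a + int k)) (vdim M a)"
      by (intro eq_matI) (auto simp: path_map_dims[OF P])
    then show False using a by simp
  qed
  then obtain x0 y0 where xy: "x0 < vdim M (a + int k)" "y0 < vdim M a" "?p $$ (x0, y0) \<noteq> 0" by blast
  define b where "b = a + int k + 1"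
  have ab: "a < b" "b < a + n" using K_less[OF \<open>k \<in> K\<close>] by (auto simp: b_def)
  \<comment> \<open>A basis vector and a rescaled coordinate form that detect a nonzero entry of the path.\<close>
  define x where "x = mat (vdim M a) 1 (\<lambda>(u, _). if u = y0 then 1 else 0 :: complex)"
  define \<phi> where "\<phi> = mat 1 (vdim M (a + int k)) (\<lambda>(_, u). if u = x0 then 1 / ?p $$ (x0, y0) else 0)"
  have \<phi>x: "\<phi> * ?p * x = 1\<^sub>m 1"
  proof (rule eq_matI)
    fix i j assume ij: "i < dim_row (1\<^sub>m 1 :: complex mat)" "j < dim_col (1\<^sub>m 1 :: complex mat)"
    have "(\<phi> * ?p * x) $$ (i, j) = (\<Sum>v = 0..<vdim M a. (\<phi> * ?p) $$ (0, v) * (if v = y0 then 1 else 0))"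
      using ij by (simp add: \<phi>_def x_def scalar_prod_def path_map_dims[OF P])
    also have "\<dots> = (\<phi> * ?p) $$ (0, y0)" using xy by (simp add: if_distrib sum.delta cong: if_cong)
    also have "\<dots> = (\<Sum>u = 0..<vdim M (a + int k). (if u = x0 then 1 / ?p $$ (x0, y0) else 0) * ?p $$ (u, y0))"
      using xy by (simp add: \<phi>_def scalar_prod_def path_map_dims[OF P])
    also have "\<dots> = 1" using xy by (simp add: if_distrib[of "\<lambda>t. t * _"] sum.delta cong: if_cong)
    finally show "(\<phi> * ?p * x) $$ (i, j) = 1\<^sub>m 1 $$ (i, j)" using ij by simp
  qed (simp_all add: \<phi>_def x_def)
  let ?I = "interval_rep n a b" and ?s = "interval_map n a b M x"
  have I: "prerep n ?I" using ab by (intro interval_prerep) auto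
  have natb: "nat (b - a) = Suc k" by (simp add: b_def)
  have x: "x \<in> carrier_mat (vdim M a) 1" by (simp add: x_def)
  have "path_map M a (nat (b - a)) * x = 0\<^sub>m (vdim M b) 1"
    unfolding natb zero using x by (simp add: b_def add.assoc add.commute[of 1])
  note s = interval_map_hom[OF ab P x this]
  define r where "r i = (let t = (i - a) mod n in
     if t < b - a then \<phi> * path_map M i (nat (b - 1 - a - t)) else 0\<^sub>m 0 (vdim M i))" for i
  have r_val: "r i = (if i < b then \<phi> * path_map M i (nat (b - 1 - i)) else 0\<^sub>m 0 (vdim M i))"
    if "a \<le> i" "i < a + n" for i
  proof -
    have e: "b - 1 - a - (i - a) = b - 1 - i" "i - a < b - a \<longleftrightarrow> i < b" by auto
    show ?thesis by (simp only: r_def Let_def mod_window[OF that] e)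
  qed
  have r_per: "r (i + n) = r i" for i
  proof -
    have "i + n - a = i - a + n" by simp
    then show ?thesis by (simp only: r_def mod_add_self2 prerepD(1)[OF P] path_map_periodic[OF P])
  qed
  have r_per1: "r (i + n + 1) = r (i + 1)" for i using r_per[of "i + 1"] by (simp add: algebra_simps)
  have r_car: "r i \<in> carrier_mat (vdim ?I i) (vdim M i)" for i
  proof (rule periodic_window[OF n, of "\<lambda>i. r i \<in> carrier_mat (vdim ?I i) (vdim M i)" a])
    fix i assume i: "a \<le> i" "i < a + n"
    then show "r i \<in> carrier_mat (vdim ?I i) (vdim M i)"
      using ab path_map_dims[OF P, of i "nat (b - 1 - i)"]
      by (auto simp: r_val interval_vdim supp_window[of a i n a b] \<phi>_def intro!: carrier_matI)
  qed (simp add: r_per prerepD(1)[OF P] prerepD(1)[OF I])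
  have r_hom: "r (i + 1) * vmap M i = vmap ?I i * r i" for i
  proof (rule periodic_window[OF n, of "\<lambda>i. r (i + 1) * vmap M i = vmap ?I i * r i" a])
    fix i assume i: "a \<le> i" "i < a + n"
    have dims: "dim_row (r j) = vdim ?I j" "dim_col (r j) = vdim M j" for j using r_car[of j] by auto
    consider "i + 1 < b" | "b \<le> i + 1" "i + 1 < a + n" | "i + 1 = a + n" using i by linarith
    then show "r (i + 1) * vmap M i = vmap ?I i * r i"
    proof cases
      case 1
      have nat: "nat (b - 1 - i) = Suc (nat (b - 1 - (i + 1)))" using 1 by simp
      have j: "i + 1 + int (nat (b - 1 - (i + 1))) = a + int k" using 1 by (simp add: b_def)
      have "r (i + 1) * vmap M i = \<phi> * path_map M (i + 1) (nat (b - 1 - (i + 1))) * vmap M i"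
        using 1 i ab by (simp add: r_val)
      also have "\<dots> = \<phi> * path_map M i (nat (b - 1 - i))"
        unfolding nat path_map_Suc_left[OF P] using j
        by (subst mult_assoc_dims) (simp_all only: path_map_dims[OF P] prerepD[OF P] \<phi>_def dim_col_mat)
      also have "\<dots> = r i" using 1 i by (simp add: r_val)
      also have "\<dots> = vmap ?I i * r i"
        using 1 i ab by (simp add: interval_vmap interval_vdim supp_window[of a _ n a b] ones_diag dims)
      finally show ?thesis .
    next
      case 2
      then have "vdim ?I (i + 1) = 0" using i ab by (simp add: interval_vdim supp_window[of a "i+1" n a b])
      then show ?thesis by (intro mat_eq_if_no_entries) (simp_all add: dims prerepD[OF P] prerepD[OF I])
    next
      case 3
      \<comment> \<open>The arrow from i enters the left end a of the next period, and both composites vanish.\<close>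
      have i0: "vdim ?I i = 0" using 3 i ab by (simp add: interval_vdim supp_window[of a i n a b])
      have "r (i + 1) = r a" using r_per[of a] 3 by simp
      also have "\<dots> = \<phi> * path_map M (i + 1) k"
        using r_val[of a] ab path_map_periodic[OF P, of a k] 3 by (simp add: b_def)
      finally have r1: "r (i + 1) = \<phi> * path_map M (i + 1) k" .
      have "vdim M (i + 1 + int k) = vdim M (a + int k)"
        using prerepD(1)[OF P, of "a + int k"] 3 by (simp add: algebra_simps)
      then have "r (i + 1) * vmap M i = \<phi> * path_map M i (Suc k)"
        unfolding r1 path_map_Suc_left[OF P]
        by (subst mult_assoc_dims) (simp_all only: path_map_dims[OF P] prerepD[OF P] \<phi>_def dim_col_mat)
      also have "\<dots> = 0\<^sub>m 1 (vdim M i)"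
        unfolding zero using \<open>vdim M (i + 1 + int k) = _\<close>
        by (simp add: \<phi>_def add.assoc add.commute[of 1])
      also have "\<dots> = vmap ?I i * r i"
      proof -
        have "supp n a b (a + n)" using supp_self[OF ab(1)] supp_periodic by simp
        then have "vdim ?I (i + 1) = 1" using 3 by (simp add: interval_vdim)
        then show ?thesis
          by (intro eq_matI) (auto simp: i0 dims prerepD[OF P] prerepD[OF I] scalar_prod_def)
      qed
      finally show ?thesis .
    qed
  next
    show "(r (i + n + 1) * vmap M (i + n) = vmap ?I (i + n) * r (i + n)) = (r (i + 1) * vmap M i = vmap ?I i * r i)" for i
      by (simp add: r_per r_per1 prerepD(3)[OF P] prerepD(3)[OF I])
  qed
  have r: "r \<in> rep_hom n M ?I" by (rule rep_homI[OF r_per r_car r_hom])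
  have "r i * ?s i = 1\<^sub>m (vdim ?I i)" for i
  proof (rule interval_hom_determined[OF _ ab(2) I rep_hom_comp[OF s(1) r I P I] rep_hom_id[OF I]])
    have "vdim ?I a = 1" using ab by (simp add: interval_vdim supp_self)
    moreover have "r a = \<phi> * ?p" using r_val[of a] ab by (simp add: b_def)
    ultimately show "r a * ?s a = 1\<^sub>m (vdim ?I a)" using s(2) \<phi>x by simp
  qed (use ab in simp)
  then show ?thesis using ab s(1) r by blast
qed

text \<open>The induction runs over the total dimension on one period. It is the decomposition into intervals
in the form in which it is used: only one summand is visible at a time.\<close>

lemma rep_induct [consumes 2, case_names zero split]:
  assumes n: "0 < n" and M: "rep n M"
    and zero: "\<And>M. rep n M \<Longrightarrow> is_zero M \<Longrightarrow> P M"
    and split: "\<And>M a b Q s i2 r p2. rep n M \<Longrightarrow> a < b \<Longrightarrow> b < a + n \<Longrightarrow> rep n Q \<Longrightarrow>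
      biprod n M (interval_rep n a b) Q s i2 r p2 \<Longrightarrow>
      (\<And>i. vdim M i = vdim (interval_rep n a b) i + vdim Q i) \<Longrightarrow> P Q \<Longrightarrow> P M"
  shows "P M"
  using M
proof (induction "\<Sum>i = 0..<n. vdim M i" arbitrary: M rule: less_induct)
  case less
  show ?case
  proof (cases "is_zero M")
    case True then show ?thesis using less zero by blast
  next
    case False
    obtain a b s r where ab: "a < b" "b < a + n" and s: "s \<in> rep_hom n (interval_rep n a b) M"
      and r: "r \<in> rep_hom n M (interval_rep n a b)"
      and rs: "\<And>i. r i * s i = 1\<^sub>m (vdim (interval_rep n a b) i)"
      using interval_retract_exists[OF n less.prems False] by blast
    have I: "prerep n (interval_rep n a b)" using ab by (intro interval_prerep) auto
    obtain Q i2 p2 where Q: "rep n Q" "biprod n M (interval_rep n a b) Q s i2 r p2"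
      and dim: "\<And>i. vdim M i = vdim (interval_rep n a b) i + vdim Q i"
      using retract_biprod[OF n less.prems I interval_vdim_le s r rs] by blast
    have "(\<Sum>i = 0..<n. vdim Q i) < (\<Sum>i = 0..<n. vdim M i)"
    proof (rule sum_strict_mono_ex1)
      have "a mod n = a + (- (a div n)) * n" by (simp add: minus_div_mult_eq_mod[symmetric])
      then have "supp n a b (a mod n)"
        using periodic_shift[of "supp n a b" n a "- (a div n)"] supp_periodic supp_self[OF ab(1)] by metis
      then have "vdim Q (a mod n) < vdim M (a mod n)" using dim[of "a mod n"] by (simp add: interval_vdim)
      then show "\<exists>i\<in>{0..<n}. vdim Q i < vdim M i" using n by (intro bexI[of _ "a mod n"]) auto
    qed (use dim in auto)
    then have "P Q" using less.hyps Q(1) by blast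
    then show ?thesis using split[OF less.prems ab Q dim] by blast
  qed
qed

section \<open>Bricks and indecomposables\<close>

text \<open>Over the complex numbers the endomorphism ring of a brick consists of scalars. In this form the
property also yields the scalars that recognise retracts among summands.\<close>

definition scalar_endos :: "int \<Rightarrow> qrep \<Rightarrow> bool" where
  "scalar_endos n M \<longleftrightarrow> (\<forall>f \<in> rep_hom n M M. \<exists>c. \<forall>i. f i = c \<cdot>\<^sub>m 1\<^sub>m (vdim M i))"

lemma scalar_hom: "prerep n M \<Longrightarrow> (\<lambda>i. c \<cdot>\<^sub>m 1\<^sub>m (vdim M i)) \<in> rep_hom n M M"
  by (rule rep_homI) (auto simp: prerepD smult_one_mult)

lemma interval_scalar_endos:
  assumes ab: "a < b" "b < a + n"
  shows "scalar_endos n (interval_rep n a b)"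
  unfolding scalar_endos_def
proof
  let ?I = "interval_rep n a b"
  have I: "prerep n ?I" using ab by (intro interval_prerep) auto
  fix f assume f: "f \<in> rep_hom n ?I ?I"
  define c where "c = f a $$ (0, 0)"
  have "vdim ?I a = 1" using ab by (simp add: interval_vdim supp_self)
  then have "f a = c \<cdot>\<^sub>m 1\<^sub>m (vdim ?I a)"
    using rep_homD(3,4)[OF f] by (intro eq_matI) (auto simp: c_def)
  then have "\<forall>i. f i = c \<cdot>\<^sub>m 1\<^sub>m (vdim ?I i)"
    using interval_hom_determined[OF less_imp_le[OF ab(1)] ab(2) I f scalar_hom[OF I]] by blast
  then show "\<exists>c. \<forall>i. f i = c \<cdot>\<^sub>m 1\<^sub>m (vdim ?I i)" by blast
qed

lemma scalar_endos_isomorphic: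
  assumes M: "scalar_endos n M" "prerep n M" and iso: "isomorphic n M N" and N: "prerep n N"
  shows "scalar_endos n N"
  unfolding scalar_endos_def
proof
  fix f assume f: "f \<in> rep_hom n N N"
  obtain u v where u: "u \<in> rep_hom n M N" and v: "v \<in> rep_hom n N M"
    and uv: "\<And>i. u i * v i = 1\<^sub>m (vdim N i)"
    using iso unfolding isomorphic_iff by blast
  note d = rep_homD(3,4)[OF u] rep_homD(3,4)[OF v] rep_homD(3,4)[OF f]
  have "(\<lambda>i. v i * (f i * u i)) \<in> rep_hom n M M"
    by (rule rep_hom_comp[OF rep_hom_comp[OF u f M(2) N N] v M(2) N M(2)])
  then obtain c where c: "\<And>i. v i * (f i * u i) = c \<cdot>\<^sub>m 1\<^sub>m (vdim M i)"
    using bspec[OF M(1)[unfolded scalar_endos_def]] by blast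
  have "f i = c \<cdot>\<^sub>m 1\<^sub>m (vdim N i)" for i
  proof -
    have "f i = (u i * v i) * f i * (u i * v i)" by (simp add: uv d)
    also have "\<dots> = u i * (v i * (f i * u i)) * v i" by (simp add: mult_assoc_dims d)
    also have "\<dots> = c \<cdot>\<^sub>m (u i * v i)"
      using mult_smult_assoc_mat[OF rep_hom_carrier[OF u] rep_hom_carrier[OF v], of c i]
      by (simp add: c smult_one_mult d)
    finally show ?thesis by (simp add: uv)
  qed
  then show "\<exists>c. \<forall>i. f i = c \<cdot>\<^sub>m 1\<^sub>m (vdim N i)" by blast
qed

lemma brick_if_scalar_endos:
  assumes M: "rep n M" "\<not> is_zero M" "scalar_endos n M"
  shows "brick n M"
  unfolding brick_def
proof (intro conjI ballI impI)
  fix f assume f: "f \<in> rep_hom n M M" and nz: "\<exists>i. f i \<noteq> 0\<^sub>m (vdim M i) (vdim M i)"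
  obtain c where c: "\<And>i. f i = c \<cdot>\<^sub>m 1\<^sub>m (vdim M i)" using f M(3) unfolding scalar_endos_def by blast
  have "c \<noteq> 0"
  proof
    assume "c = 0"
    then have "f i = 0\<^sub>m (vdim M i) (vdim M i)" for i unfolding c by (intro eq_matI) auto
    then show False using nz by blast
  qed
  let ?g = "\<lambda>i. (1 / c) \<cdot>\<^sub>m 1\<^sub>m (vdim M i)"
  have "?g \<in> rep_hom n M M" by (rule scalar_hom[OF rep_prerep[OF M(1)]])
  moreover have "?g i * f i = 1\<^sub>m (vdim M i)" "f i * ?g i = 1\<^sub>m (vdim M i)" for i
    using \<open>c \<noteq> 0\<close> unfolding c by (auto simp: smult_one_mult intro!: eq_matI)
  ultimately show "f \<in> rep_iso n M M" using f unfolding rep_iso_def mem_Collect_eq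
    by (intro conjI bexI[of _ ?g]) auto
qed (use M in auto)

lemma interval_not_zero: "a < b \<Longrightarrow> \<not> is_zero (interval_rep n a b)"
  unfolding is_zero_def by (auto simp: interval_vdim intro!: exI[of _ a] supp_self)

lemma isomorphic_vdim_zero:
  assumes "isomorphic n M N" "vdim N i = 0"
  shows "vdim M i = 0"
proof -
  obtain f g where f: "f \<in> rep_hom n M N" and g: "g \<in> rep_hom n N M"
    and gf: "\<And>i. g i * f i = 1\<^sub>m (vdim M i)" using assms(1) unfolding isomorphic_iff by blast
  have "g i * f i = 0\<^sub>m (vdim M i) (vdim M i)"
    using assms(2) rep_homD(3,4)[OF f] rep_homD(3,4)[OF g] by (intro eq_matI) (auto simp: scalar_prod_def)
  then show ?thesis using gf one_mat_eq_zero_iff by metis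
qed

lemma brick_if_isomorphic_interval:
  assumes ab: "a < b" "b < a + n" and M: "rep n M" "isomorphic n M (interval_rep n a b)"
  shows "brick n M"
proof (rule brick_if_scalar_endos[OF M(1)])
  have I: "prerep n (interval_rep n a b)" using ab by (intro interval_prerep) auto
  show "scalar_endos n M"
    using scalar_endos_isomorphic[OF interval_scalar_endos[OF ab] I isomorphic_sym[OF M(2)] rep_prerep[OF M(1)]] .
  show "\<not> is_zero M"
    using isomorphic_vdim_zero[OF isomorphic_sym[OF M(2)]] interval_not_zero[OF ab(1)] unfolding is_zero_def by blast
qed

text \<open>A split interval gives an idempotent endomorphism. It is not zero, so it is invertible and hence the
identity.\<close>

lemma brick_is_interval:
  assumes n: "0 < n" and M: "brick n M"
  shows "\<exists>a b. a < b \<and> b < a + n \<and> isomorphic n M (interval_rep n a b)"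
proof -
  have rep: "rep n M" and nz: "\<not> is_zero M" using M unfolding brick_def by auto
  obtain a b s r where ab: "a < b" "b < a + n" and s: "s \<in> rep_hom n (interval_rep n a b) M"
    and r: "r \<in> rep_hom n M (interval_rep n a b)"
    and rs: "\<And>i. r i * s i = 1\<^sub>m (vdim (interval_rep n a b) i)"
    using interval_retract_exists[OF n rep nz] by blast
  let ?I = "interval_rep n a b"
  have I: "prerep n ?I" using ab by (intro interval_prerep) auto
  note d = rep_homD(3,4)[OF s] rep_homD(3,4)[OF r]
  have idem: "s i * r i * (s i * r i) = s i * r i" for i
  proof -
    have "s i * r i * (s i * r i) = s i * (r i * s i * r i)" by (simp add: mult_assoc_dims d)
    then show ?thesis by (simp add: rs d)
  qed
  have "s a * r a \<noteq> 0\<^sub>m (vdim M a) (vdim M a)"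
  proof
    assume z: "s a * r a = 0\<^sub>m (vdim M a) (vdim M a)"
    have "1\<^sub>m (vdim ?I a) = r a * s a * (r a * s a)" by (simp add: rs)
    also have "\<dots> = r a * (s a * r a) * s a" by (simp add: mult_assoc_dims d)
    also have "\<dots> = 0\<^sub>m (vdim ?I a) (vdim ?I a)" by (simp add: z d)
    finally have "vdim ?I a = 0" by (simp add: one_mat_eq_zero_iff)
    then show False using supp_self[OF ab(1)] by (simp add: interval_vdim)
  qed
  moreover have "f \<in> rep_iso n M M" if "f \<in> rep_hom n M M" "f a \<noteq> 0\<^sub>m (vdim M a) (vdim M a)" for f
    using M that unfolding brick_def by blast
  ultimately have "(\<lambda>i. s i * r i) \<in> rep_iso n M M"
    using rep_hom_comp[OF r s rep_prerep[OF rep] I rep_prerep[OF rep]] by simp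
  then obtain k where k: "k \<in> rep_hom n M M" "\<And>i. k i * (s i * r i) = 1\<^sub>m (vdim M i)"
    unfolding rep_iso_def by blast
  have "s i * r i = 1\<^sub>m (vdim M i)" for i
  proof -
    have "s i * r i = k i * (s i * r i) * (s i * r i)" by (simp add: k(2) d)
    also have "\<dots> = k i * (s i * r i * (s i * r i))"
      by (rule mult_assoc_dims) (simp_all add: rep_homD(3,4)[OF k(1)] d)
    finally show ?thesis by (simp add: idem k(2))
  qed
  then show ?thesis using isomorphicI[OF r s _ rs] ab by blast
qed

lemma direct_sum_singleton: "direct_sum [M] = M"
  by (simp add: direct_sum_def del: diag_block_mat.simps)

lemma direct_sum_pair_biprod:
  assumes "prerep n U" "prerep n V"
  shows "prerep n (direct_sum [U, V])" "\<exists>i1 i2 p1 p2. biprod n (direct_sum [U, V]) U V i1 i2 p1 p2"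
  using direct_sum_Cons_biprod[of n U "[V]"] assms by (simp_all add: direct_sum_singleton)

lemma biprod_isomorphic_direct_sum:
  assumes B: "biprod n E U V i1 i2 p1 p2" and P: "prerep n E" "prerep n U" "prerep n V"
  shows "isomorphic n E (direct_sum [U, V])"
  using biprod_unique[OF B _ P(1) _ P(2,3)] direct_sum_pair_biprod[OF P(2,3)] by blast

text \<open>The projection to a summand is a scalar and an idempotent.\<close>

lemma interval_indecomposable:
  assumes ab: "a < b" "b < a + n"
  shows "indecomposable n (interval_rep n a b)"
  unfolding indecomposable_def
proof (intro conjI allI impI)
  let ?I = "interval_rep n a b"
  show "rep n ?I" using ab by (intro interval_rep_is_rep) auto
  then have I: "prerep n ?I" by (rule rep_prerep)
  show "\<not> is_zero ?I" by (rule interval_not_zero[OF ab(1)])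
  fix U V assume "rep n U \<and> rep n V \<and> isomorphic n ?I (direct_sum [U, V])"
  then have U: "prerep n U" and V: "prerep n V" and iso: "isomorphic n ?I (direct_sum [U, V])"
    using rep_prerep by auto
  obtain i1 i2 p1 p2 where B: "biprod n ?I U V i1 i2 p1 p2"
    using direct_sum_pair_biprod[OF U V] biprod_iso[OF _ iso _ I U V] by blast
  note h = biprodD(1-4)[OF B]
  note d = h[THEN rep_homD(3)] h[THEN rep_homD(4)]
  obtain c where c: "\<And>i. i1 i * p1 i = c \<cdot>\<^sub>m 1\<^sub>m (vdim ?I i)"
    using bspec[OF interval_scalar_endos[OF ab, unfolded scalar_endos_def] rep_hom_comp[OF h(3,1) I U I]]
    by blast
  show "is_zero U \<or> is_zero V"
  proof (cases "c = 0")
    case True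
    have "vdim U i = 0" for i
    proof -
      have "1\<^sub>m (vdim U i) = p1 i * i1 i * (p1 i * i1 i)" by (simp add: biprodD(5)[OF B])
      also have "\<dots> = p1 i * (i1 i * p1 i) * i1 i" by (simp add: mult_assoc_dims d)
      also have "i1 i * p1 i = 0\<^sub>m (vdim ?I i) (vdim ?I i)" unfolding c True by (intro eq_matI) auto
      finally show ?thesis by (simp add: d one_mat_eq_zero_iff)
    qed
    then show ?thesis unfolding is_zero_def by blast
  next
    case False
    have "vdim V i = 0" for i
    proof -
      have "p2 i * (i1 i * p1 i) = p2 i * i1 i * p1 i" by (simp add: mult_assoc_dims d)
      then have "c \<cdot>\<^sub>m p2 i = 0\<^sub>m (vdim V i) (vdim ?I i)"
        by (simp add: c smult_one_mult d biprodD(8)[OF B])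
      then have "(1 / c) \<cdot>\<^sub>m (c \<cdot>\<^sub>m p2 i) = 0\<^sub>m (vdim V i) (vdim ?I i)" by auto
      moreover have "(1 / c) \<cdot>\<^sub>m (c \<cdot>\<^sub>m p2 i) = p2 i" using False by (intro eq_matI) auto
      ultimately have "p2 i = 0\<^sub>m (vdim V i) (vdim ?I i)" by simp
      then have "1\<^sub>m (vdim V i) = (0\<^sub>m (vdim V i) (vdim V i) :: complex mat)"
        using biprodD(6)[OF B, of i] by (simp add: d)
      then show ?thesis by (simp add: one_mat_eq_zero_iff)
    qed
    then show ?thesis unfolding is_zero_def by blast
  qed
qed

lemma indecomposable_retract:
  assumes n: "0 < n" and ab: "a < b" "b < a + n" and M: "indecomposable n M"
    and s: "s \<in> rep_hom n (interval_rep n a b) M" and r: "r \<in> rep_hom n M (interval_rep n a b)"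
    and rs: "\<And>i. r i * s i = 1\<^sub>m (vdim (interval_rep n a b) i)"
  shows "isomorphic n M (interval_rep n a b)"
proof -
  let ?I = "interval_rep n a b"
  have rep: "rep n M" using M unfolding indecomposable_def by blast
  have I: "rep n ?I" using ab by (intro interval_rep_is_rep) auto
  obtain Q i2 p2 where Q: "rep n Q" and B: "biprod n M ?I Q s i2 r p2"
    using retract_biprod[OF n rep rep_prerep[OF I] interval_vdim_le s r rs] by blast
  have "isomorphic n M (direct_sum [?I, Q])"
    using biprod_isomorphic_direct_sum[OF B] rep I Q rep_prerep by blast
  then have "is_zero Q"
    using M I Q interval_not_zero[OF ab(1)] unfolding indecomposable_def by blast
  then have "i2 i * p2 i = 0\<^sub>m (vdim M i) (vdim M i)" for i
    using rep_homD(3,4)[OF biprodD(2)[OF B]] rep_homD(3,4)[OF biprodD(4)[OF B]] unfolding is_zero_def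
    by (intro eq_matI) (auto simp: scalar_prod_def)
  then have "s i * r i = 1\<^sub>m (vdim M i)" for i
    using biprodD(9)[OF B, of i] rep_homD(3,4)[OF s] rep_homD(3,4)[OF r] by (simp add: add_zero_dims)
  then show ?thesis using isomorphicI[OF r s _ rs] by blast
qed

lemma indecomposable_is_interval:
  assumes n: "0 < n" and M: "indecomposable n M"
  shows "\<exists>a b. a < b \<and> b < a + n \<and> isomorphic n M (interval_rep n a b)"
proof -
  have "rep n M" "\<not> is_zero M" using M unfolding indecomposable_def by auto
  from interval_retract_exists[OF n this] show ?thesis
    using indecomposable_retract[OF n _ _ M] by metis
qed

text \<open>Retracts compose without keeping track of complements; for intervals, the complement exists by
the explicit construction above.\<close>

definition retract :: "int \<Rightarrow> qrep \<Rightarrow> qrep \<Rightarrow> bool" where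
  "retract n A M \<longleftrightarrow> (\<exists>s \<in> rep_hom n A M. \<exists>r \<in> rep_hom n M A. \<forall>i. r i * s i = 1\<^sub>m (vdim A i))"

lemma summand_iff_retract:
  assumes n: "0 < n" and ab: "a < b" "b < a + n" and P: "rep n P"
  shows "summand n (interval_rep n a b) P \<longleftrightarrow> retract n (interval_rep n a b) P"
proof
  let ?I = "interval_rep n a b"
  have I: "prerep n ?I" using ab by (intro interval_prerep) auto
  show "retract n ?I P" if sm: "summand n ?I P"
  proof -
    obtain Q where Q: "rep n Q" and iso: "isomorphic n P (direct_sum [?I, Q])"
      using sm unfolding summand_def by blast
    obtain i1 i2 p1 p2 where B: "biprod n P ?I Q i1 i2 p1 p2"
      using direct_sum_pair_biprod[OF I rep_prerep[OF Q]] biprod_iso[OF _ iso _ rep_prerep[OF P] I rep_prerep[OF Q]] by blast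
    show ?thesis using biprodD(1,3,5)[OF B] unfolding retract_def by blast
  qed
  show "summand n ?I P" if re: "retract n ?I P"
  proof -
    obtain s r where "s \<in> rep_hom n ?I P" "r \<in> rep_hom n P ?I" "\<And>i. r i * s i = 1\<^sub>m (vdim ?I i)"
      using re unfolding retract_def by blast
    then obtain Q i2 p2 where Q: "rep n Q" "biprod n P ?I Q s i2 r p2"
      using retract_biprod[OF n P I interval_vdim_le] by blast
    then show ?thesis
      using biprod_isomorphic_direct_sum[OF Q(2) rep_prerep[OF P] I rep_prerep[OF Q(1)]]
      unfolding summand_def by blast
  qed
qed


section \<open>Short exact sequences\<close>

lemma rep_injD:
  assumes "f \<in> rep_inj n M N"
  shows "f \<in> rep_hom n M N"
    "\<And>i X Y. dim_row X = vdim M i \<Longrightarrow> dim_row Y = vdim M i \<Longrightarrow> dim_col X = dim_col Y \<Longrightarrow>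
      f i * X = f i * Y \<Longrightarrow> X = Y"
proof -
  show f: "f \<in> rep_hom n M N" using assms unfolding rep_inj_def by auto
  show "X = Y" if "dim_row X = vdim M i" "dim_row Y = vdim M i" "dim_col X = dim_col Y" "f i * X = f i * Y"
    for i X Y
    by (rule inj_matrix_cancel[of "f i"]) (use that assms rep_homD(4)[OF f] in \<open>auto simp: rep_inj_def\<close>)
qed

text \<open>Exactness in the middle is expressed for matrices rather than vectors: whatever g kills factors
through f.\<close>

lemma extensionsD:
  assumes "(E, f, g) \<in> extensions n M N"
  shows "rep n E" "f \<in> rep_inj n N E" "g \<in> rep_surj n E M"
    "g i * f i = 0\<^sub>m (vdim M i) (vdim N i)"
    "dim_row X = vdim E i \<Longrightarrow> g i * X = 0\<^sub>m (vdim M i) (dim_col X) \<Longrightarrow>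
      \<exists>Y \<in> carrier_mat (vdim N i) (dim_col X). f i * Y = X"
proof -
  show *: "rep n E" "f \<in> rep_inj n N E" "g \<in> rep_surj n E M"
    using assms unfolding extensions_def by auto
  have im: "\<And>i. (*\<^sub>v) (f i) ` carrier_vec (vdim N i) = mat_kernel (g i)"
    using assms unfolding extensions_def by auto
  have f: "f \<in> rep_hom n N E" and g: "g \<in> rep_hom n E M"
    using * unfolding rep_inj_def rep_surj_def by auto
  note d = rep_homD(3,4)[OF f] rep_homD(3,4)[OF g]
  show "g i * f i = 0\<^sub>m (vdim M i) (vdim N i)"
  proof (rule mat_col_eqI)
    fix j assume j: "j < dim_col (0\<^sub>m (vdim M i) (vdim N i) :: complex mat)"
    have "col (f i) j = f i *\<^sub>v unit_vec (vdim N i) j"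
      using j col_times[of "f i" "1\<^sub>m (vdim N i)" j] by (simp add: d)
    then have "col (f i) j \<in> mat_kernel (g i)" unfolding im[symmetric] by (rule image_eqI) simp
    then show "col (g i * f i) j = col (0\<^sub>m (vdim M i) (vdim N i)) j"
      using j by (subst col_times) (auto simp: d mat_kernel_def)
  qed (simp_all add: d)
  show "\<exists>Y \<in> carrier_mat (vdim N i) (dim_col X). f i * Y = X"
    if X: "dim_row X = vdim E i" "g i * X = 0\<^sub>m (vdim M i) (dim_col X)"
  proof -
    have "col X j \<in> (*\<^sub>v) (f i) ` carrier_vec (dim_col (f i))" if "j < dim_col X" for j
    proof -
      have "g i *\<^sub>v col X j = col (g i * X) j" using that X by (subst col_times) (auto simp: d)
      also have "\<dots> = 0\<^sub>v (vdim M i)" unfolding X(2) using that by auto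
      finally have "col X j \<in> mat_kernel (g i)"
        using X(1) by (intro mat_kernelI[OF rep_hom_carrier[OF g]]) (auto intro: carrier_vecI)
      then show ?thesis unfolding im[symmetric] d(2) .
    qed
    then show ?thesis using columns_in_image[of X "f i"] X by (metis d(1,2))
  qed
qed

text \<open>Exactness is a condition at each vertex, and a splitting of vector spaces certifies it.\<close>

lemma extensionsI:
  assumes E: "rep n E" and f: "f \<in> rep_hom n N E" and g: "g \<in> rep_hom n E M"
    and \<rho>: "\<And>i. \<rho> i \<in> carrier_mat (vdim N i) (vdim E i)" "\<And>i. \<rho> i * f i = 1\<^sub>m (vdim N i)"
    and \<sigma>: "\<And>i. \<sigma> i \<in> carrier_mat (vdim E i) (vdim M i)" "\<And>i. g i * \<sigma> i = 1\<^sub>m (vdim M i)"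
    and gf: "\<And>i. g i * f i = 0\<^sub>m (vdim M i) (vdim N i)"
    and sum: "\<And>i. f i * \<rho> i + \<sigma> i * g i = 1\<^sub>m (vdim E i)"
  shows "(E, f, g) \<in> extensions n M N"
proof -
  note cf = rep_hom_carrier[OF f] and cg = rep_hom_carrier[OF g]
  have "(*\<^sub>v) (f i) ` carrier_vec (vdim N i) = mat_kernel (g i)" for i
  proof
    show "(*\<^sub>v) (f i) ` carrier_vec (vdim N i) \<subseteq> mat_kernel (g i)"
    proof
      fix w assume "w \<in> (*\<^sub>v) (f i) ` carrier_vec (vdim N i)"
      then obtain v where v: "v \<in> carrier_vec (vdim N i)" "w = f i *\<^sub>v v" by auto
      have "g i *\<^sub>v w = (g i * f i) *\<^sub>v v" unfolding v(2) using v(1) cf cg by (metis assoc_mult_mat_vec)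
      also have "\<dots> = 0\<^sub>v (vdim M i)" unfolding gf using v(1) by (intro eq_vecI) auto
      finally have "g i *\<^sub>v w = 0\<^sub>v (vdim M i)" .
      then show "w \<in> mat_kernel (g i)"
        using v mult_mat_vec_carrier[OF cf v(1)] by (intro mat_kernelI[OF cg]) auto
    qed
    show "mat_kernel (g i) \<subseteq> (*\<^sub>v) (f i) ` carrier_vec (vdim N i)"
    proof
      fix w assume "w \<in> mat_kernel (g i)"
      then have w: "w \<in> carrier_vec (vdim E i)" "g i *\<^sub>v w = 0\<^sub>v (vdim M i)"
        using mat_kernelD[OF cg] by auto
      have "w = (f i * \<rho> i + \<sigma> i * g i) *\<^sub>v w" using w(1) by (simp add: sum)
      also have "\<dots> = f i * \<rho> i *\<^sub>v w + \<sigma> i * g i *\<^sub>v w"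

        using w(1) by (rule add_mult_distrib_mat_vec[OF mult_carrier_mat[OF cf \<rho>(1)] mult_carrier_mat[OF \<sigma>(1) cg]])
      also have "f i * \<rho> i *\<^sub>v w = f i *\<^sub>v (\<rho> i *\<^sub>v w)" using w(1) cf \<rho>(1) by (metis assoc_mult_mat_vec)
      also have "\<sigma> i * g i *\<^sub>v w = \<sigma> i *\<^sub>v (g i *\<^sub>v w)" using w(1) cg \<sigma>(1) by (metis assoc_mult_mat_vec)
      also have "\<dots> = 0\<^sub>v (vdim E i)" unfolding w(2) using \<sigma>(1)[of i] by (intro eq_vecI) auto
      also have "f i *\<^sub>v (\<rho> i *\<^sub>v w) + 0\<^sub>v (vdim E i) = f i *\<^sub>v (\<rho> i *\<^sub>v w)"
        using cf[of i] by (intro eq_vecI) auto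
      finally show "w \<in> (*\<^sub>v) (f i) ` carrier_vec (vdim N i)"
        using mult_mat_vec_carrier[OF \<rho>(1) w(1)] by blast
    qed
  qed
  moreover have "f \<in> rep_inj n N E" by (rule rep_injI[OF f \<rho>])
  moreover have "g \<in> rep_surj n E M" by (rule rep_surjI[OF g \<sigma>])
  ultimately show ?thesis using E unfolding extensions_def by blast
qed

lemma biprod_extension:
  assumes "biprod n E U V i1 i2 p1 p2" "rep n E"
  shows "(E, i1, p2) \<in> extensions n V U"
  by (rule extensionsI[OF assms(2) biprodD(1,4)[OF assms(1)], of p1 i2])
    (use biprodD[OF assms(1)] rep_hom_carrier in auto)

text \<open>The induced map on the quotient is u composed with any right inverse of g, since the error lies in
the image of f.\<close>

lemma extension_factor:
  assumes ext: "(E, f, g) \<in> extensions n M N" and M: "prerep n M" and X: "prerep n X"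
    and u: "u \<in> rep_hom n E X" and uf: "\<And>i. u i * f i = 0\<^sub>m (vdim X i) (vdim N i)"
  shows "\<exists>h \<in> rep_hom n M X. \<forall>i. h i * g i = u i"
proof -
  note E = rep_prerep[OF extensionsD(1)[OF ext]]
  have f: "f \<in> rep_hom n N E" using extensionsD(2)[OF ext] by (rule rep_injD)
  obtain G where g: "g \<in> rep_hom n E M" and G: "\<And>i. G (i + n) = G i"
    "\<And>i. dim_row (G i) = vdim E i" "\<And>i. dim_col (G i) = vdim M i" "\<And>i. g i * G i = 1\<^sub>m (vdim M i)"
    using rep_surjE[OF extensionsD(3)[OF ext]] by metis
  note d = rep_homD(3,4)[OF f] rep_homD(3,4)[OF g] rep_homD(3,4)[OF u] G(2,3)
    prerepD(4,5)[OF E] prerepD(4,5)[OF M] prerepD(4,5)[OF X]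
  have hg: "u i * G i * g i = u i" for i
  proof -
    let ?Z = "G i * g i - 1\<^sub>m (vdim E i)"
    have "g i * ?Z = g i * G i * g i - g i" by (simp add: distrib_dims mult_assoc_dims d)
    also have "\<dots> = 0\<^sub>m (vdim M i) (dim_col ?Z)" by (simp add: G(4) d) (auto simp: d intro!: eq_matI)
    finally obtain Y where Y: "Y \<in> carrier_mat (vdim N i) (vdim E i)" "f i * Y = ?Z"
      using extensionsD(5)[OF ext, of ?Z i] by (auto simp: d)
    have "u i * ?Z = u i * f i * Y" unfolding Y(2)[symmetric] using Y(1) by (simp add: mult_assoc_dims d)
    also have "\<dots> = 0\<^sub>m (vdim X i) (vdim E i)" using Y(1) by (simp add: uf)
    finally have "u i * G i * g i - u i = 0\<^sub>m (vdim X i) (vdim E i)"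
      by (simp add: distrib_dims mult_assoc_dims d)
    moreover have "u i * G i * g i = (u i * G i * g i - u i) + u i"
      by (intro eq_matI) (simp_all add: d)
    ultimately show ?thesis by (simp add: add_zero_dims d)
  qed
  have "(\<lambda>i. u i * G i) \<in> rep_hom n M X"
  proof (rule rep_homI)
    fix i
    have "u (i + 1) * G (i + 1) * vmap M i = u (i + 1) * G (i + 1) * (vmap M i * g i) * G i"
      by (simp add: mult_assoc_dims d G(4))
    also have "\<dots> = u (i + 1) * G (i + 1) * g (i + 1) * vmap E i * G i"
      unfolding rep_homD(5)[OF g, symmetric] by (simp add: mult_assoc_dims d)
    also have "\<dots> = vmap X i * (u i * G i)"
      unfolding hg rep_homD(5)[OF u] by (simp add: mult_assoc_dims d)
    finally show "u (i + 1) * G (i + 1) * vmap M i = vmap X i * (u i * G i)" .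
  qed (auto simp: rep_homD(1)[OF u] G(1) d)
  then show ?thesis using hg by (intro bexI[of _ "\<lambda>i. u i * G i"]) auto
qed

section \<open>The torsion class of an affine arc torsion class\<close>

lemma arc_translate: "arc n (a + k * n) (b + k * n) = arc n a b"
proof -
  have "arc n (a + k * n) (b + k * n) \<subseteq> arc n a b" for a b k
    unfolding arc_def by (auto intro: exI[of _ "k + _"] simp: algebra_simps)
  from this[of a k b] this[of "a + k * n" "- k" "b + k * n"] show ?thesis by simp
qed

text \<open>After a translation, the left end of the target lies in the support of the source. If it were not the
left end of the source, the element there would come from the preceding vertex, where the target is
zero.\<close>

lemma interval_quotient_of_interval:
  assumes ab: "a < b" "b < a + n" and cd: "c < d" "d < c + n"
    and q: "is_quotient n (interval_rep n c d) (interval_rep n a b)"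
  shows "\<exists>e. a < e \<and> e \<le> b \<and> arc n c d = arc n a e"
proof -
  let ?I = "interval_rep n a b"
  have I: "prerep n ?I" using ab by (intro interval_prerep) auto
  have n: "0 < n" using ab by simp
  \<comment> \<open>Translate the target so that its left end lies in the window that starts at a.\<close>
  define k where "k = - ((c - a) div n)"
  define c' where "c' = c + k * n"
  define d' where "d' = d + k * n"
  have c'_eq: "c' = a + (c - a) mod n" by (simp add: c'_def k_def minus_div_mult_eq_mod[symmetric])
  have c': "a \<le> c'" "c' < a + n" using n by (auto simp: c'_eq)
  have cd': "c' < d'" "d' < c' + n" using cd by (auto simp: c'_def d'_def)
  let ?J = "interval_rep n c' d'"
  have J_eq: "?J = interval_rep n c d" unfolding c'_def d'_def by (rule interval_translate)
  have J: "prerep n ?J" using cd' by (intro interval_prerep) auto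
  obtain f where "f \<in> rep_surj n ?I ?J" using q unfolding is_quotient_def J_eq by blast
  then obtain G where f: "f \<in> rep_hom n ?I ?J" "\<And>i. dim_row (G i) = vdim ?I i"
      "\<And>i. dim_col (G i) = vdim ?J i" and fG: "\<And>i. f i * G i = 1\<^sub>m (vdim ?J i)"
    by (metis rep_surjE)
  note d = rep_homD(3,4)[OF f(1)] f(2,3)
  have sub: "supp n a b i" if "supp n c' d' i" for i
  proof (rule ccontr)
    assume "\<not> supp n a b i"
    then have "f i * G i = 0\<^sub>m 1 1" using that by (intro eq_matI) (auto simp: d interval_vdim scalar_prod_def)
    then have "1\<^sub>m 1 = (0\<^sub>m 1 1 :: complex mat)" using fG[of i] that by (simp add: interval_vdim)
    then show False by (simp add: one_mat_eq_zero_iff)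
  qed
  have "supp n a b c'" using sub supp_self[OF cd'(1)] by blast
  then have c'b: "c' < b" using c' ab by (simp add: supp_window[of a c' n a b])
  have "c' = a"
  proof (rule ccontr)
    assume "c' \<noteq> a"
    then have i: "supp n a b (c' - 1)" using c' c'b ab by (simp add: supp_window[of a _ n a b])
    have j: "\<not> supp n c' d' (c' - 1)"
      using supp_window[of "c' - 1" "c' - 1" n "c'" d'] cd' by simp
    have v: "vmap ?I (c' - 1) = 1\<^sub>m 1"
      using ab i \<open>supp n a b c'\<close> by (simp add: interval_vmap interval_vdim ones_diag)
    have "f c' = f c' * vmap ?I (c' - 1)" using \<open>supp n a b c'\<close> by (simp add: v d interval_vdim)
    also have "\<dots> = vmap ?J (c' - 1) * f (c' - 1)" using rep_homD(5)[OF f(1), of "c' - 1"] by simp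
    also have "\<dots> = 0\<^sub>m 1 1"
      using i j supp_self[OF cd'(1)]
      by (intro eq_matI) (auto simp: d interval_vdim prerepD(4,5)[OF J] scalar_prod_def)
    finally have "f c' * G c' = 0\<^sub>m 1 1"
      using \<open>supp n a b c'\<close> supp_self[OF cd'(1), of n] by (simp add: d interval_vdim)
    then have "1\<^sub>m 1 = (0\<^sub>m 1 1 :: complex mat)"
      using fG[of c'] supp_self[OF cd'(1), of n] by (simp add: interval_vdim)
    then show False by (simp add: one_mat_eq_zero_iff)
  qed
  moreover have "d' \<le> b"
  proof (rule ccontr)
    assume "\<not> d' \<le> b"
    then have "supp n c' d' b" using c'b cd' by (simp add: supp_window[of c' b n c' d'])
    then show False using sub not_supp_end[of a b n] ab by auto
  qed
  moreover have "arc n c d = arc n c' d'" unfolding c'_def d'_def by (rule arc_translate[symmetric])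
  ultimately show ?thesis using cd' by auto
qed

text \<open>Membership is tested on interval quotients instead of on a decomposition into intervals, so that
closure under quotients is immediate and closure under extensions becomes a statement about a single
map into an interval.\<close>

definition quotient_class :: "int \<Rightarrow> (int \<times> int) set set \<Rightarrow> qrep set" where
  "quotient_class n D = {M. rep n M \<and>
     (\<forall>a b. a < b \<and> b < a + n \<and> is_quotient n (interval_rep n a b) M \<longrightarrow> arc n a b \<in> D)}"

lemma is_quotient_refl: "rep n M \<Longrightarrow> is_quotient n M M"
  using is_quotient_if_isomorphic isomorphic_refl rep_prerep by blast

lemma interval_in_quotient_class_iff:
  assumes D: "affine_arc_torsion_class n D" and ab: "a < b" "b < a + n"
  shows "interval_rep n a b \<in> quotient_class n D \<longleftrightarrow> arc n a b \<in> D"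
proof
  have I: "rep n (interval_rep n a b)" using ab by (intro interval_rep_is_rep) auto
  show "arc n a b \<in> D" if "interval_rep n a b \<in> quotient_class n D"
    using that ab is_quotient_refl[OF I] unfolding quotient_class_def by blast
  assume arc: "arc n a b \<in> D"
  have "arc n c d \<in> D" if cd: "c < d" "d < c + n" and q: "is_quotient n (interval_rep n c d) (interval_rep n a b)" for c d
  proof -
    obtain e where e: "a < e" "e \<le> b" "arc n c d = arc n a e"
      using interval_quotient_of_interval[OF ab cd q] by blast
    then show ?thesis using arc D unfolding affine_arc_torsion_class_def by (metis order_le_less)
  qed
  then show "interval_rep n a b \<in> quotient_class n D" using I unfolding quotient_class_def by blast
qed

text \<open>The arrows inside the interval are identities, so once the map is nonzero it stays nonzero up to b - 1.
Its image is thus M(c,b), where c is the first vertex at which it does not vanish, and c = b if there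
is none.\<close>

lemma image_in_interval:
  assumes ab: "a < b" "b < a + n" and N: "rep n N" and v: "v \<in> rep_hom n N (interval_rep n a b)"
  shows "\<exists>c. a \<le> c \<and> c \<le> b \<and> (\<forall>i. a \<le> i \<and> i < c \<longrightarrow> v i = 0\<^sub>m (vdim (interval_rep n a b) i) (vdim N i)) \<and>
    (c < b \<longrightarrow> is_quotient n (interval_rep n c b) N)"
proof -
  let ?I = "interval_rep n a b"
  note P = rep_prerep[OF N]
  have n: "0 < n" using ab by simp
  have I: "prerep n ?I" using ab by (intro interval_prerep) auto
  define nz where "nz i \<longleftrightarrow> v i \<noteq> 0\<^sub>m (vdim ?I i) (vdim N i)" for i
  note d = rep_homD(3,4)[OF v] prerepD(4,5)[OF P] prerepD(4,5)[OF I]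
  have step: "nz (i + 1)" if "nz i" "a \<le> i" "i + 1 < b" for i
  proof (rule ccontr)
    assume "\<not> nz (i + 1)"
    then have z: "v (i + 1) = 0\<^sub>m (vdim ?I (i + 1)) (vdim N (i + 1))" by (simp add: nz_def)
    have "supp n a b i" "supp n a b (i + 1)"
      using that ab by (auto simp: supp_window[of a _ n a b])
    then have "vmap ?I i = 1\<^sub>m 1" "vdim ?I i = 1" "vdim ?I (i + 1) = 1"
      using ab by (simp_all add: interval_vmap interval_vdim ones_diag)
    then have "v i = vmap ?I i * v i" by (simp add: d)
    also have "\<dots> = v (i + 1) * vmap N i" by (simp add: rep_homD(5)[OF v])
    also have "\<dots> = 0\<^sub>m (vdim ?I i) (vdim N i)"
      using \<open>vdim ?I i = 1\<close> \<open>vdim ?I (i + 1) = 1\<close> by (simp add: z d)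
    finally show False using \<open>nz i\<close> by (simp add: nz_def)
  qed
  define S where "S = {i. a \<le> i \<and> i < b \<and> nz i}"
  have "finite S" by (rule finite_subset[of _ "{a..b}"]) (auto simp: S_def)
  define c where "c = (if S = {} then b else Min S)"
  have "Min S \<in> S" if "S \<noteq> {}" using Min_in[OF \<open>finite S\<close> that] .
  then have "S = {} \<or> (a \<le> Min S \<and> Min S < b)" unfolding S_def by blast
  then have c: "a \<le> c" "c \<le> b" using ab by (auto simp: c_def)
  have before: "\<not> nz i" if "a \<le> i" "i < c" for i
  proof
    assume "nz i"
    then have "i \<in> S" using that c by (simp add: S_def)
    then have "S \<noteq> {}" "Min S \<le> i" using Min_le[OF \<open>finite S\<close>] by auto
    then show False using that(2) by (simp add: c_def)
  qed
  have after: "nz (c + int k)" if "c + int k < b" for k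
    using that
  proof (induction k)
    case 0
    then have "S \<noteq> {}" by (auto simp: c_def)
    then show ?case using Min_in[OF \<open>finite S\<close>] by (auto simp: c_def S_def)
  next
    case (Suc k)
    then show ?case using step[of "c + int k"] c by (simp add: algebra_simps)
  qed
  have after: "nz i" if "c \<le> i" "i < b" for i
    using after[of "nat (i - c)"] that by simp
  have "is_quotient n (interval_rep n c b) N" if "c < b"
  proof -
    let ?J = "interval_rep n c b"
    have cb: "c \<le> b" "b < c + n" using c ab by auto
    note J = interval_prerep[OF cb]
    define w where "w i = (if supp n c b i then v i else 0\<^sub>m 0 (vdim N i))" for i
    have sub: "supp n a b i" if "supp n c b i" for i
      using that c unfolding supp_def by (meson order_trans)
    have wper: "w (i + n) = w i" for i
      by (simp add: w_def supp_periodic rep_homD(1)[OF v] prerepD(1)[OF P])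
    have wper1: "w (i + n + 1) = w (i + 1)" for i using wper[of "i + 1"] by (simp add: algebra_simps)
    have wd: "dim_row (w i) = vdim ?J i" "dim_col (w i) = vdim N i" for i
      using sub[of i] by (auto simp: w_def d interval_vdim)
    \<comment> \<open>At the vertex before c the map into M(a,b) vanishes, so cutting it off there is compatible with the
      arrow that enters c.\<close>
    have last: "v (c - 1) = 0\<^sub>m (vdim ?I (c - 1)) (vdim N (c - 1))"
    proof (cases "c = a")
      case True
      then have "vdim ?I (c - 1) = 0"
        using supp_window[of "a - 1" "a - 1" n a b] ab by (simp add: interval_vdim)
      then show ?thesis by (intro mat_eq_if_no_entries) (simp_all add: d)
    next
      case False
      then show ?thesis using before[of "c - 1"] c by (simp add: nz_def)
    qed
    have "w (i + 1) * vmap N i = vmap ?J i * w i" for i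
    proof (rule periodic_window[OF n, of "\<lambda>i. w (i + 1) * vmap N i = vmap ?J i * w i" c])
      fix i assume i: "c \<le> i" "i < c + n"
      consider "i + 1 < b" | "b \<le> i + 1" "i + 1 < c + n" | "i + 1 = c + n" using i by linarith
      then show "w (i + 1) * vmap N i = vmap ?J i * w i"
      proof cases
        case 1
        then have "supp n c b i" "supp n c b (i + 1)" using i cb by (auto simp: supp_window[of c _ n c b])
        moreover from this have "vmap ?J i = vmap ?I i"
          using sub cb ab by (simp add: interval_vmap interval_vdim)
        ultimately show ?thesis by (simp add: w_def rep_homD(5)[OF v])
      next
        case 2
        then have "vdim ?J (i + 1) = 0" using i cb by (simp add: interval_vdim supp_window[of c "i + 1" n c b])
        then show ?thesis by (intro mat_eq_if_no_entries) (simp_all add: wd d prerepD(4,5)[OF J])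
      next
        case 3
        have i_eq: "i = c - 1 + n" using 3 by simp
        have "supp n c b (i + 1)" using 3 supp_periodic[of n c b c] supp_self[OF that] by simp
        then have one: "vdim ?J (i + 1) = 1" "w (i + 1) = v (i + 1)" "vdim ?I (i + 1) = 1"
          using sub by (simp_all add: interval_vdim w_def)
        have "\<not> supp n c b i" using i cb 3 by (simp add: supp_window[of c i n c b])
        then have zero: "vdim ?J i = 0" by (simp add: interval_vdim)
        have "w (i + 1) * vmap N i = vmap ?I i * v i" by (simp add: one rep_homD(5)[OF v])
        also have "v i = 0\<^sub>m (vdim ?I i) (vdim N i)"
          unfolding i_eq rep_homD(1)[OF v] prerepD(1)[OF P] prerepD(1)[OF I] by (rule last)
        also have "vmap ?I i * \<dots> = 0\<^sub>m 1 (vdim N i)" by (simp add: d one)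
        also have "\<dots> = vmap ?J i * w i"
          by (intro eq_matI) (auto simp: wd prerepD(4,5)[OF J] one zero scalar_prod_def)
        finally show ?thesis .
      qed
    next
      show "(w (i + n + 1) * vmap N (i + n) = vmap ?J (i + n) * w (i + n)) =
        (w (i + 1) * vmap N i = vmap ?J i * w i)" for i
        by (simp add: wper wper1 prerepD(3)[OF P] prerepD(3)[OF J])
    qed
    then have w: "w \<in> rep_hom n N ?J" using wper wd by (intro rep_homI) auto
    have nz_supp: "supp n c b i \<longrightarrow> nz i" for i
    proof (rule periodic_window[OF n, of "\<lambda>i. supp n c b i \<longrightarrow> nz i" c])
      fix i assume "c \<le> i" "i < c + n"
      then show "supp n c b i \<longrightarrow> nz i" using after cb by (auto simp: supp_window[of c i n c b])
    qed (simp add: supp_periodic nz_def rep_homD(1)[OF v] prerepD(1)[OF P] prerepD(1)[OF I])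
    have "\<exists>G. G \<in> carrier_mat (vdim N i) (vdim ?J i) \<and> w i * G = 1\<^sub>m (vdim ?J i)" for i
    proof (cases "supp n c b i")
      case True
      then have one: "vdim ?J i = 1" "vdim ?I i = 1" "w i = v i" using sub by (simp_all add: interval_vdim w_def)
      moreover have "v i \<noteq> 0\<^sub>m 1 (vdim N i)"
        using nz_supp[of i] True unfolding nz_def one(2) by blast
      ultimately show ?thesis using nonzero_row_right_inverse[of "v i" "vdim N i"] rep_hom_carrier[OF v, of i]
        by auto
    next
      case False
      then have "vdim ?J i = 0" by (simp add: interval_vdim)
      then show ?thesis
        by (intro exI[of _ "0\<^sub>m (vdim N i) 0"]) (auto simp: wd intro!: mat_eq_if_no_entries)
    qed
    then obtain G where "\<And>i. G i \<in> carrier_mat (vdim N i) (vdim ?J i)" "\<And>i. w i * G i = 1\<^sub>m (vdim ?J i)"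
      by metis
    then show ?thesis by (rule is_quotientI[OF interval_rep_is_rep[OF cb] w])
  qed
  then show ?thesis using c before unfolding nz_def by blast
qed


text \<open>A map from E onto M(a,b) sends N onto some M(c,b), and the induced map sends M onto M(a,c).
Closure of D under concatenation of arcs gives \<gamma>(a,b).\<close>

lemma quotient_class_closed_under_extensions:
  assumes D: "affine_arc_torsion_class n D" and M: "M \<in> quotient_class n D" and N: "N \<in> quotient_class n D"
    and ext: "(E, f, g) \<in> extensions n M N"
  shows "E \<in> quotient_class n D"
proof -
  have rM: "rep n M" and rN: "rep n N" using M N unfolding quotient_class_def by auto
  have rE: "rep n E" using extensionsD(1)[OF ext] .
  note P = rep_prerep[OF rE] rep_prerep[OF rM] rep_prerep[OF rN]
  have "arc n a b \<in> D" if ab: "a < b" "b < a + n" and q: "is_quotient n (interval_rep n a b) E" for a b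
  proof -
    let ?I = "interval_rep n a b"
    have n: "0 < n" using ab by simp
    have I: "prerep n ?I" using ab by (intro interval_prerep) auto
    obtain u where u: "u \<in> rep_surj n E ?I" using q unfolding is_quotient_def by blast
    then have uh: "u \<in> rep_hom n E ?I" unfolding rep_surj_def by blast
    have f: "f \<in> rep_hom n N E" using extensionsD(2)[OF ext] by (rule rep_injD)
    obtain c where c: "a \<le> c" "c \<le> b"
      and zero: "\<And>i. a \<le> i \<Longrightarrow> i < c \<Longrightarrow> u i * f i = 0\<^sub>m (vdim ?I i) (vdim N i)"
      and sub: "c < b \<Longrightarrow> is_quotient n (interval_rep n c b) N"
      using image_in_interval[OF ab rN rep_hom_comp[OF f uh P(3,1) I]] by auto
    have arc_cb: "arc n c b \<in> D" if "c < b"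
      using sub[OF that] that N c ab unfolding quotient_class_def by auto
    have arc_ac: "arc n a c \<in> D" if "a < c"
    proof -
      let ?J = "interval_rep n a c"
      have ac: "a \<le> c" "c < a + n" using that c ab by auto
      note J = interval_prerep[OF ac]
      let ?q = "\<lambda>i. ones (vdim ?J i) (vdim ?I i)"
      have q: "?q \<in> rep_hom n ?I ?J" using c ab by (intro interval_canonical_map) auto
      have "?q i * ones (vdim ?I i) (vdim ?J i) = 1\<^sub>m (vdim ?J i)" for i
      proof -
        have "supp n a c i \<Longrightarrow> supp n a b i" using c unfolding supp_def by (meson diff_right_mono order_trans)
        then show ?thesis by (auto simp: interval_vdim ones_mult ones_diag)
      qed
      then have qs: "?q \<in> rep_surj n ?I ?J"
        by (intro rep_surjI[OF q, of "\<lambda>i. ones (vdim ?I i) (vdim ?J i)"]) auto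
      note qu = rep_surj_comp[OF u qs P(1) I J]
      have quh: "(\<lambda>i. ?q i * u i) \<in> rep_hom n E ?J" using qu unfolding rep_surj_def by blast
      have kill: "?q i * u i * f i = 0\<^sub>m (vdim ?J i) (vdim N i)" for i
      proof (rule periodic_window[OF n, of "\<lambda>i. ?q i * u i * f i = 0\<^sub>m (vdim ?J i) (vdim N i)" a])
        fix i assume i: "a \<le> i" "i < a + n"
        show "?q i * u i * f i = 0\<^sub>m (vdim ?J i) (vdim N i)"
        proof (cases "i < c")
          case True
          have "?q i * u i * f i = ?q i * (u i * f i)"
            by (rule mult_assoc_dims) (simp_all add: rep_homD(3,4)[OF uh] rep_homD(3,4)[OF f])
          then show ?thesis by (simp add: zero[OF i(1) True])
        next
          case False
          then have "vdim ?J i = 0" using i ac by (simp add: interval_vdim supp_window[of a i n a c])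
          then show ?thesis by (intro mat_eq_if_no_entries) (simp_all add: rep_homD(3,4)[OF f])
        qed
      qed (simp add: rep_homD(1)[OF uh] rep_homD(1)[OF f] prerepD(1)[OF I] prerepD(1)[OF J] prerepD(1)[OF P(3)])
      obtain h where h: "h \<in> rep_hom n M ?J" and hg: "\<And>i. h i * g i = ?q i * u i"
        using extension_factor[OF ext P(2) J quh kill] by blast
      have gh: "g \<in> rep_hom n E M" using extensionsD(3)[OF ext] unfolding rep_surj_def by blast
      obtain R where R: "\<And>i. dim_row (R i) = vdim E i" "\<And>i. dim_col (R i) = vdim ?J i"
        "\<And>i. ?q i * u i * R i = 1\<^sub>m (vdim ?J i)"
        using rep_surjE[OF qu] by metis
      have "is_quotient n ?J M"
      proof (rule is_quotientI[OF interval_rep_is_rep[OF ac] h, of "\<lambda>i. g i * R i"])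
        fix i
        show "g i * R i \<in> carrier_mat (vdim M i) (vdim ?J i)"
          using rep_homD(3,4)[OF gh] R by (auto intro!: carrier_matI)
        have "h i * (g i * R i) = h i * g i * R i"
          by (rule mult_assoc_dims[symmetric]) (simp_all add: rep_homD(3,4)[OF gh] rep_homD(3,4)[OF h] R)
        then show "h i * (g i * R i) = 1\<^sub>m (vdim ?J i)" by (simp add: hg R)
      qed
      then show ?thesis using that M ac unfolding quotient_class_def by blast
    qed
    show "arc n a b \<in> D"
    proof (cases "c = a \<or> c = b")
      case True
      then show ?thesis using arc_cb arc_ac ab by auto
    next
      case False
      then show ?thesis using arc_cb arc_ac c ab D unfolding affine_arc_torsion_class_def
        by (metis diff_less_eq add.commute order_le_less)
    qed
  qed
  then show ?thesis using rE unfolding quotient_class_def by blast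
qed

lemma zero_in_quotient_class: "0 < n \<Longrightarrow> is_zero M \<Longrightarrow> rep n M \<Longrightarrow> M \<in> quotient_class n D"
proof -
  assume n: "0 < n" and z: "is_zero M" and M: "rep n M"
  have "\<not> is_quotient n (interval_rep n a b) M" if ab: "a < b" for a b
  proof
    assume "is_quotient n (interval_rep n a b) M"
    then obtain f where "f \<in> rep_surj n M (interval_rep n a b)" unfolding is_quotient_def by blast
    then obtain G where f: "f \<in> rep_hom n M (interval_rep n a b)" "\<And>i. dim_row (G i) = vdim M i"
      "\<And>i. dim_col (G i) = vdim (interval_rep n a b) i"
      and fG: "\<And>i. f i * G i = 1\<^sub>m (vdim (interval_rep n a b) i)" by (metis rep_surjE)
    have "f a * G a = 0\<^sub>m 1 1"
      using rep_homD(3,4)[OF f(1)] f(2,3) z supp_self[OF ab, of n]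
      by (intro eq_matI) (auto simp: scalar_prod_def interval_vdim is_zero_def)
    then have "1\<^sub>m 1 = (0\<^sub>m 1 1 :: complex mat)" using fG[of a] supp_self[OF ab] by (simp add: interval_vdim)
    then show False by (simp add: one_mat_eq_zero_iff)
  qed
  then show ?thesis using M unfolding quotient_class_def by blast
qed

lemma quotient_class_torsion:
  assumes n: "0 < n" and D: "affine_arc_torsion_class n D"
  shows "torsion_class n (quotient_class n D)"
  unfolding torsion_class_def
proof (intro conjI ballI allI impI)
  have "prerep n \<lparr>vdim = \<lambda>_. 0, vmap = \<lambda>_. 0\<^sub>m 0 0\<rparr>" by (simp add: prerep_def)
  then have "rep n \<lparr>vdim = \<lambda>_. 0, vmap = \<lambda>_. 0\<^sub>m 0 0\<rparr>"
    using path_map_dims unfolding rep_iff_prerep by (auto intro!: mat_eq_if_no_entries)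
  then have "\<lparr>vdim = \<lambda>_. 0, vmap = \<lambda>_. 0\<^sub>m 0 0\<rparr> \<in> quotient_class n D"
    using zero_in_quotient_class[OF n] by (simp add: is_zero_def)
  then show "quotient_class n D \<noteq> {}" by blast
  show quot: "N \<in> quotient_class n D" if "M \<in> quotient_class n D" "is_quotient n N M" for M N
    using that is_quotient_trans[OF _ that(2)] unfolding quotient_class_def is_quotient_def by blast
  show "N \<in> quotient_class n D" if "M \<in> quotient_class n D" "rep n N \<and> isomorphic n M N" for M N
    using quot[OF that(1)] is_quotient_if_isomorphic that(2) by blast
  show "case X of (E, f, g) \<Rightarrow> E \<in> quotient_class n D"
    if "M \<in> quotient_class n D" "N \<in> quotient_class n D" "X \<in> extensions n M N" for M N X
    using quotient_class_closed_under_extensions[OF D that(1,2)] that(3) by (cases X) auto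
qed (auto simp: quotient_class_def)

definition brick_set :: "int \<Rightarrow> (int \<times> int) set set \<Rightarrow> qrep set" where
  "brick_set n D = {M. rep n M \<and> (\<exists>a b. a < b \<and> b < a + n \<and> arc n a b \<in> D \<and> isomorphic n M (interval_rep n a b))}"

lemma bricks_of_quotient_class:
  assumes n: "0 < n" and D: "affine_arc_torsion_class n D"
  shows "{M \<in> quotient_class n D. brick n M} = brick_set n D"
proof (rule Set.set_eqI, rule iffI)
  fix M assume M: "M \<in> {M \<in> quotient_class n D. brick n M}"
  then obtain a b where ab: "a < b" "b < a + n" "isomorphic n M (interval_rep n a b)"
    using brick_is_interval[OF n] by blast
  then have "is_quotient n (interval_rep n a b) M"
    using interval_rep_is_rep[of a b n] is_quotient_if_isomorphic by simp
  then show "M \<in> brick_set n D" using M ab unfolding brick_set_def quotient_class_def by blast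
next
  fix M assume "M \<in> brick_set n D"
  then obtain a b where M: "rep n M" and ab: "a < b" "b < a + n" "arc n a b \<in> D"
    and iso: "isomorphic n M (interval_rep n a b)" unfolding brick_set_def by blast
  have "interval_rep n a b \<in> quotient_class n D"
    using ab interval_in_quotient_class_iff[OF D] by blast
  then have "M \<in> quotient_class n D"
    using quotient_class_torsion[OF n D] isomorphic_sym[OF iso] M unfolding torsion_class_def by blast
  then show "M \<in> {M \<in> quotient_class n D. brick n M}"
    using brick_if_isomorphic_interval[OF ab(1,2) M iso] by blast
qed

text \<open>One inclusion tests membership on interval quotients, which are bricks. For the other, a
representation is an iterated extension of its interval summands, each of which is a quotient.\<close>

lemma torsion_class_determined_by_bricks:
  assumes n: "0 < n" and D: "affine_arc_torsion_class n D" and T: "torsion_class n T"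
    and bricks: "{M \<in> T. brick n M} = brick_set n D"
  shows "T = quotient_class n D"
proof
  have quot: "N \<in> T" if "M \<in> T" "is_quotient n N M" for M N
    using T that unfolding torsion_class_def by blast
  have ext: "E \<in> T" if "M \<in> T" "N \<in> T" "(E, f, g) \<in> extensions n M N" for E f g M N
    using T that unfolding torsion_class_def by blast
  have repT: "rep n M" if "M \<in> T" for M using T that unfolding torsion_class_def by blast
  show "T \<subseteq> quotient_class n D"
  proof
    fix M assume M: "M \<in> T"
    have "arc n a b \<in> D" if ab: "a < b" "b < a + n" and q: "is_quotient n (interval_rep n a b) M" for a b
    proof -
      have I: "rep n (interval_rep n a b)" using ab by (intro interval_rep_is_rep) auto
      have "brick n (interval_rep n a b)"
        using brick_if_isomorphic_interval[OF ab I isomorphic_refl[OF rep_prerep[OF I]]] .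
      then have "interval_rep n a b \<in> brick_set n D" using quot[OF M q] bricks by blast
      then have "interval_rep n a b \<in> quotient_class n D" using bricks_of_quotient_class[OF n D] by blast
      then show ?thesis using interval_in_quotient_class_iff[OF D ab] by blast
    qed
    then show "M \<in> quotient_class n D" using repT[OF M] unfolding quotient_class_def by blast
  qed
  show "quotient_class n D \<subseteq> T"
  proof
    fix M assume MQ: "M \<in> quotient_class n D"
    then have "rep n M" unfolding quotient_class_def by blast
    with n show "M \<in> T" using MQ
    proof (induction rule: rep_induct)
      case (zero M)
      obtain X where X: "X \<in> T" using T unfolding torsion_class_def by blast
      note P = rep_prerep[OF zero(1)] rep_prerep[OF repT[OF X]]
      have "is_quotient n M X"
      proof (rule is_quotientI[OF zero(1), of "\<lambda>i. 0\<^sub>m 0 (vdim X i)" _ "\<lambda>i. 0\<^sub>m (vdim X i) 0"])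
        show "(\<lambda>i. 0\<^sub>m 0 (vdim X i)) \<in> rep_hom n X M"
          using zero(2) by (intro rep_homI)
            (auto simp: is_zero_def prerepD[OF P(1)] prerepD[OF P(2)] intro!: mat_eq_if_no_entries)
      qed (use zero(2) in \<open>auto simp: is_zero_def intro!: mat_eq_if_no_entries\<close>)
      then show ?case using quot[OF X] by blast
    next
      case (split M a b Q s i2 r p2)
      let ?I = "interval_rep n a b"
      have I: "rep n ?I" using split by (intro interval_rep_is_rep) auto
      have "is_quotient n Q M" "is_quotient n ?I M"
        using biprod_quotients[OF split(5) I split(4)] by auto
      then have "Q \<in> quotient_class n D" and "?I \<in> quotient_class n D"
        using split.prems quotient_class_torsion[OF n D] unfolding torsion_class_def by blast+
      then have "Q \<in> T" using split by blast
      have "brick n ?I"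
        using brick_if_isomorphic_interval[OF split(2,3) I isomorphic_refl[OF rep_prerep[OF I]]] .
      then have "?I \<in> T" using \<open>?I \<in> quotient_class n D\<close> bricks bricks_of_quotient_class[OF n D] by blast
      then show ?case using ext[OF _ \<open>Q \<in> T\<close> biprod_extension[OF biprod_swap[OF split(5)] split(1)]] by blast
    qed
  qed
qed

lemma psi_eq_quotient_class:
  assumes n: "0 < n" and D: "affine_arc_torsion_class n D"
  shows "psi n D = quotient_class n D"
  unfolding psi_def brick_set_def[symmetric]
proof (rule the_equality)
  show "torsion_class n (quotient_class n D) \<and> {M \<in> quotient_class n D. brick n M} = brick_set n D"
    using quotient_class_torsion[OF n D] bricks_of_quotient_class[OF n D] ..
  show "T = quotient_class n D" if "torsion_class n T \<and> {M \<in> T. brick n M} = brick_set n D" for T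
    using that torsion_class_determined_by_bricks[OF n D] by blast
qed


section \<open>Vanishing of extensions\<close>

text \<open>The element 1 - \<sigma> g is killed by g and hence factors through f. The factor \<rho> is unique, which
forces the remaining identities.\<close>

lemma extension_split_pointwise:
  assumes ext: "(E, f, g) \<in> extensions n M N"
    and \<sigma>: "\<And>i. \<sigma> i \<in> carrier_mat (vdim E i) (vdim M i)" "\<And>i. g i * \<sigma> i = 1\<^sub>m (vdim M i)"
  shows "\<exists>\<rho>. \<forall>i. \<rho> i \<in> carrier_mat (vdim N i) (vdim E i) \<and> \<rho> i * f i = 1\<^sub>m (vdim N i) \<and>
    \<rho> i * \<sigma> i = 0\<^sub>m (vdim N i) (vdim M i) \<and> f i * \<rho> i + \<sigma> i * g i = 1\<^sub>m (vdim E i)"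
proof -
  have f: "f \<in> rep_hom n N E" using extensionsD(2)[OF ext] by (rule rep_injD)
  have g: "g \<in> rep_hom n E M" using extensionsD(3)[OF ext] unfolding rep_surj_def by blast
  have \<sigma>d: "dim_row (\<sigma> i) = vdim E i" "dim_col (\<sigma> i) = vdim M i" for i using \<sigma>(1)[of i] by auto
  note d = rep_homD(3,4)[OF f] rep_homD(3,4)[OF g] \<sigma>d
  have "\<exists>\<rho>. \<rho> \<in> carrier_mat (vdim N i) (vdim E i) \<and> \<rho> * f i = 1\<^sub>m (vdim N i) \<and>
    \<rho> * \<sigma> i = 0\<^sub>m (vdim N i) (vdim M i) \<and> f i * \<rho> + \<sigma> i * g i = 1\<^sub>m (vdim E i)" for i
  proof -
    let ?Z = "1\<^sub>m (vdim E i) - \<sigma> i * g i"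
    have "g i * ?Z = g i - g i * \<sigma> i * g i" by (simp add: distrib_dims mult_assoc_dims d)
    also have "\<dots> = 0\<^sub>m (vdim M i) (dim_col ?Z)" by (simp add: \<sigma>(2) d) (auto simp: d intro!: eq_matI)
    finally obtain \<rho> where \<rho>: "\<rho> \<in> carrier_mat (vdim N i) (vdim E i)" "f i * \<rho> = ?Z"
      using extensionsD(5)[OF ext, of ?Z i] by (auto simp: d)
    have \<rho>d: "dim_row \<rho> = vdim N i" "dim_col \<rho> = vdim E i" using \<rho>(1) by auto
    have "\<rho> * f i = 1\<^sub>m (vdim N i)"
    proof (rule rep_injD(2)[OF extensionsD(2)[OF ext]])
      have "f i * (\<rho> * f i) = ?Z * f i" unfolding \<rho>(2)[symmetric] by (simp add: mult_assoc_dims d \<rho>d)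
      also have "\<dots> = f i - \<sigma> i * (g i * f i)" by (simp add: distrib_dims mult_assoc_dims d)
      also have "\<dots> = f i" by (simp add: extensionsD(4)[OF ext] d) (auto simp: d intro!: eq_matI)
      finally show "f i * (\<rho> * f i) = f i * 1\<^sub>m (vdim N i)" by (simp add: d)
    qed (simp_all add: d \<rho>d)
    moreover have "\<rho> * \<sigma> i = 0\<^sub>m (vdim N i) (vdim M i)"
    proof (rule rep_injD(2)[OF extensionsD(2)[OF ext]])
      have "f i * (\<rho> * \<sigma> i) = ?Z * \<sigma> i" unfolding \<rho>(2)[symmetric] by (simp add: mult_assoc_dims d \<rho>d)
      also have "\<dots> = \<sigma> i - \<sigma> i * (g i * \<sigma> i)" by (simp add: distrib_dims mult_assoc_dims d)
      also have "\<dots> = 0\<^sub>m (vdim E i) (vdim M i)" by (simp add: \<sigma>(2) d) (auto simp: d intro!: eq_matI)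
      finally show "f i * (\<rho> * \<sigma> i) = f i * 0\<^sub>m (vdim N i) (vdim M i)" by (simp add: d)
    qed (simp_all add: d \<rho>d)
    moreover have "f i * \<rho> + \<sigma> i * g i = 1\<^sub>m (vdim E i)"
      unfolding \<rho>(2) by (auto simp: d intro!: eq_matI)
    ultimately show ?thesis using \<rho>(1) by blast
  qed
  then show ?thesis by metis
qed

lemma extension_section_biprod:
  assumes ext: "(E, f, g) \<in> extensions n M N" and M: "prerep n M" and N: "prerep n N"
    and \<sigma>: "\<sigma> \<in> rep_hom n M E" "\<And>i. g i * \<sigma> i = 1\<^sub>m (vdim M i)"
  shows "\<exists>\<rho>. biprod n E N M f \<sigma> \<rho> g"
proof -
  have f: "f \<in> rep_hom n N E" using extensionsD(2)[OF ext] by (rule rep_injD)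
  have g: "g \<in> rep_hom n E M" using extensionsD(3)[OF ext] unfolding rep_surj_def by blast
  note E = rep_prerep[OF extensionsD(1)[OF ext]]
  note cancel = rep_injD(2)[OF extensionsD(2)[OF ext]]
  obtain \<rho> where \<rho>: "\<And>i. \<rho> i \<in> carrier_mat (vdim N i) (vdim E i)" "\<And>i. \<rho> i * f i = 1\<^sub>m (vdim N i)"
    "\<And>i. \<rho> i * \<sigma> i = 0\<^sub>m (vdim N i) (vdim M i)" "\<And>i. f i * \<rho> i + \<sigma> i * g i = 1\<^sub>m (vdim E i)"
    using extension_split_pointwise[OF ext rep_hom_carrier[OF \<sigma>(1)] \<sigma>(2)] by metis
  have \<rho>d: "dim_row (\<rho> i) = vdim N i" "dim_col (\<rho> i) = vdim E i" for i using \<rho>(1)[of i] by auto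
  note d = rep_homD(3,4)[OF f] rep_homD(3,4)[OF g] rep_homD(3,4)[OF \<sigma>(1)] \<rho>d
    prerepD(4,5)[OF E] prerepD(4,5)[OF M] prerepD(4,5)[OF N]
  have f\<rho>: "f i * \<rho> i = 1\<^sub>m (vdim E i) - \<sigma> i * g i" for i
  proof -
    have "f i * \<rho> i = (f i * \<rho> i + \<sigma> i * g i) - \<sigma> i * g i" by (auto simp: d intro!: eq_matI)
    then show ?thesis by (simp add: \<rho>(4))
  qed
  have "\<rho> \<in> rep_hom n E N"
  proof (rule rep_homI)
    fix i
    show "\<rho> (i + n) = \<rho> i"
    proof (rule cancel)
      have "f i * \<rho> (i + n) = f (i + n) * \<rho> (i + n)" by (simp only: rep_homD(1)[OF f])
      also have "\<dots> = f i * \<rho> i"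
        unfolding f\<rho> by (simp only: rep_homD(1)[OF \<sigma>(1)] rep_homD(1)[OF g] prerepD(1)[OF E])
      finally show "f i * \<rho> (i + n) = f i * \<rho> i" .
    qed (simp_all add: d prerepD(1)[OF E] prerepD(1)[OF N])
    show "\<rho> (i + 1) * vmap E i = vmap N i * \<rho> i"
    proof (rule cancel)
      have "f (i + 1) * (\<rho> (i + 1) * vmap E i) = (f (i + 1) * \<rho> (i + 1)) * vmap E i"
        by (simp add: mult_assoc_dims d)
      also have "\<dots> = vmap E i - \<sigma> (i + 1) * (g (i + 1) * vmap E i)"
        unfolding f\<rho> by (simp add: distrib_dims mult_assoc_dims d)
      also have "\<sigma> (i + 1) * (g (i + 1) * vmap E i) = \<sigma> (i + 1) * vmap M i * g i"
        unfolding rep_homD(5)[OF g] by (simp add: mult_assoc_dims d)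
      also have "\<dots> = vmap E i * (\<sigma> i * g i)"
        unfolding rep_homD(5)[OF \<sigma>(1)] by (simp add: mult_assoc_dims d)
      also have "vmap E i - \<dots> = vmap E i * (f i * \<rho> i)" unfolding f\<rho> by (simp add: distrib_dims d)
      also have "\<dots> = f (i + 1) * vmap N i * \<rho> i"
        unfolding rep_homD(5)[OF f] by (simp add: mult_assoc_dims d)
      also have "\<dots> = f (i + 1) * (vmap N i * \<rho> i)" by (simp add: mult_assoc_dims d)
      finally show "f (i + 1) * (\<rho> (i + 1) * vmap E i) = f (i + 1) * (vmap N i * \<rho> i)" .
    qed (simp_all add: d)
  qed (rule \<rho>(1))
  then have "biprod n E N M f \<sigma> \<rho> g"
    unfolding biprod_def using f g \<sigma> \<rho> extensionsD(4)[OF ext] by blast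
  then show ?thesis by blast
qed

lemma split_extension_exists:
  assumes n: "0 < n" and M: "rep n M" and N: "rep n N"
  shows "\<exists>E f \<sigma> \<rho> g. biprod n E N M f \<sigma> \<rho> g \<and> (E, f, g) \<in> extensions n M N"
proof -
  note P = rep_prerep[OF N] rep_prerep[OF M]
  obtain i1 i2 p1 p2 where B: "biprod n (direct_sum [N, M]) N M i1 i2 p1 p2"
    using direct_sum_pair_biprod[OF P] by blast
  have "rep n (direct_sum [N, M])" by (rule biprod_rep[OF n B direct_sum_pair_biprod(1)[OF P] N M])
  then show ?thesis using B biprod_extension[OF B] by blast
qed

lemma extension_equiv_iff:
  "((E, f, g), (E', f', g')) \<in> extension_equiv n M N \<longleftrightarrow>
     (E, f, g) \<in> extensions n M N \<and> (E', f', g') \<in> extensions n M N \<and>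
     (\<exists>h \<in> rep_iso n E E'. \<forall>i. h i * f i = f' i \<and> g' i * h i = g i)"
  by (simp add: extension_equiv_def)

text \<open>Two extensions with sections are both biproducts of N and M with the same outer maps, so they are
equivalent. Conversely, an equivalence with the split extension carries over its section.\<close>

lemma Ext1_vanishes_iff:
  assumes n: "0 < n" and M: "rep n M" and N: "rep n N"
  shows "Ext1_vanishes n M N \<longleftrightarrow> (\<forall>E f g. (E, f, g) \<in> extensions n M N \<longrightarrow>
    (\<exists>\<sigma> \<in> rep_hom n M E. \<forall>i. g i * \<sigma> i = 1\<^sub>m (vdim M i)))" (is "_ \<longleftrightarrow> ?S")
proof
  let ?X = "extensions n M N" and ?R = "extension_equiv n M N"
  note P = rep_prerep[OF M] rep_prerep[OF N]
  obtain E0 f0 \<sigma>0 \<rho>0 g0 where B0: "biprod n E0 N M f0 \<sigma>0 \<rho>0 g0" and x0: "(E0, f0, g0) \<in> ?X"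
    using split_extension_exists[OF n M N] by blast
  show ?S if van: "Ext1_vanishes n M N"
  proof (intro allI impI)
    fix E f g assume x: "(E, f, g) \<in> ?X"
    note E = rep_prerep[OF extensionsD(1)[OF x]]
    have f: "f \<in> rep_hom n N E" using extensionsD(2)[OF x] by (rule rep_injD)
    have g: "g \<in> rep_hom n E M" using extensionsD(3)[OF x] unfolding rep_surj_def by blast
    have "(\<lambda>i. 1\<^sub>m (vdim E i)) \<in> rep_iso n E E"
      unfolding rep_iso_def mem_Collect_eq using rep_hom_id[OF E]
      by (intro conjI bexI[OF _ rep_hom_id[OF E]]) simp_all
    moreover have "1\<^sub>m (vdim E i) * f i = f i" "g i * 1\<^sub>m (vdim E i) = g i" for i
      by (simp_all add: rep_homD(3,4)[OF f] rep_homD(3,4)[OF g])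
    ultimately have "((E, f, g), (E, f, g)) \<in> ?R"
      using x unfolding extension_equiv_iff by (intro conjI bexI) simp_all
    moreover have "?R `` {(E, f, g)} = ?R `` {(E0, f0, g0)}"
    proof -
      obtain C where "?X // ?R = {C}" using van unfolding Ext1_vanishes_def Ext1_def is_singleton_def by blast
      moreover have "?R `` {(E, f, g)} \<in> ?X // ?R" "?R `` {(E0, f0, g0)} \<in> ?X // ?R"
        using x x0 by (auto intro: quotientI)
      ultimately show ?thesis by (metis singletonD)
    qed
    ultimately have "((E0, f0, g0), (E, f, g)) \<in> ?R" by blast
    then obtain h where h: "h \<in> rep_iso n E0 E" "\<And>i. g i * h i = g0 i" unfolding extension_equiv_iff by blast
    have hh: "h \<in> rep_hom n E0 E" using h(1) unfolding rep_iso_def by blast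
    have s: "\<sigma>0 \<in> rep_hom n M E0" by (rule biprodD(2)[OF B0])
    have E0: "prerep n E0" using rep_prerep[OF extensionsD(1)[OF x0]] .
    show "\<exists>\<sigma> \<in> rep_hom n M E. \<forall>i. g i * \<sigma> i = 1\<^sub>m (vdim M i)"
    proof (rule bexI[OF _ rep_hom_comp[OF s hh P(1) E0 E]], rule allI)
      fix i
      have "g i * (h i * \<sigma>0 i) = g i * h i * \<sigma>0 i"
        by (rule mult_assoc_dims[symmetric]) (simp_all add: rep_homD(3,4)[OF g] rep_homD(3,4)[OF hh] rep_homD(3,4)[OF s])
      then show "g i * (h i * \<sigma>0 i) = 1\<^sub>m (vdim M i)" by (simp add: h(2) biprodD(6)[OF B0])
    qed
  qed
  show "Ext1_vanishes n M N" if S: ?S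
  proof -
    have "(x, y) \<in> ?R" if x: "x \<in> ?X" and y: "y \<in> ?X" for x y
    proof -
      obtain E f g where xe: "x = (E, f, g)" by (cases x)
      obtain E' f' g' where ye: "y = (E', f', g')" by (cases y)
      have x': "(E, f, g) \<in> ?X" and y': "(E', f', g') \<in> ?X" using x y xe ye by auto
      obtain \<sigma> where "\<sigma> \<in> rep_hom n M E" "\<And>i. g i * \<sigma> i = 1\<^sub>m (vdim M i)" using S x' by blast
      then obtain \<rho> where B: "biprod n E N M f \<sigma> \<rho> g" using extension_section_biprod[OF x' P] by blast
      obtain \<sigma>' where "\<sigma>' \<in> rep_hom n M E'" "\<And>i. g' i * \<sigma>' i = 1\<^sub>m (vdim M i)" using S y' by blast
      then obtain \<rho>' where B': "biprod n E' N M f' \<sigma>' \<rho>' g'" using extension_section_biprod[OF y' P] by blast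
      have "prerep n E" "prerep n E'" using extensionsD(1)[OF x'] extensionsD(1)[OF y'] rep_prerep by auto
      then have "\<exists>h \<in> rep_iso n E E'. \<forall>i. h i * f i = f' i \<and> g' i * h i = g i"
        using biprod_comparison[OF B B' _ _ P(2,1)] by blast
      then show ?thesis using x' y' unfolding xe ye extension_equiv_iff by blast
    qed
    moreover have "?R \<subseteq> ?X \<times> ?X" unfolding extension_equiv_def by auto
    ultimately have "?R = ?X \<times> ?X" by auto
    then have "?X // ?R = {?X}" using x0 unfolding quotient_def by auto
    then show ?thesis unfolding Ext1_vanishes_def Ext1_def is_singleton_def by blast
  qed
qed

lemma Ext1_vanishes_isomorphic:
  assumes n: "0 < n" and M: "rep n M" and M': "rep n M'" and N: "rep n N"
    and iso: "isomorphic n M M'" and van: "Ext1_vanishes n M N"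
  shows "Ext1_vanishes n M' N"
  unfolding Ext1_vanishes_iff[OF n M' N]
proof (intro allI impI)
  fix E f g assume ext: "(E, f, g) \<in> extensions n M' N"
  note P = rep_prerep[OF M] rep_prerep[OF M'] rep_prerep[OF extensionsD(1)[OF ext]]
  have f: "f \<in> rep_hom n N E" using extensionsD(2)[OF ext] by (rule rep_injD)
  obtain G where g: "g \<in> rep_hom n E M'" and G: "\<And>i. dim_row (G i) = vdim E i"
    "\<And>i. dim_col (G i) = vdim M' i" "\<And>i. g i * G i = 1\<^sub>m (vdim M' i)"
    using rep_surjE[OF extensionsD(3)[OF ext]] by metis
  have "G i \<in> carrier_mat (vdim E i) (vdim M' i)" for i using G by (auto intro: carrier_matI)
  then obtain \<rho> where \<rho>: "\<And>i. \<rho> i \<in> carrier_mat (vdim N i) (vdim E i)"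
    "\<And>i. \<rho> i * f i = 1\<^sub>m (vdim N i)" "\<And>i. f i * \<rho> i + G i * g i = 1\<^sub>m (vdim E i)"
    using extension_split_pointwise[OF ext _ G(3)] by metis
  obtain u v where u: "u \<in> rep_hom n M M'" and v: "v \<in> rep_hom n M' M"
    and vu: "\<And>i. v i * u i = 1\<^sub>m (vdim M i)" and uv: "\<And>i. u i * v i = 1\<^sub>m (vdim M' i)"
    using iso unfolding isomorphic_iff by blast
  note d = rep_homD(3,4)[OF f] rep_homD(3,4)[OF g] rep_homD(3,4)[OF u] rep_homD(3,4)[OF v] G(1,2)
  have "(E, f, \<lambda>i. v i * g i) \<in> extensions n M N"
  proof (rule extensionsI[OF extensionsD(1)[OF ext] f rep_hom_comp[OF g v P(3,2,1)] \<rho>(1,2), of "\<lambda>i. G i * u i"])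
    fix i
    show "G i * u i \<in> carrier_mat (vdim E i) (vdim M i)" by (auto simp: d)
    have "v i * g i * (G i * u i) = v i * (g i * G i * u i)" by (simp add: mult_assoc_dims d)
    then show "v i * g i * (G i * u i) = 1\<^sub>m (vdim M i)" by (simp add: G(3) vu d)
    have "v i * g i * f i = v i * (g i * f i)" by (simp add: mult_assoc_dims d)
    then show "v i * g i * f i = 0\<^sub>m (vdim M i) (vdim N i)" by (simp add: extensionsD(4)[OF ext] d)
    have "G i * u i * (v i * g i) = G i * (u i * v i * g i)" by (simp add: mult_assoc_dims d)
    then show "f i * \<rho> i + G i * u i * (v i * g i) = 1\<^sub>m (vdim E i)" by (simp add: uv d \<rho>(3))
  qed
  then obtain \<sigma> where \<sigma>: "\<sigma> \<in> rep_hom n M E" "\<And>i. v i * g i * \<sigma> i = 1\<^sub>m (vdim M i)"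
    using van unfolding Ext1_vanishes_iff[OF n M N] by blast
  show "\<exists>\<sigma> \<in> rep_hom n M' E. \<forall>i. g i * \<sigma> i = 1\<^sub>m (vdim M' i)"
  proof (rule bexI[OF _ rep_hom_comp[OF v \<sigma>(1) P(2,1,3)]], rule allI)
    fix i
    have "g i * (\<sigma> i * v i) = u i * v i * (g i * (\<sigma> i * v i))"
      by (simp add: uv d rep_homD(3,4)[OF \<sigma>(1)])
    also have "\<dots> = u i * (v i * g i * \<sigma> i * v i)"
      by (simp add: mult_assoc_dims d rep_homD(3,4)[OF \<sigma>(1)])
    finally show "g i * (\<sigma> i * v i) = 1\<^sub>m (vdim M' i)" by (simp add: \<sigma>(2) uv d)
  qed
qed

text \<open>The maps from M(b',c) to M(a,c) and to its quotient M(b',b) and the maps from these to M(a,b) form a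
square that is both a pullback and a pushout. It yields an exact sequence whose middle term is the
sum of M(a,c) and M(b',b). The sequence does not split: a section would lift the generator of
M(a,b) to an element with nonzero component in M(a,c), and that component survives the path from a
to b, which is zero on M(a,b).\<close>

lemma crossing_intervals_extension:
  assumes h: "a < b'" "b' \<le> b" "b < c" "c < a + n"
  shows "\<not> Ext1_vanishes n (interval_rep n a b) (interval_rep n b' c)"
proof
  let ?X = "interval_rep n a b" and ?N = "interval_rep n b' c"
  let ?A = "interval_rep n a c" and ?B = "interval_rep n b' b"
  have n: "0 < n" using h by simp
  have r: "rep n ?X" "rep n ?N" "rep n ?A" "rep n ?B" using h by (auto intro!: interval_rep_is_rep)
  note P = r[THEN rep_prerep]
  let ?E = "direct_sum [?A, ?B]"
  obtain i1 i2 p1 p2 where B: "biprod n ?E ?A ?B i1 i2 p1 p2"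
    using direct_sum_pair_biprod[OF P(3,4)] by blast
  note E = direct_sum_pair_biprod(1)[OF P(3,4)]
  have rE: "rep n ?E" by (rule biprod_rep[OF n B E r(3,4)])
  define nA where "nA i = ones (vdim ?A i) (vdim ?N i)" for i
  define nB where "nB i = ones (vdim ?B i) (vdim ?N i)" for i
  define aX where "aX i = ones (vdim ?X i) (vdim ?A i)" for i
  define bX where "bX i = ones (vdim ?X i) (vdim ?B i)" for i
  have nA: "nA \<in> rep_hom n ?N ?A" unfolding nA_def using h by (intro interval_canonical_map) auto
  have nB: "nB \<in> rep_hom n ?N ?B" unfolding nB_def using h by (intro interval_canonical_map) auto
  have aX: "aX \<in> rep_hom n ?A ?X" unfolding aX_def using h by (intro interval_canonical_map) auto
  have bX: "bX \<in> rep_hom n ?B ?X" unfolding bX_def using h by (intro interval_canonical_map) auto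
  note b = biprodD(1-4)[OF B]
  define f where "f i = i1 i * nA i + i2 i * nB i" for i
  define g where "g i = aX i * p1 i - bX i * p2 i" for i
  have f: "f \<in> rep_hom n ?N ?E" unfolding f_def
    by (rule rep_hom_add[OF rep_hom_comp[OF nA b(1) P(2,3) E] rep_hom_comp[OF nB b(2) P(2,4) E] P(2) E])
  have g: "g \<in> rep_hom n ?E ?X" unfolding g_def
    by (rule rep_hom_diff[OF rep_hom_comp[OF b(3) aX E P(3,1)] rep_hom_comp[OF b(4) bX E P(4,1)] E P(1)])
  note d = b[THEN rep_homD(3)] b[THEN rep_homD(4)] rep_homD(3,4)[OF nA] rep_homD(3,4)[OF nB]
    rep_homD(3,4)[OF aX] rep_homD(3,4)[OF bX]
  let ?dims = "\<lambda>i. (vdim ?N i, vdim ?A i, vdim ?B i, vdim ?X i)"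
  have dims: "?dims i \<in> {(0,1,0,1), (1,1,1,1), (1,1,0,0), (0,0,0,0)}" for i
  proof (rule periodic_window[OF n, of "\<lambda>i. ?dims i \<in> {(0,1,0,1), (1,1,1,1), (1,1,0,0), (0,0,0,0)}" a])
    fix i assume "a \<le> i" "i < a + n"
    then show "?dims i \<in> {(0,1,0,1), (1,1,1,1), (1,1,0,0), (0,0,0,0)}"
      using h by (auto simp: interval_vdim supp_window[of a i n])
  qed (simp add: prerepD(1)[OF P(1)] prerepD(1)[OF P(2)] prerepD(1)[OF P(3)] prerepD(1)[OF P(4)])
  \<comment> \<open>Where all four spaces are nonzero, f is the diagonal and g the difference, which \<rho> = p2 and
    \<sigma> = i1 split. At the other vertices one of the outer terms is zero.\<close>
  define \<rho> where "\<rho> i = (if vdim ?B i = 1 then ones (vdim ?N i) (vdim ?B i) * p2 i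
    else ones (vdim ?N i) (vdim ?A i) * p1 i)" for i
  define \<sigma> where "\<sigma> i = i1 i * ones (vdim ?A i) (vdim ?X i)" for i
  have one: "ones 1 1 = 1\<^sub>m 1" by (simp add: ones_diag)
  have bd: "p1 i * (i1 i * Z) = Z" "p2 i * (i1 i * Z) = 0\<^sub>m (vdim ?B i) (dim_col Z)" if "dim_row Z = vdim ?A i" for Z i
    using that biprodD(5,8)[OF B, of i] by (simp_all add: mult_assoc_dims[symmetric] d)
  have bd': "p1 i * (i2 i * Z) = 0\<^sub>m (vdim ?A i) (dim_col Z)" "p2 i * (i2 i * Z) = Z" if "dim_row Z = vdim ?B i" for Z i
    using that biprodD(6,7)[OF B, of i] by (simp_all add: mult_assoc_dims[symmetric] d)
  have gf: "g i * f i = 0\<^sub>m (vdim ?X i) (vdim ?N i)" for i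
  proof -
    have "g i * f i = aX i * nA i - bX i * nB i"
      by (simp add: f_def g_def distrib_dims mult_assoc_dims d bd bd') (auto simp: d intro!: eq_matI)
    then show ?thesis using dims[of i]
      by (auto simp: aX_def bX_def nA_def nB_def ones_mult intro!: eq_matI)
  qed
  have g\<sigma>: "g i * \<sigma> i = 1\<^sub>m (vdim ?X i)" for i
  proof -
    have "g i * \<sigma> i = aX i * ones (vdim ?A i) (vdim ?X i)"
      by (simp add: \<sigma>_def g_def distrib_dims mult_assoc_dims d bd) (auto simp: d intro!: eq_matI)
    then show ?thesis using dims[of i] by (auto simp: aX_def ones_mult ones_diag)
  qed
  have \<rho>f: "\<rho> i * f i = 1\<^sub>m (vdim ?N i)" for i
  proof -
    have "ones (vdim ?N i) (vdim ?B i) * p2 i * f i = ones (vdim ?N i) (vdim ?B i) * nB i"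
      "ones (vdim ?N i) (vdim ?A i) * p1 i * f i = ones (vdim ?N i) (vdim ?A i) * nA i"
      by (simp_all add: f_def distrib_dims mult_assoc_dims d bd bd' add_zero_dims)
    then show ?thesis using dims[of i] by (auto simp: \<rho>_def nA_def nB_def ones_mult ones_diag)
  qed
  have sum: "f i * \<rho> i + \<sigma> i * g i = 1\<^sub>m (vdim ?E i)" for i
  proof -
    note total = biprodD(9)[OF B, of i]
    consider (1) "vdim ?N i = 0" "vdim ?A i = 1" "vdim ?B i = 0" "vdim ?X i = 1"
      | (2) "vdim ?N i = 1" "vdim ?A i = 1" "vdim ?B i = 1" "vdim ?X i = 1"
      | (3) "vdim ?N i = 1" "vdim ?A i = 1" "vdim ?B i = 0" "vdim ?X i = 0"
      | (4) "vdim ?N i = 0" "vdim ?A i = 0" "vdim ?B i = 0" "vdim ?X i = 0"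
      using dims[of i] by auto
    then show ?thesis
    proof cases
      case 1
      have "i2 i * p2 i = 0\<^sub>m (vdim ?E i) (vdim ?E i)" using 1 by (simp add: mult_inner_zero d)
      moreover have "f i * \<rho> i = 0\<^sub>m (vdim ?E i) (vdim ?E i)"
        using 1 by (simp add: mult_inner_zero d f_def \<rho>_def)
      moreover have "\<sigma> i * g i = i1 i * p1 i"
      proof -
        have "bX i * p2 i = 0\<^sub>m 1 (vdim ?E i)" using 1 by (simp add: mult_inner_zero d)
        moreover have "p1 i - 0\<^sub>m 1 (vdim ?E i) = p1 i" using 1 by (auto simp: d intro!: eq_matI)
        ultimately show ?thesis using 1 by (simp add: \<sigma>_def g_def aX_def one[unfolded One_nat_def] d)
      qed
      ultimately show ?thesis using total by (simp add: add_zero_dims d)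
    next
      case 2
      then have e: "f i = i1 i + i2 i" "g i = p1 i - p2 i" "\<rho> i = p2 i" "\<sigma> i = i1 i"
        by (simp_all add: f_def g_def \<rho>_def \<sigma>_def nA_def nB_def aX_def bX_def one[unfolded One_nat_def] d)
      have "f i * \<rho> i + \<sigma> i * g i = i1 i * p2 i + i2 i * p2 i + (i1 i * p1 i - i1 i * p2 i)"
        unfolding e using 2 by (simp add: distrib_dims d)
      also have "\<dots> = i1 i * p1 i + i2 i * p2 i"
        using 2 by (intro eq_matI) (simp_all add: d)
      finally show ?thesis using total by simp
    next
      case 3
      have "i2 i * p2 i = 0\<^sub>m (vdim ?E i) (vdim ?E i)" using 3 by (simp add: mult_inner_zero d)
      moreover have "\<sigma> i * g i = 0\<^sub>m (vdim ?E i) (vdim ?E i)"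
        using 3 by (simp add: mult_inner_zero d \<sigma>_def g_def)
      moreover have "f i * \<rho> i = i1 i * p1 i"
      proof -
        have "i2 i * nB i = 0\<^sub>m (vdim ?E i) 1" using 3 by (simp add: mult_inner_zero d)
        then show ?thesis using 3
          by (simp add: f_def \<rho>_def nA_def one[unfolded One_nat_def] d add_zero_dims)
      qed
      ultimately show ?thesis using total by (simp add: add_zero_dims d)
    next
      case 4
      then have zero: "i1 i * p1 i = 0\<^sub>m (vdim ?E i) (vdim ?E i)" "i2 i * p2 i = 0\<^sub>m (vdim ?E i) (vdim ?E i)"
        "f i * \<rho> i = 0\<^sub>m (vdim ?E i) (vdim ?E i)" "\<sigma> i * g i = 0\<^sub>m (vdim ?E i) (vdim ?E i)"
        by (simp_all add: mult_inner_zero d f_def g_def \<rho>_def \<sigma>_def)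
      show ?thesis using total unfolding zero .
    qed
  qed
  have ext: "(?E, f, g) \<in> extensions n ?X ?N"
  proof (rule extensionsI[OF rE f g _ \<rho>f _ g\<sigma> gf sum])
    show "\<rho> i \<in> carrier_mat (vdim ?N i) (vdim ?E i)" "\<sigma> i \<in> carrier_mat (vdim ?E i) (vdim ?X i)" for i
      by (auto simp: \<rho>_def \<sigma>_def d intro!: carrier_matI)
  qed
  assume "Ext1_vanishes n ?X ?N"
  then obtain s where s: "s \<in> rep_hom n ?X ?E" "\<And>i. g i * s i = 1\<^sub>m (vdim ?X i)"
    using ext unfolding Ext1_vanishes_iff[OF n r(1,2)] by blast
  note ds = rep_homD(3,4)[OF s(1)]
  define t where "t i = p1 i * s i" for i
  have t: "t \<in> rep_hom n ?X ?A" unfolding t_def by (rule rep_hom_comp[OF s(1) b(3) P(1) E P(3)])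
  \<comment> \<open>The lift of the generator of M(a,b) survives the path from a to b in M(a,c), but not in M(a,b).\<close>
  have xa: "vdim ?X a = 1" "vdim ?A a = 1" "vdim ?B a = 0" "vdim ?X b = 0"
    using h not_supp_end[of a b n] by (simp_all add: interval_vdim supp_window[of a _ n])
  define k where "k = nat (b - a)"
  have k: "a + int k = b" using h by (simp add: k_def)
  have "t a = path_map ?A a k * t a"
    using interval_path[of a a k c n] h k xa by (simp add: rep_homD(3,4)[OF t])
  also have "\<dots> = t b * path_map ?X a k" using rep_hom_path[OF t P(1,3), of a k] k by simp
  also have "\<dots> = 0\<^sub>m (vdim ?A b) (vdim ?X a)"
    using xa k path_map_dims[OF P(1), of a k] rep_homD(3,4)[OF t, of b] by (simp add: mult_inner_zero)
  finally have ta: "t a = 0\<^sub>m 1 1" using xa h rep_homD(3,4)[OF t, of a]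
    by (metis index_zero_mat(2))
  have "1\<^sub>m 1 = g a * s a" using s(2)[of a] xa by simp
  also have "\<dots> = aX a * t a - bX a * (p2 a * s a)"
    by (simp add: g_def t_def distrib_dims mult_assoc_dims d ds)
  also have "bX a * (p2 a * s a) = 0\<^sub>m 1 1" using xa by (simp add: mult_inner_zero d ds)
  also have "aX a * t a - 0\<^sub>m 1 1 = 0\<^sub>m 1 1" unfolding ta using xa by (simp add: d)
  finally have "1\<^sub>m 1 = (0\<^sub>m 1 1 :: complex mat)" .
  then show False by (simp add: one_mat_eq_zero_iff)
qed

text \<open>Decompose N into intervals. A component of z in M(c,d) is nonzero only if c \<le> b < d up to translation,
and since the path of length a + n - 1 - b kills it, d < a + n. As \<gamma>(c,d) belongs to D, it does not
cross M(a,b), so c \<le> a and the component is hit from the vertex a.\<close>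

lemma generator_correction:
  assumes D: "affine_arc_torsion_class n D" and ab: "a < b" "b < a + n"
    and nc: "\<And>b' c. a < b' \<Longrightarrow> b' \<le> b \<Longrightarrow> b < c \<Longrightarrow> c < a + n \<Longrightarrow> arc n b' c \<notin> D"
    and N: "rep n N" "N \<in> quotient_class n D"
    and z: "z \<in> carrier_mat (vdim N b) 1"
      "path_map N b (nat (a + n - 1 - b)) * z = 0\<^sub>m (vdim N (a + n - 1)) 1"
  shows "\<exists>w \<in> carrier_mat (vdim N a) 1. path_map N a (nat (b - a)) * w = z"
proof -
  define k where "k = nat (a + n - 1 - b)"
  define l where "l = nat (b - a)"
  have k: "b + int k = a + n - 1" and l: "a + int l = b" using ab by (auto simp: k_def l_def)
  have n: "0 < n" using ab by simp
  have "\<exists>w \<in> carrier_mat (vdim N a) 1. path_map N a l * w = z"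
    if "path_map N b k * z = 0\<^sub>m (vdim N (b + int k)) 1" "z \<in> carrier_mat (vdim N b) 1"
    using n N(1) N(2) that
  proof (induction arbitrary: z rule: rep_induct)
    case (zero N)
    then have "path_map N a l * 0\<^sub>m (vdim N a) 1 = z"
      using path_map_dims[OF rep_prerep[OF zero(1)], of a l] zero.prems l
      by (intro mat_eq_if_no_entries) (auto simp: is_zero_def)
    then show ?case by (intro bexI[of _ "0\<^sub>m (vdim N a) 1"]) auto
  next
    case (split N c d Q s i2 r p2)
    let ?I = "interval_rep n c d"
    note B = biprodD[OF split(5)]
    have I: "rep n ?I" using split by (intro interval_rep_is_rep) auto
    note P = rep_prerep[OF split(1)] rep_prerep[OF I] rep_prerep[OF split(4)]
    note dims = B(1-4)[THEN rep_homD(3)] B(1-4)[THEN rep_homD(4)]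
      P[THEN path_map_dims(1)] P[THEN path_map_dims(2)]
    have z: "dim_row z = vdim N b" "dim_col z = 1" using split.prems by auto
    have quot: "is_quotient n Q N" "is_quotient n ?I N"
      using biprod_quotients[OF split(5) I split(4)] by auto
    then have "Q \<in> quotient_class n D"
      using split.prems quotient_class_torsion[OF n D] unfolding torsion_class_def by blast
    have cdD: "arc n c d \<in> D" using split.prems(1) quot(2) split(2,3) unfolding quotient_class_def by blast
    have killed: "path_map W b k * (p b * z) = 0\<^sub>m (vdim W (b + int k)) 1"
      if p: "p \<in> rep_hom n N W" and W: "prerep n W" for p W
    proof -
      have "path_map W b k * (p b * z) = path_map W b k * p b * z"
        by (rule mult_assoc_dims[symmetric]) (simp_all add: path_map_dims[OF W] rep_homD(3,4)[OF p] z)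
      also have "\<dots> = p (b + int k) * (path_map N b k * z)"
        unfolding rep_hom_path[OF p P(1) W, symmetric]
        by (rule mult_assoc_dims) (simp_all add: dims rep_homD(3,4)[OF p] z)
      finally show ?thesis using split.prems(2) by (simp add: rep_homD(3,4)[OF p])
    qed
    obtain w2 where w2: "w2 \<in> carrier_mat (vdim Q a) 1" "path_map Q a l * w2 = p2 b * z"
    proof -
      have "p2 b * z \<in> carrier_mat (vdim Q b) 1" using z by (auto simp: dims intro!: carrier_matI)
      from split.IH[OF \<open>Q \<in> quotient_class n D\<close> killed[OF B(4) P(3)] this] show thesis
        using that by blast
    qed
    obtain w1 where w1: "w1 \<in> carrier_mat (vdim ?I a) 1" "path_map ?I a l * w1 = r b * z"
    proof (cases "r b * z = 0\<^sub>m (vdim ?I b) 1")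
      case True
      then show thesis using l by (intro that[of "0\<^sub>m (vdim ?I a) 1"]) (simp_all add: dims)
    next
      case False
      have "supp n c d b"
      proof (rule ccontr)
        assume "\<not> supp n c d b"
        then have "vdim ?I b = 0" by (simp add: interval_vdim)
        then have "r b * z = 0\<^sub>m (vdim ?I b) 1" using z by (intro mat_eq_if_no_entries) (simp_all add: dims)
        then show False using False by blast
      qed
      then obtain j where j: "c \<le> b + j * n" "b + j * n \<le> d - 1" unfolding supp_def by blast
      define c' where "c' = c + (- j) * n"
      define d' where "d' = d + (- j) * n"
      have cd': "c' \<le> b" "b < d'" "d' < c' + n" using j split(3) by (auto simp: c'_def d'_def)
      have I': "?I = interval_rep n c' d'" unfolding c'_def d'_def by (rule interval_translate[symmetric])
      have "arc n c' d' \<in> D" using cdD unfolding c'_def d'_def arc_translate .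
      have one: "vdim ?I b = 1" using \<open>supp n c d b\<close> by (simp add: interval_vdim)
      have "d' < a + n"
      proof (rule ccontr)
        assume "\<not> d' < a + n"
        then have "path_map ?I b k = 1\<^sub>m 1" unfolding I' using cd' k by (intro interval_path) auto
        then have "r b * z = 0\<^sub>m (vdim ?I (b + int k)) 1" using killed[OF B(3) P(2)] one by (simp add: dims)
        moreover from this have "dim_row (r b * z) = vdim ?I (b + int k)"
          by (simp only: index_zero_mat)
        moreover have "dim_row (r b * z) = vdim ?I b" by (simp add: dims)
        ultimately show False using False by simp
      qed
      then have "c' \<le> a" using nc[of c' d'] cd' \<open>arc n c' d' \<in> D\<close> by force
      then have p1: "path_map ?I a l = 1\<^sub>m 1" unfolding I' using cd' l by (intro interval_path) auto
      have "vdim ?I a = 1" using arg_cong[OF p1, of dim_col] by (simp add: dims)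
      then show thesis
        using p1 one z by (intro that[of "r b * z"]) (auto simp: dims intro!: carrier_matI)
    qed
    have wd: "dim_row w1 = vdim ?I a" "dim_col w1 = 1" "dim_row w2 = vdim Q a" "dim_col w2 = 1"
      using w1 w2 by auto
    have push: "path_map N a l * (i a * w) = i b * (path_map W a l * w)"
      if i: "i \<in> rep_hom n W N" and W: "prerep n W" and w: "dim_row w = vdim W a" for i W w
    proof -
      have "path_map N a l * (i a * w) = path_map N a l * i a * w"
        by (rule mult_assoc_dims[symmetric]) (simp_all add: dims rep_homD(3,4)[OF i] w)
      also have "\<dots> = i b * (path_map W a l * w)"
        using rep_hom_path[OF i W P(1), of a l] unfolding l
        by (simp add: mult_assoc_dims[symmetric] path_map_dims[OF W] rep_homD(3,4)[OF i] w l)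
      finally show ?thesis .
    qed
    have "path_map N a l * (s a * w1 + i2 a * w2) = s b * (r b * z) + i2 b * (p2 b * z)"
      by (simp add: distrib_dims dims wd push[OF B(1) P(2)] push[OF B(2) P(3)] w1(2) w2(2))
    also have "\<dots> = (s b * r b + i2 b * p2 b) * z"
      by (simp add: distrib_dims mult_assoc_dims dims z)
    also have "\<dots> = z" by (simp add: B(9) z)
    finally show ?case
      by (intro bexI[of _ "s a * w1 + i2 a * w2"]) (auto simp: dims wd intro!: carrier_matI)
  qed
  then show ?thesis using z k unfolding k_def[symmetric] l_def[symmetric] by simp
qed

text \<open>Lift the generator of M(a,b) to E. The path to b sends the lift into N, and correcting it by an element
of N at the vertex a makes the path vanish, so that the corrected lift defines a section.\<close>

lemma noncrossing_interval_projective: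
  assumes D: "affine_arc_torsion_class n D" and ab: "a < b" "b < a + n"
    and nc: "\<And>b' c. a < b' \<Longrightarrow> b' \<le> b \<Longrightarrow> b < c \<Longrightarrow> c < a + n \<Longrightarrow> arc n b' c \<notin> D"
    and N: "N \<in> quotient_class n D"
  shows "Ext1_vanishes n (interval_rep n a b) N"
proof -
  let ?I = "interval_rep n a b"
  have n: "0 < n" using ab by simp
  have I: "rep n ?I" using ab by (intro interval_rep_is_rep) auto
  have rN: "rep n N" using N unfolding quotient_class_def by blast
  show ?thesis unfolding Ext1_vanishes_iff[OF n I rN]
  proof (intro allI impI)
    fix E f g assume ext: "(E, f, g) \<in> extensions n ?I N"
    have rE: "rep n E" using extensionsD(1)[OF ext] .
    note P = rep_prerep[OF I] rep_prerep[OF rN] rep_prerep[OF rE]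
    note cancel = rep_injD(2)[OF extensionsD(2)[OF ext]]
    have f: "f \<in> rep_hom n N E" using extensionsD(2)[OF ext] by (rule rep_injD)
    obtain G where g: "g \<in> rep_hom n E ?I" and G: "\<And>i. dim_row (G i) = vdim E i"
      "\<And>i. dim_col (G i) = vdim ?I i" "\<And>i. g i * G i = 1\<^sub>m (vdim ?I i)"
      using rep_surjE[OF extensionsD(3)[OF ext]] by metis
    have one: "vdim ?I a = 1" "vdim ?I b = 0"
      using supp_self[OF ab(1)] not_supp_end[of a b n] ab by (simp_all add: interval_vdim)
    define k where "k = nat (a + n - 1 - b)"
    define l where "l = nat (b - a)"
    have k: "b + int k = a + n - 1" and l: "a + int l = b" using ab by (auto simp: k_def l_def)
    let ?x = "G a"
    let ?y = "path_map E a l * ?x"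
    note d = rep_homD(3,4)[OF f] rep_homD(3,4)[OF g] G(1,2) path_map_dims[OF P(1)]
      path_map_dims[OF P(2)] path_map_dims[OF P(3)]
    have "g b * ?y = 0\<^sub>m (vdim ?I b) (dim_col ?y)"
      by (rule mat_eq_if_no_entries) (simp_all add: d one)
    then obtain z where z: "z \<in> carrier_mat (vdim N b) 1" "f b * z = ?y"
      using extensionsD(5)[OF ext, of ?y b] by (auto simp: d one l)
    have zd: "dim_row z = vdim N b" "dim_col z = 1" using z(1) by auto
    have "path_map N b k * z = 0\<^sub>m (vdim N (b + int k)) 1"
    proof (rule cancel)
      have "f (b + int k) * (path_map N b k * z) = f (b + int k) * path_map N b k * z"
        by (simp add: mult_assoc_dims d zd)
      also have "\<dots> = path_map E b k * (f b * z)"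
        unfolding rep_hom_path[OF f P(2,3)] by (simp add: mult_assoc_dims d zd)
      also have "\<dots> = path_map E b k * path_map E a l * ?x"
        unfolding z(2) using l by (simp add: mult_assoc_dims d)
      also have "path_map E b k * path_map E a l = path_map E a (l + k)"
        using path_map_add[OF P(3), of a l k] l by simp
      also have "\<dots> = 0\<^sub>m (vdim E (a + int (l + k))) (vdim E a)"
        using k l by (intro rep_long_path[OF rE n]) simp
      also have "\<dots> * ?x = 0\<^sub>m (vdim E (b + int k)) 1"
        using l by (simp add: d one) (simp add: add.assoc[symmetric])
      finally show "f (b + int k) * (path_map N b k * z) = f (b + int k) * 0\<^sub>m (vdim N (b + int k)) 1"
        by (simp add: d)
    qed (simp_all add: d zd)
    then obtain w where w: "w \<in> carrier_mat (vdim N a) 1" "path_map N a l * w = z"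
      using generator_correction[OF D ab nc rN N z(1)] unfolding k_def[symmetric] l_def[symmetric] k by blast
    have wd: "dim_row w = vdim N a" "dim_col w = 1" using w(1) by auto
    \<comment> \<open>The correction changes the image under the path by exactly f z.\<close>
    let ?x' = "?x - f a * w"
    have x': "?x' \<in> carrier_mat (vdim E a) 1" by (auto simp: d wd intro!: carrier_matI)
    have "path_map E a l * ?x' = ?y - path_map E a l * f a * w"
      by (simp add: distrib_dims mult_assoc_dims d wd one)
    also have "path_map E a l * f a * w = f b * (path_map N a l * w)"
      using rep_hom_path[OF f P(2,3), of a l] unfolding l
      by (simp add: mult_assoc_dims[symmetric] d wd l)
    also have "\<dots> = ?y" unfolding w(2) z(2) ..
    also have "?y - ?y = 0\<^sub>m (vdim E b) 1" using l by (intro eq_matI) (simp_all add: d one)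
    finally have x'0: "path_map E a (nat (b - a)) * ?x' = 0\<^sub>m (vdim E b) 1" unfolding l_def .
    note \<sigma> = interval_map_hom[OF ab P(3) x' x'0]
    let ?\<sigma> = "interval_map n a b E ?x'"
    have "g i * ?\<sigma> i = 1\<^sub>m (vdim ?I i)" for i
    proof (rule interval_hom_determined[OF _ ab(2) P(1) rep_hom_comp[OF \<sigma>(1) g P(1,3,1)] rep_hom_id[OF P(1)]])
      have "g a * ?x' = g a * ?x - g a * f a * w"
        by (simp add: distrib_dims mult_assoc_dims d wd one)
      also have "\<dots> = 1\<^sub>m (vdim ?I a) - 0\<^sub>m 1 1"
        using one by (simp add: G(3) extensionsD(4)[OF ext] wd)
      also have "\<dots> = 1\<^sub>m (vdim ?I a)" using one by (intro eq_matI) auto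
      finally show "g a * ?\<sigma> a = 1\<^sub>m (vdim ?I a)" unfolding \<sigma>(2) .
    qed (use ab in simp)
    then show "\<exists>\<sigma> \<in> rep_hom n ?I E. \<forall>i. g i * \<sigma> i = 1\<^sub>m (vdim ?I i)" using \<sigma>(1) by blast
  qed
qed

lemma ext_projective_interval_iff:
  assumes D: "affine_arc_torsion_class n D" and ab: "a < b" "b < a + n"
  shows "ext_projective n (quotient_class n D) (interval_rep n a b) \<longleftrightarrow>
    arc n a b \<in> D \<and> \<not> (\<exists>b' c. a < b' \<and> b' \<le> b \<and> b < c \<and> c < a + n \<and> arc n b' c \<in> D)"
proof -
  have "arc n b' c \<notin> D" if van: "\<forall>N \<in> quotient_class n D. Ext1_vanishes n (interval_rep n a b) N"
    and h: "a < b'" "b' \<le> b" "b < c" "c < a + n" for b' c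
  proof
    assume "arc n b' c \<in> D"
    then have "interval_rep n b' c \<in> quotient_class n D"
      using interval_in_quotient_class_iff[OF D, of b' c] h by simp
    then show False using van crossing_intervals_extension[OF h] by blast
  qed
  moreover have "Ext1_vanishes n (interval_rep n a b) N"
    if "\<not> (\<exists>b' c. a < b' \<and> b' \<le> b \<and> b < c \<and> c < a + n \<and> arc n b' c \<in> D)" "N \<in> quotient_class n D" for N
    using noncrossing_interval_projective[OF D ab _ that(2)] that(1) by blast
  ultimately show ?thesis
    unfolding ext_projective_def interval_in_quotient_class_iff[OF D ab] by blast
qed


section \<open>The support tau-tilting module\<close>

lemma direct_sum_rep:
  assumes n: "0 < n" and "\<And>M. M \<in> set Ms \<Longrightarrow> rep n M"
  shows "rep n (direct_sum Ms)"
  using assms(2)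
proof (induction Ms)
  case Nil
  have "prerep n (direct_sum [])" by (simp add: prerep_def direct_sum_def)
  then show ?case
    unfolding rep_iff_prerep by (auto simp: path_map_dims direct_sum_def intro!: mat_eq_if_no_entries)
next
  case (Cons U Ms)
  then have U: "rep n U" and V: "rep n (direct_sum Ms)" by auto
  then obtain i1 i2 p1 p2 where E: "prerep n (direct_sum (U # Ms))"
    and "biprod n (direct_sum (U # Ms)) U (direct_sum Ms) i1 i2 p1 p2"
    using direct_sum_Cons_biprod[OF rep_prerep[OF U] rep_prerep[OF V]] by blast
  then show ?case using biprod_rep[OF n _ E U V] by blast
qed

lemma retractI:
  assumes "s \<in> rep_hom n A M" "r \<in> rep_hom n M A" "\<And>i. r i * s i = 1\<^sub>m (vdim A i)"
  shows "retract n A M"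
  using assms unfolding retract_def by blast

lemma retract_trans:
  assumes "retract n A M" "retract n M K" and P: "prerep n A" "prerep n M" "prerep n K"
  shows "retract n A K"
proof -
  obtain s r where s: "s \<in> rep_hom n A M" and r: "r \<in> rep_hom n M A" and rs: "\<And>i. r i * s i = 1\<^sub>m (vdim A i)"
    using assms(1) unfolding retract_def by blast
  obtain u v where u: "u \<in> rep_hom n M K" and v: "v \<in> rep_hom n K M" and vu: "\<And>i. v i * u i = 1\<^sub>m (vdim M i)"
    using assms(2) unfolding retract_def by blast
  note d = rep_homD(3,4)[OF s] rep_homD(3,4)[OF r] rep_homD(3,4)[OF u] rep_homD(3,4)[OF v]
  have "r i * v i * (u i * s i) = 1\<^sub>m (vdim A i)" for i
  proof -
    have "r i * v i * (u i * s i) = r i * (v i * u i * s i)" by (simp add: mult_assoc_dims d)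
    then show ?thesis by (simp add: vu rs d)
  qed
  then show ?thesis by (rule retractI[OF rep_hom_comp[OF s u P] rep_hom_comp[OF v r P(3,2,1)]])
qed

lemma retract_if_isomorphic: "isomorphic n A M \<Longrightarrow> retract n A M"
  unfolding isomorphic_iff retract_def by blast

text \<open>The identity of A is the sum of its two components through U and V. Both are scalars, and
if one of them is not zero, it exhibits A as a retract.\<close>

lemma retract_of_biprod:
  assumes A: "prerep n A" "scalar_endos n A" and P: "prerep n E" "prerep n U" "prerep n V"
    and B: "biprod n E U V i1 i2 p1 p2" and re: "retract n A E"
  shows "retract n A U \<or> retract n A V"
proof -
  obtain s r where s: "s \<in> rep_hom n A E" and r: "r \<in> rep_hom n E A" and rs: "\<And>i. r i * s i = 1\<^sub>m (vdim A i)"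
    using re unfolding retract_def by blast
  note b = biprodD(1-4)[OF B]
  note d = rep_homD(3,4)[OF s] rep_homD(3,4)[OF r] b[THEN rep_homD(3)] b[THEN rep_homD(4)]
  have factor: "\<exists>c. (\<forall>i. r i * i' i * (p' i * s i) = c \<cdot>\<^sub>m 1\<^sub>m (vdim A i)) \<and> (c \<noteq> 0 \<longrightarrow> retract n A W)"
    if i': "i' \<in> rep_hom n W E" and p': "p' \<in> rep_hom n E W" and W: "prerep n W" for i' p' W
  proof -
    have u: "(\<lambda>i. p' i * s i) \<in> rep_hom n A W" by (rule rep_hom_comp[OF s p' A(1) P(1) W])
    have v: "(\<lambda>i. r i * i' i) \<in> rep_hom n W A" by (rule rep_hom_comp[OF i' r W P(1) A(1)])
    obtain c where c: "\<And>i. r i * i' i * (p' i * s i) = c \<cdot>\<^sub>m 1\<^sub>m (vdim A i)"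
      using bspec[OF A(2)[unfolded scalar_endos_def] rep_hom_comp[OF u v A(1) W A(1)]] by blast
    have "retract n A W" if "c \<noteq> 0"
    proof -
      have v': "(\<lambda>i. ((1 / c) \<cdot>\<^sub>m 1\<^sub>m (vdim A i)) * (r i * i' i)) \<in> rep_hom n W A"
        by (rule rep_hom_comp[OF v scalar_hom[OF A(1)] W A(1) A(1)])
      have "((1 / c) \<cdot>\<^sub>m 1\<^sub>m (vdim A i)) * (r i * i' i) * (p' i * s i) = 1\<^sub>m (vdim A i)" for i
      proof -
        have "((1 / c) \<cdot>\<^sub>m 1\<^sub>m (vdim A i)) * (r i * i' i) * (p' i * s i)
            = ((1 / c) \<cdot>\<^sub>m 1\<^sub>m (vdim A i)) * (r i * i' i * (p' i * s i))"
          by (rule mult_assoc_dims) (simp_all add: d rep_homD(3,4)[OF i'] rep_homD(3,4)[OF p'])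
        also have "\<dots> = (1 / c) \<cdot>\<^sub>m (c \<cdot>\<^sub>m 1\<^sub>m (vdim A i))" unfolding c by (rule smult_one_mult) simp
        also have "\<dots> = 1\<^sub>m (vdim A i)" using that by (intro eq_matI) auto
        finally show ?thesis .
      qed
      then show ?thesis by (rule retractI[OF u v'])
    qed
    then show ?thesis using c by blast
  qed
  obtain c where c: "\<And>i. r i * i1 i * (p1 i * s i) = c \<cdot>\<^sub>m 1\<^sub>m (vdim A i)" "c \<noteq> 0 \<longrightarrow> retract n A U"
    using factor[OF b(1,3) P(2)] by blast
  obtain c' where c': "\<And>i. r i * i2 i * (p2 i * s i) = c' \<cdot>\<^sub>m 1\<^sub>m (vdim A i)" "c' \<noteq> 0 \<longrightarrow> retract n A V"
    using factor[OF b(2,4) P(3)] by blast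
  show ?thesis
  proof (cases "c = 0 \<and> c' = 0")
    case False then show ?thesis using c(2) c'(2) by blast
  next
    case True
    have "vdim A i = 0" for i
    proof -
      have "1\<^sub>m (vdim A i) = r i * ((i1 i * p1 i + i2 i * p2 i) * s i)"
        by (simp add: biprodD(9)[OF B] d rs)
      also have "\<dots> = r i * i1 i * (p1 i * s i) + r i * i2 i * (p2 i * s i)"
        by (simp add: distrib_dims mult_assoc_dims d)
      also have "\<dots> = 0\<^sub>m (vdim A i) (vdim A i)" unfolding c(1) c'(1) using True by (intro eq_matI) auto
      finally show ?thesis by (simp add: one_mat_eq_zero_iff)
    qed
    then have "retract n A U"
      by (intro retractI[OF rep_hom_comp[OF s b(3) A(1) P(1,2)] rep_hom_comp[OF b(1) r P(2,1) A(1)]]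
          mat_eq_if_no_entries) (simp_all add: d)
    then show ?thesis ..
  qed
qed

lemma retract_of_direct_sum:
  assumes n: "0 < n" and A: "prerep n A" "scalar_endos n A" "\<not> is_zero A"
    and "\<And>M. M \<in> set Ms \<Longrightarrow> rep n M" and "retract n A (direct_sum Ms)"
  shows "\<exists>M \<in> set Ms. retract n A M"
  using assms(5,6)
proof (induction Ms)
  case Nil
  then obtain s r where s: "s \<in> rep_hom n A (direct_sum [])" and r: "r \<in> rep_hom n (direct_sum []) A"
    and rs: "\<And>i. r i * s i = 1\<^sub>m (vdim A i)" unfolding retract_def by blast
  have "vdim A i = 0" for i
  proof -
    have "r i * s i = 0\<^sub>m (vdim A i) (vdim A i)"
      using rep_homD(3,4)[OF s, of i] rep_homD(3,4)[OF r, of i] by (simp add: mult_inner_zero direct_sum_def)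
    then show ?thesis by (simp add: rs one_mat_eq_zero_iff)
  qed
  then show ?case using A(3) unfolding is_zero_def by blast
next
  case (Cons U Ms)
  have U: "prerep n U" and V: "prerep n (direct_sum Ms)"
    using Cons.prems direct_sum_rep[OF n, of Ms] rep_prerep by auto
  obtain i1 i2 p1 p2 where E: "prerep n (direct_sum (U # Ms))"
    and B: "biprod n (direct_sum (U # Ms)) U (direct_sum Ms) i1 i2 p1 p2"
    using direct_sum_Cons_biprod[OF U V] by blast
  show ?case using retract_of_biprod[OF A(1,2) E U V B Cons.prems(2)] Cons by auto
qed

lemma direct_sum_member_retract:
  assumes n: "0 < n" and "\<And>M. M \<in> set Ms \<Longrightarrow> rep n M" and "N \<in> set Ms"
  shows "retract n N (direct_sum Ms)"
  using assms(2,3)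
proof (induction Ms)
  case (Cons U Ms)
  have U: "prerep n U" and V: "prerep n (direct_sum Ms)"
    using Cons.prems direct_sum_rep[OF n, of Ms] rep_prerep by auto
  obtain i1 i2 p1 p2 where E: "prerep n (direct_sum (U # Ms))"
    and B: "biprod n (direct_sum (U # Ms)) U (direct_sum Ms) i1 i2 p1 p2"
    using direct_sum_Cons_biprod[OF U V] by blast
  have "retract n U (direct_sum (U # Ms))" "retract n (direct_sum Ms) (direct_sum (U # Ms))"
    using biprodD[OF B] unfolding retract_def by blast+
  then show ?case
    using Cons retract_trans[OF _ _ _ V E] rep_prerep by auto
qed simp

text \<open>Build the list from its end and discard an element that is related to one already listed.\<close>

lemma representatives:
  assumes "finite X" and "\<And>x. x \<in> X \<Longrightarrow> R x x"
  shows "\<exists>xs. set xs \<subseteq> X \<and> sorted_wrt (\<lambda>x y. \<not> R x y) xs \<and> (\<forall>x \<in> X. \<exists>y \<in> set xs. R x y)"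
  using assms
proof (induction X rule: finite_induct)
  case empty then show ?case by (intro exI[of _ "[]"]) simp
next
  case (insert x X)
  then obtain xs where xs: "set xs \<subseteq> X" "sorted_wrt (\<lambda>x y. \<not> R x y) xs" "\<forall>x \<in> X. \<exists>y \<in> set xs. R x y"
    by auto
  show ?case
  proof (cases "\<exists>y \<in> set xs. R x y")
    case True then show ?thesis using xs by (intro exI[of _ xs]) auto
  next
    case False then show ?thesis using xs insert.prems by (intro exI[of _ "x # xs"]) auto
  qed
qed

lemma ext_projective_isomorphic:
  assumes n: "0 < n" and T: "torsion_class n T" and M: "ext_projective n T M"
    and iso: "isomorphic n M M'" and M': "rep n M'"
  shows "ext_projective n T M'"
proof -
  have "M' \<in> T" using T M iso M' unfolding torsion_class_def ext_projective_def by blast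
  moreover have "rep n N" if "N \<in> T" for N using T that unfolding torsion_class_def by blast
  ultimately show ?thesis
    using M Ext1_vanishes_isomorphic[OF n _ M' _ iso] unfolding ext_projective_def by blast
qed

definition complete_summands :: "int \<Rightarrow> qrep set \<Rightarrow> qrep list \<Rightarrow> bool" where
  "complete_summands n T Ms \<longleftrightarrow> (\<forall>M \<in> set Ms. indecomposable n M \<and> ext_projective n T M) \<and>
     sorted_wrt (\<lambda>M N. \<not> isomorphic n M N) Ms \<and>
     (\<forall>M. indecomposable n M \<and> ext_projective n T M \<longrightarrow> (\<exists>N \<in> set Ms. isomorphic n M N))"

text \<open>Up to isomorphism the indecomposables are the intervals with left end in one period, which are
finitely many.\<close>

lemma complete_summands_exist:
  assumes n: "0 < n" and T: "torsion_class n T"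
  shows "\<exists>Ms. complete_summands n T Ms"
proof -
  define Y where "Y = (\<lambda>(a, b). interval_rep n a b) ` {(a, b) \<in> {0..n} \<times> {0..2 * n}. a < b \<and> b < a + n}"
  define X where "X = {M \<in> Y. ext_projective n T M}"
  have Y: "\<exists>a b. M = interval_rep n a b \<and> a < b \<and> b < a + n" if "M \<in> Y" for M
    using that unfolding Y_def by auto
  have indec: "indecomposable n M" if "M \<in> Y" for M using Y[OF that] interval_indecomposable by blast
  then have rep: "rep n M" if "M \<in> Y" for M using that unfolding indecomposable_def by blast
  have "finite {(a, b) \<in> {0..n} \<times> {0..2 * n}. a < b \<and> b < a + n}"
    by (rule finite_subset[of _ "{0..n} \<times> {0..2 * n}"]) (blast, simp)
  then have "finite Y" unfolding Y_def by (rule finite_imageI)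
  then have "finite X" unfolding X_def by simp
  moreover have "isomorphic n M M" if "M \<in> X" for M
    using that rep isomorphic_refl rep_prerep unfolding X_def by blast
  ultimately obtain Ms where Ms: "set Ms \<subseteq> X" "sorted_wrt (\<lambda>M N. \<not> isomorphic n M N) Ms"
    "\<forall>M \<in> X. \<exists>N \<in> set Ms. isomorphic n M N"
    using representatives[of X "isomorphic n"] by blast
  have "\<exists>N \<in> set Ms. isomorphic n M N" if M: "indecomposable n M" "ext_projective n T M" for M
  proof -
    obtain a b where ab: "a < b" "b < a + n" and iso: "isomorphic n M (interval_rep n a b)"
      using indecomposable_is_interval[OF n M(1)] by blast
    define k where "k = - (a div n)"
    have ak: "a + k * n = a mod n" by (simp add: k_def minus_div_mult_eq_mod[symmetric])
    have "0 \<le> a + k * n" "a + k * n < n" unfolding ak using n by auto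
    then have "(a + k * n, b + k * n) \<in> {(a, b) \<in> {0..n} \<times> {0..2 * n}. a < b \<and> b < a + n}"
      using ab by auto
    then have "interval_rep n (a + k * n) (b + k * n) \<in> Y" unfolding Y_def by (rule rev_image_eqI) simp
    then have IY: "interval_rep n a b \<in> Y" unfolding interval_translate .
    have "ext_projective n T (interval_rep n a b)"
      by (rule ext_projective_isomorphic[OF n T M(2) iso rep[OF IY]])
    then have "interval_rep n a b \<in> X" using IY unfolding X_def by blast
    then obtain N where N: "N \<in> set Ms" "isomorphic n (interval_rep n a b) N" using Ms(3) by blast
    have "rep n M" "rep n N" using M(1) N(1) Ms(1) rep unfolding indecomposable_def X_def by auto
    then show ?thesis using N isomorphic_trans[OF iso N(2)] rep[OF IY] rep_prerep by blast
  qed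
  moreover have "indecomposable n M \<and> ext_projective n T M" if "M \<in> set Ms" for M
    using that Ms(1) indec unfolding X_def by blast
  ultimately show ?thesis using Ms(2) unfolding complete_summands_def by blast
qed

text \<open>Being a retract of the direct sum passes to a single member of the list, and an indecomposable with
an interval as a retract is isomorphic to it. Ext-projectivity is invariant under isomorphism.\<close>

lemma summand_stau_tilting_module_iff:
  assumes n: "0 < n" and T: "torsion_class n T" and ab: "a < b" "b < a + n"
  shows "summand n (interval_rep n a b) (stau_tilting_module n T) \<longleftrightarrow> ext_projective n T (interval_rep n a b)"
proof -
  let ?I = "interval_rep n a b" and ?P = "stau_tilting_module n T"
  have stau: "?P = (SOME P. rep n P \<and> (\<exists>Ms. complete_summands n T Ms \<and> isomorphic n P (direct_sum Ms)))"
    unfolding stau_tilting_module_def complete_summands_def by (simp add: conj_assoc)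
  have reps: "rep n M" if "complete_summands n T Ms" "M \<in> set Ms" for Ms M
    using that unfolding complete_summands_def indecomposable_def by blast
  obtain Ms0 where Ms0: "complete_summands n T Ms0" using complete_summands_exist[OF n T] by blast
  have rep0: "rep n (direct_sum Ms0)" by (rule direct_sum_rep[OF n reps[OF Ms0]])
  then have "\<exists>P. rep n P \<and> (\<exists>Ms. complete_summands n T Ms \<and> isomorphic n P (direct_sum Ms))"
    using Ms0 isomorphic_refl[OF rep_prerep[OF rep0]] by blast
  from someI_ex[OF this] obtain Ms where P: "rep n ?P" and Ms: "complete_summands n T Ms"
    and iso: "isomorphic n ?P (direct_sum Ms)" unfolding stau[symmetric] by blast
  have rS: "rep n (direct_sum Ms)" by (rule direct_sum_rep[OF n reps[OF Ms]])
  have I: "rep n ?I" using ab by (intro interval_rep_is_rep) auto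
  note pre = rep_prerep[OF I] rep_prerep[OF P] rep_prerep[OF rS]
  have "summand n ?I ?P \<longleftrightarrow> retract n ?I ?P" by (rule summand_iff_retract[OF n ab P])
  also have "\<dots> \<longleftrightarrow> retract n ?I (direct_sum Ms)"
    using retract_trans[OF _ retract_if_isomorphic[OF iso] pre]
      retract_trans[OF _ retract_if_isomorphic[OF isomorphic_sym[OF iso]] pre(1,3,2)] by blast
  also have "\<dots> \<longleftrightarrow> ext_projective n T ?I"
  proof
    assume "retract n ?I (direct_sum Ms)"
    then obtain M where M: "M \<in> set Ms" and re: "retract n ?I M"
      using retract_of_direct_sum[OF n pre(1) interval_scalar_endos[OF ab] interval_not_zero[OF ab(1)]]
        reps[OF Ms] by blast
    have MM: "indecomposable n M" "ext_projective n T M" using Ms M unfolding complete_summands_def by auto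
    then have "isomorphic n M ?I"
      using re indecomposable_retract[OF n ab] unfolding retract_def by blast
    then show "ext_projective n T ?I" using ext_projective_isomorphic[OF n T MM(2) _ I] by blast
  next
    assume "ext_projective n T ?I"
    then obtain N where N: "N \<in> set Ms" "isomorphic n ?I N"
      using Ms interval_indecomposable[OF ab] unfolding complete_summands_def by blast
    then show "retract n ?I (direct_sum Ms)"
      using retract_trans[OF retract_if_isomorphic[OF N(2)] direct_sum_member_retract[OF n reps[OF Ms] N(1)]]
        pre reps[OF Ms N(1)] rep_prerep by blast
  qed
  finally show ?thesis .
qed

section \<open>Simple subquotients\<close>

lemma surj_vdim_zero:
  assumes "f \<in> rep_surj n M N" "vdim M i = 0"
  shows "vdim N i = 0"
proof -
  obtain G where f: "f \<in> rep_hom n M N" and G: "\<And>i. dim_row (G i) = vdim M i" "\<And>i. dim_col (G i) = vdim N i"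
    "\<And>i. f i * G i = 1\<^sub>m (vdim N i)"
    using rep_surjE[OF assms(1)] by metis
  have "f i * G i = 0\<^sub>m (vdim N i) (vdim N i)"
    using assms(2) by (simp add: mult_inner_zero rep_homD(3,4)[OF f] G(1,2))
  then show ?thesis by (simp add: G(3) one_mat_eq_zero_iff)
qed

lemma inj_vdim_zero:
  assumes "f \<in> rep_inj n M N" "vdim N i = 0"
  shows "vdim M i = 0"
proof -
  note f = rep_injD[OF assms(1)]
  have e: "f i * 1\<^sub>m (vdim M i) = f i * 0\<^sub>m (vdim M i) (vdim M i)"
    using assms(2) by (intro mat_eq_if_no_entries) (simp_all add: rep_homD(3,4)[OF f(1)])
  have "1\<^sub>m (vdim M i) = (0\<^sub>m (vdim M i) (vdim M i) :: complex mat)"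
    by (rule f(2)[OF _ _ _ e]) simp_all
  then show ?thesis by (simp add: one_mat_eq_zero_iff)
qed

text \<open>The dimension at i is the sum of those of the interval summands, so one of them contains i.\<close>

lemma quotient_class_support:
  assumes n: "0 < n" and D: "affine_arc_torsion_class n D" and M: "M \<in> quotient_class n D" "vdim M i \<noteq> 0"
  shows "\<exists>a b. a \<le> i \<and> i < b \<and> arc n a b \<in> D"
proof -
  have "rep n M" using M(1) unfolding quotient_class_def by blast
  with n show ?thesis using M
  proof (induction rule: rep_induct)
    case (zero M) then show ?case by (simp add: is_zero_def)
  next
    case (split M a b Q s i2 r p2)
    let ?I = "interval_rep n a b"
    have I: "rep n ?I" using split by (intro interval_rep_is_rep) auto
    have quot: "is_quotient n Q M" "is_quotient n ?I M"
      using biprod_quotients[OF split(5) I split(4)] by auto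
    show ?case
    proof (cases "supp n a b i")
      case True
      then obtain k where k: "a \<le> i + k * n" "i + k * n \<le> b - 1" unfolding supp_def by blast
      have "arc n a b \<in> D" using split.prems(1) quot(2) split(2,3) unfolding quotient_class_def by blast
      then have "arc n (a + (- k) * n) (b + (- k) * n) \<in> D" unfolding arc_translate .
      then show ?thesis using k by (intro exI[of _ "a + (- k) * n"] exI[of _ "b + (- k) * n"]) auto
    next
      case False
      then have "vdim Q i \<noteq> 0" using split(6)[of i] split.prems(2) by (simp add: interval_vdim)
      moreover have "Q \<in> quotient_class n D"
        using split.prems quot(1) quotient_class_torsion[OF n D] unfolding torsion_class_def by blast
      ultimately show ?thesis using split.IH by blast
    qed
  qed
qed

lemma arc_in_class_length:
  assumes "affine_arc_torsion_class n D" "arc n a b \<in> D"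
  shows "b - a < n"
proof -
  have "arc n a b \<in> real_arcs n" using assms unfolding affine_arc_torsion_class_def by blast
  then obtain x y where xy: "arc n a b = arc n x y" "y - x < n" unfolding real_arcs_def by blast
  have "(a, b) \<in> arc n a b" unfolding arc_def by (auto intro!: exI[of _ 0])
  then show ?thesis using xy(2) unfolding xy(1) by (auto simp: arc_def)
qed

text \<open>If a' \<le> a < b', then M(a,b') is a subrepresentation of M(a',b') and has the simple module at a as
its top.\<close>

lemma simple_subquotient_iff:
  assumes n: "2 \<le> n" and D: "affine_arc_torsion_class n D"
  shows "(\<exists>M \<in> quotient_class n D. subquotient n (interval_rep n a (a + 1)) M) \<longleftrightarrow>
    (\<exists>a' b'. a' \<le> a \<and> a < b' \<and> arc n a' b' \<in> D)"
proof
  have n0: "0 < n" using n by simp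
  assume "\<exists>M \<in> quotient_class n D. subquotient n (interval_rep n a (a + 1)) M"
  then obtain M U f g where M: "M \<in> quotient_class n D" and f: "f \<in> rep_inj n U M"
    and g: "g \<in> rep_surj n U (interval_rep n a (a + 1))"
    unfolding subquotient_def is_quotient_def by blast
  have "vdim (interval_rep n a (a + 1)) a \<noteq> 0" by (simp add: interval_vdim supp_self)
  then have "vdim M a \<noteq> 0" using inj_vdim_zero[OF f, of a] surj_vdim_zero[OF g, of a] by auto
  then show "\<exists>a' b'. a' \<le> a \<and> a < b' \<and> arc n a' b' \<in> D" by (rule quotient_class_support[OF n0 D M])
next
  assume "\<exists>a' b'. a' \<le> a \<and> a < b' \<and> arc n a' b' \<in> D"
  then obtain a' b' where h: "a' \<le> a" "a < b'" and arc: "arc n a' b' \<in> D" by blast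
  have len: "b' < a' + n" using arc_in_class_length[OF D arc] by simp
  let ?M = "interval_rep n a' b'" and ?U = "interval_rep n a b'" and ?S = "interval_rep n a (a + 1)"
  have M: "?M \<in> quotient_class n D" using interval_in_quotient_class_iff[OF D] arc h len by simp
  have U: "rep n ?U" and S: "rep n ?S" using h len n by (auto intro!: interval_rep_is_rep)
  have sub: "supp n a b' i \<Longrightarrow> supp n a' b' i" "supp n a (a + 1) i \<Longrightarrow> supp n a b' i" for i
    using h unfolding supp_def by force+
  have "(\<lambda>i. ones (vdim ?M i) (vdim ?U i)) \<in> rep_inj n ?U ?M"
  proof (rule rep_injI[of _ _ _ _ "\<lambda>i. ones (vdim ?U i) (vdim ?M i)"])
    show "(\<lambda>i. ones (vdim ?M i) (vdim ?U i)) \<in> rep_hom n ?U ?M"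
      using h len by (intro interval_canonical_map) auto
    show "ones (vdim ?U i) (vdim ?M i) * ones (vdim ?M i) (vdim ?U i) = 1\<^sub>m (vdim ?U i)" for i
      using sub(1)[of i] by (auto simp: interval_vdim ones_mult ones_diag)
  qed simp
  moreover have "is_quotient n ?S ?U"
  proof (rule is_quotientI[OF S, of "\<lambda>i. ones (vdim ?S i) (vdim ?U i)" _ "\<lambda>i. ones (vdim ?U i) (vdim ?S i)"])
    show "(\<lambda>i. ones (vdim ?S i) (vdim ?U i)) \<in> rep_hom n ?U ?S"
      using h len by (intro interval_canonical_map) auto
    show "ones (vdim ?S i) (vdim ?U i) * ones (vdim ?U i) (vdim ?S i) = 1\<^sub>m (vdim ?S i)" for i
      using sub(2)[of i] by (auto simp: interval_vdim ones_mult ones_diag)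
  qed simp
  ultimately show "\<exists>M \<in> quotient_class n D. subquotient n ?S M"
    using M U unfolding subquotient_def by blast
qed

section \<open>The triangulation\<close>

theorem theorem7p5:
  fixes n :: int and D :: "(int \<times> int) set set"
  assumes "2 \<le> n" and "affine_arc_torsion_class n D"
  shows "triangulation n (psi n D) =
     {tagged_a n a b | a b. a < b \<and> b < a + n \<and> arc n a b \<in> D \<and>
        \<not> (\<exists>b' c. a < b' \<and> b' \<le> b \<and> b < c \<and> c < a + n \<and> arc n b' c \<in> D)} \<union>
     {tagged_r n a | a. \<not> (\<exists>a' b'. a' \<le> a \<and> a < b' \<and> arc n a' b' \<in> D)}"
proof -
  let ?T = "quotient_class n D"
  have n: "0 < n" using assms(1) by simp
  have "summand n (interval_rep n a b) (stau_tilting_module n ?T) \<longleftrightarrow> arc n a b \<in> D \<and>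
      \<not> (\<exists>b' c. a < b' \<and> b' \<le> b \<and> b < c \<and> c < a + n \<and> arc n b' c \<in> D)"
    if "a < b" "b < a + n" for a b
    using summand_stau_tilting_module_iff[OF n quotient_class_torsion[OF n assms(2)] that]
      ext_projective_interval_iff[OF assms(2) that] by simp
  then have "{tagged_a n a b | a b. a < b \<and> b < a + n \<and> summand n (interval_rep n a b) (stau_tilting_module n ?T)} =
     {tagged_a n a b | a b. a < b \<and> b < a + n \<and> arc n a b \<in> D \<and>
        \<not> (\<exists>b' c. a < b' \<and> b' \<le> b \<and> b < c \<and> c < a + n \<and> arc n b' c \<in> D)}"
    by (intro Collect_cong ex_cong1 conj_cong refl) blast+
  moreover have "{tagged_r n a | a. \<not> (\<exists>M \<in> ?T. subquotient n (interval_rep n a (a + 1)) M)} =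
     {tagged_r n a | a. \<not> (\<exists>a' b'. a' \<le> a \<and> a < b' \<and> arc n a' b' \<in> D)}"
    by (simp only: simple_subquotient_iff[OF assms])
  ultimately show ?thesis unfolding triangulation_def psi_eq_quotient_class[OF n assms(2)] by simp
qed

end
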